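(* Let $(L,\le,\perp,\sim)$ be an espalier. Then the partial commutative monoid $L/{\sim}$ of all $\sim$-equivalence classes of elements of $L$ is a continuous dimension scale.
   Context: **Espaliers.** An espalier is a structure $(L,\le,\perp,\sim)$, where $(L,\le)$ is a (nonempty) partially ordered set, $\perp$ is a binary relation on $L$ and $\sim$ is an equivalence relation on $L$, such that: (L1) Every nonempty subset of $L$ has an infimum (equivalently, every subset with an upper bound has a supremum). In particular $L$ has a least element $0$; $a\vee b$ exists iff $\{a,b\}$ has an upper bound. (L2) For all $a,b,c\in L$: (i) $a\perp 0$; (ii) $a\perp b$ implies $b\perp a$; (iii) $a\le b$ and $b\perp c$ imply $a\perp c$; (iv) if $\{a,b,c\}$ has an upper bound, $a\perp b$ and $(a\vee b)\perp c$, then $a\perp(b\vee c)$; (v) $a\perp a$ implies $a=0$. Write $c=a\oplus b$ if $c=a\vee b$ and $a\perp b$; by (i)--(iv) this is an associative, commutative partial operation with zero $0$, so finite sums $\oplus_{i\in J}a_i$ make sense (when defined). A family $(a_i)_{i\in I}$ is orthogonal if it has an upper bound and $\oplus_{i\in J}a_i$ is defined for every finite $J\subseteq I$; then $\oplus_{i\in I}a_i:=\bigvee_{i\in I}a_i$. (L3) If $a\le b$, then there is $x\in L$ with $a\oplus x=b$. (L4) If $(b_i)_{i\in I}$ is orthogonal and $a\perp(\oplus_{i\in J}b_i)$ for all finite $J\subseteq I$, then $a\perp(\oplus_{i\in I}b_i)$. (L5) $x\sim0$ implies $x=0$. (L6) If $(b_i)_{i\in I}$ is orthogonal and $a\sim\oplus_{i\in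 I}b_i$, then $a=\oplus_{i\in I}a_i$ for some $a_i\sim b_i$ ($i\in I$). (L7) If $(a_i)_{i\in I}$, $(b_i)_{i\in I}$ are orthogonal and $a_i\sim b_i$ for all $i$, then $\oplus_{i\in I}a_i\sim\oplus_{i\in I}b_i$. (L8) If $a\vee b$ exists, $(a\wedge b)\oplus x=a$ and $b\oplus y=a\vee b$, then $x\sim y$. **The partial monoid $L/{\sim}$.** Denote by $\Delta(a)$ the $\sim$-class of $a$. For $\alpha,\beta,\gamma\in L/{\sim}$, put $\gamma=\alpha+\beta$ iff there are $a,b,c\in L$ with $\alpha=\Delta(a)$, $\beta=\Delta(b)$, $\gamma=\Delta(c)$ and $c=a\oplus b$ (this is well defined by (L7)). The zero element is $\Delta(0)$. **Partial commutative monoids.** A partial commutative monoid is $(S,+,0)$ with $+$ a partial binary operation on $S$ and $0\in S$ such that: $(a+b)+c$ is defined iff $a+(b+c)$ is, and then they are equal; $a+b$ is defined iff $b+a$ is, and then they are equal; $a+0=a$ for all $a$. Algebraic preordering: $a\le b$ iff $a+x=b$ for some $x\in S$. In such an $S$, write $a\perp b$ if $x\le a$ and $x\le b$ imply $x=0$; $X^\perp=\{s\in S: s\perp x\ \forall x\in X\}$ and $x^\perp=\{x\}^\perp$. A projection of $S$ is a map $p\colon S\to S$ with $p(0)=0$, with $p(a)+p(b)$ defined and equal to $p(a+b)$ whenever $a+b$ is defined, such that for every $x\in S$ there is $y\in(pS)^\perp$ with $x=p(x)+y$. Projections are ordered by $p\le q$ iff $pS\subseteq qS$. If (M1) below holds,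 then for each projection $p$ there is a unique projection $p^\perp$ with $p^\perp S=(pS)^\perp$, and $x=p(x)+p^\perp(x)$ for all $x$. An element $a$ is directly finite if $x+a=a$ implies $x=0$; it is purely infinite if $a+a$ is defined and equal to $a$. Write $a\ll_{\mathrm{rem}}b$ if $a\le b$ and, for all $x\in S$, $b\le a+x$ implies $b\le x$. **Continuous dimension scales.** A continuous dimension scale is a partial commutative monoid $S$ such that: (M1) $S$ has refinement (if $a_0+a_1=b_0+b_1$, there are $c_{ij}$, $i,j<2$, with $a_i=c_{i0}+c_{i1}$ and $b_j=c_{0j}+c_{1j}$), and the algebraic preordering is antisymmetric. (M2) Every nonempty subset of $S$ has an infimum. (M3) For all $x,y\in S$ there is a projection $p$ of $S$ with $p(x)\le p(y)$ and $p^\perp(y)\le p^\perp(x)$. (M4) For all $a,b\in S$ there is a largest projection $p$ of $S$ with $p(a)\le p(b)$. (M5) Every element is the sum of a directly finite element and a purely infinite element. (M6) If $a,b$ are purely infinite and $a\ll_{\mathrm{rem}}b$, then the set of all purely infinite $x\in S$ with $a\ll_{\mathrm{rem}}x$ and $x^\perp=b^\perp$ has a least element. *)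

theory Defs
  imports "HOL-Library.Lub_Glb" "HOL-Library.FuncSet"
begin

section \<open>Espaliers\<close>

text \<open>
  The underlying poset is a type of class \<open>order\<close>. Partially defined operations are written
  relationally: \<open>isLub UNIV {a, b} c\<close> says that the join of \<open>a\<close> and \<open>b\<close> exists and equals \<open>c\<close>.
\<close>

definition lzero :: "'a::order" where
  "lzero = (THE z. \<forall>x. z \<le> x)"

definition osum :: "('a::order \<Rightarrow> 'a \<Rightarrow> bool) \<Rightarrow> 'a \<Rightarrow> 'a \<Rightarrow> 'a \<Rightarrow> bool" where
  "osum perp a b c \<longleftrightarrow> isLub UNIV {a, b} c \<and> perp a b"

text \<open>
  \<open>fin_osum perp a J s\<close> says that the finite orthogonal sum of \<open>(a i)\<close> over \<open>i \<in> J\<close> is defined and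
  equals \<open>s\<close>. The enumeration of \<open>J\<close> used in the derivation is irrelevant in an espalier.
\<close>

inductive fin_osum :: "('a::order \<Rightarrow> 'a \<Rightarrow> bool) \<Rightarrow> ('i \<Rightarrow> 'a) \<Rightarrow> 'i set \<Rightarrow> 'a \<Rightarrow> bool"
  for perp :: "'a::order \<Rightarrow> 'a \<Rightarrow> bool" and a :: "'i \<Rightarrow> 'a" where
  empty: "fin_osum perp a {} lzero"
| insert: "\<lbrakk>i \<notin> J; fin_osum perp a J s; osum perp s (a i) t\<rbrakk> \<Longrightarrow> fin_osum perp a (insert i J) t"

definition orthogonal_family :: "('a::order \<Rightarrow> 'a \<Rightarrow> bool) \<Rightarrow> 'i set \<Rightarrow> ('i \<Rightarrow> 'a) \<Rightarrow> bool" where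
  "orthogonal_family perp I a \<longleftrightarrow>
     (\<exists>u. \<forall>i\<in>I. a i \<le> u) \<and> (\<forall>J. finite J \<and> J \<subseteq> I \<longrightarrow> (\<exists>s. fin_osum perp a J s))"

definition big_osum :: "('a::order \<Rightarrow> 'a \<Rightarrow> bool) \<Rightarrow> 'i set \<Rightarrow> ('i \<Rightarrow> 'a) \<Rightarrow> 'a \<Rightarrow> bool" where
  "big_osum perp I a s \<longleftrightarrow> orthogonal_family perp I a \<and> isLub UNIV (a ` I) s"

text \<open>
  A locale cannot quantify over index types, so \<open>L4\<close>, \<open>L6\<close>, \<open>L7\<close> are stated for families indexed by
  subsets of the espalier itself. This loses nothing, since the nonzero members of an orthogonal
  family are pairwise distinct: see \<open>L4_any_index\<close>, \<open>L6_any_index\<close>, \<open>L7_any_index\<close> below.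
\<close>

locale espalier =
  fixes perp :: "'a::order \<Rightarrow> 'a \<Rightarrow> bool" and sim :: "'a \<Rightarrow> 'a \<Rightarrow> bool"
  assumes sim_equiv: "equivp sim"
    and L1: "\<And>A::'a set. A \<noteq> {} \<Longrightarrow> \<exists>m. isGlb UNIV A m"
    and L2_i: "\<And>a. perp a lzero"
    and L2_ii: "\<And>a b. perp a b \<Longrightarrow> perp b a"
    and L2_iii: "\<And>a b c. \<lbrakk>a \<le> b; perp b c\<rbrakk> \<Longrightarrow> perp a c"
    and L2_iv: "\<And>a b c u ab bc. \<lbrakk>isUb UNIV {a, b, c} u; perp a b; isLub UNIV {a, b} ab; perp ab c;
                  isLub UNIV {b, c} bc\<rbrakk> \<Longrightarrow> perp a bc"
    and L2_v: "\<And>a. perp a a \<Longrightarrow> a = lzero"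
    and L3: "\<And>a b. a \<le> b \<Longrightarrow> \<exists>x. osum perp a x b"
    and L4: "\<And>(I::'a set) b a t. \<lbrakk>big_osum perp I b t;
               \<And>J s. \<lbrakk>finite J; J \<subseteq> I; fin_osum perp b J s\<rbrakk> \<Longrightarrow> perp a s\<rbrakk> \<Longrightarrow> perp a t"
    and L5: "\<And>x. sim x lzero \<Longrightarrow> x = lzero"
    and L6: "\<And>(I::'a set) b a t. \<lbrakk>big_osum perp I b t; sim a t\<rbrakk> \<Longrightarrow>
               \<exists>c. big_osum perp I c a \<and> (\<forall>i\<in>I. sim (c i) (b i))"
    and L7: "\<And>(I::'a set) a b s t. \<lbrakk>big_osum perp I a s; big_osum perp I b t;
               \<And>i. i \<in> I \<Longrightarrow> sim (a i) (b i)\<rbrakk> \<Longrightarrow> sim s t"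
    and L8: "\<And>a b m j x y. \<lbrakk>isLub UNIV {a, b} j; isGlb UNIV {a, b} m;
               osum perp m x a; osum perp b y j\<rbrakk> \<Longrightarrow> sim x y"

section \<open>The quotient of an espalier\<close>

definition dim_set :: "('a \<Rightarrow> 'a \<Rightarrow> bool) \<Rightarrow> 'a set set" where
  "dim_set sim = UNIV // {(x, y). sim x y}"

definition dim_class :: "('a \<Rightarrow> 'a \<Rightarrow> bool) \<Rightarrow> 'a \<Rightarrow> 'a set" where
  "dim_class sim a = {(x, y). sim x y} `` {a}"

definition dim_add :: "('a::order \<Rightarrow> 'a \<Rightarrow> bool) \<Rightarrow> ('a \<Rightarrow> 'a \<Rightarrow> bool) \<Rightarrow>
    'a set \<Rightarrow> 'a set \<Rightarrow> 'a set \<Rightarrow> bool" where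
  "dim_add perp sim \<alpha> \<beta> \<gamma> \<longleftrightarrow>
     (\<exists>a b c. \<alpha> = dim_class sim a \<and> \<beta> = dim_class sim b \<and> \<gamma> = dim_class sim c \<and> osum perp a b c)"

section \<open>Partial commutative monoids\<close>

text \<open>
  A partial binary operation on \<open>S\<close> is given by its graph: \<open>add a b c\<close> says that \<open>a + b\<close> is defined
  and equals \<open>c\<close>.
\<close>

locale partial_comm_monoid =
  fixes S :: "'s set" and add :: "'s \<Rightarrow> 's \<Rightarrow> 's \<Rightarrow> bool" and zero :: 's
  assumes add_closed: "\<And>a b c. add a b c \<Longrightarrow> a \<in> S \<and> b \<in> S \<and> c \<in> S"
    and add_functional: "\<And>a b c d. \<lbrakk>add a b c; add a b d\<rbrakk> \<Longrightarrow> c = d"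
    and zero_closed: "zero \<in> S"
    and add_assoc: "\<And>a b c s. (\<exists>d. add a b d \<and> add d c s) \<longleftrightarrow> (\<exists>e. add b c e \<and> add a e s)"
    and add_commute: "\<And>a b c. add a b c \<longleftrightarrow> add b a c"
    and add_zero: "\<And>a. a \<in> S \<Longrightarrow> add a zero a"
begin

definition le :: "'s \<Rightarrow> 's \<Rightarrow> bool" where
  "le a b \<longleftrightarrow> (\<exists>x\<in>S. add a x b)"

definition orth :: "'s \<Rightarrow> 's \<Rightarrow> bool" where
  "orth a b \<longleftrightarrow> (\<forall>x\<in>S. le x a \<and> le x b \<longrightarrow> x = zero)"

definition polar :: "'s set \<Rightarrow> 's set" where
  "polar X = {s\<in>S. \<forall>x\<in>X. orth s x}"

text \<open>
  Projections are taken extensional outside \<open>S\<close>, so that equality of HOL functions is equality of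
  maps from \<open>S\<close> to \<open>S\<close>.
\<close>

definition projection :: "('s \<Rightarrow> 's) \<Rightarrow> bool" where
  "projection p \<longleftrightarrow>
     p \<in> S \<rightarrow>\<^sub>E S \<and> p zero = zero \<and>
     (\<forall>a b c. add a b c \<longrightarrow> add (p a) (p b) (p c)) \<and>
     (\<forall>x\<in>S. \<exists>y\<in>polar (p ` S). add (p x) y x)"

definition proj_le :: "('s \<Rightarrow> 's) \<Rightarrow> ('s \<Rightarrow> 's) \<Rightarrow> bool" where
  "proj_le p q \<longleftrightarrow> p ` S \<subseteq> q ` S"

text \<open>Well defined in the presence of refinement and antisymmetry, see \<open>proj_compl_unique\<close> below.\<close>

definition proj_compl :: "('s \<Rightarrow> 's) \<Rightarrow> 's \<Rightarrow> 's" where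
  "proj_compl p = (THE q. projection q \<and> q ` S = polar (p ` S))"

definition directly_finite :: "'s \<Rightarrow> bool" where
  "directly_finite a \<longleftrightarrow> a \<in> S \<and> (\<forall>x\<in>S. add x a a \<longrightarrow> x = zero)"

definition purely_infinite :: "'s \<Rightarrow> bool" where
  "purely_infinite a \<longleftrightarrow> a \<in> S \<and> add a a a"

text \<open>In the condition \<open>b \<le> a + x\<close> the sum \<open>a + x\<close> is required to be defined.\<close>

definition rem_ll :: "'s \<Rightarrow> 's \<Rightarrow> bool" where
  "rem_ll a b \<longleftrightarrow> le a b \<and> (\<forall>x\<in>S. (\<exists>t. add a x t \<and> le b t) \<longrightarrow> le b x)"

definition is_inf :: "'s set \<Rightarrow> 's \<Rightarrow> bool" where
  "is_inf X m \<longleftrightarrow> m \<in> S \<and> (\<forall>x\<in>X. le m x) \<and> (\<forall>l\<in>S. (\<forall>x\<in>X. le l x) \<longrightarrow> le l m)"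

end

locale refined_comm_monoid = partial_comm_monoid +
  assumes refinement: "\<And>a\<^sub>0 a\<^sub>1 b\<^sub>0 b\<^sub>1 s. \<lbrakk>add a\<^sub>0 a\<^sub>1 s; add b\<^sub>0 b\<^sub>1 s\<rbrakk> \<Longrightarrow>
      \<exists>c\<^sub>0\<^sub>0 c\<^sub>0\<^sub>1 c\<^sub>1\<^sub>0 c\<^sub>1\<^sub>1. add c\<^sub>0\<^sub>0 c\<^sub>0\<^sub>1 a\<^sub>0 \<and> add c\<^sub>1\<^sub>0 c\<^sub>1\<^sub>1 a\<^sub>1 \<and> add c\<^sub>0\<^sub>0 c\<^sub>1\<^sub>0 b\<^sub>0 \<and> add c\<^sub>0\<^sub>1 c\<^sub>1\<^sub>1 b\<^sub>1"
    and le_antisym: "\<And>a b. \<lbrakk>le a b; le b a\<rbrakk> \<Longrightarrow> a = b"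

section \<open>Continuous dimension scales\<close>

locale continuous_dimension_scale = refined_comm_monoid +
  assumes M2: "\<And>X. \<lbrakk>X \<subseteq> S; X \<noteq> {}\<rbrakk> \<Longrightarrow> \<exists>m. is_inf X m"
    and M3: "\<And>x y. \<lbrakk>x \<in> S; y \<in> S\<rbrakk> \<Longrightarrow>
      \<exists>p. projection p \<and> le (p x) (p y) \<and> le (proj_compl p y) (proj_compl p x)"
    and M4: "\<And>a b. \<lbrakk>a \<in> S; b \<in> S\<rbrakk> \<Longrightarrow>
      \<exists>p. projection p \<and> le (p a) (p b) \<and>
          (\<forall>q. projection q \<and> le (q a) (q b) \<longrightarrow> proj_le q p)"
    and M5: "\<And>x. x \<in> S \<Longrightarrow> \<exists>d e. directly_finite d \<and> purely_infinite e \<and> add d e x"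
    and M6: "\<And>a b. \<lbrakk>purely_infinite a; purely_infinite b; rem_ll a b\<rbrakk> \<Longrightarrow>
      \<exists>m. (purely_infinite m \<and> rem_ll a m \<and> polar {m} = polar {b}) \<and>
          (\<forall>x. purely_infinite x \<and> rem_ll a x \<and> polar {x} = polar {b} \<longrightarrow> le m x)"

section \<open>Adequacy of the definitions\<close>

subsection \<open>Complementary projections\<close>

context refined_comm_monoid
begin

lemma le_refl: "a \<in> S \<Longrightarrow> le a a"
  using add_zero zero_closed unfolding le_def by blast

lemma assoc_right: "\<lbrakk>add a b d; add d c s\<rbrakk> \<Longrightarrow> \<exists>e. add b c e \<and> add a e s"
  by (rule add_assoc[THEN iffD1]) blast

lemma assoc_left: "\<lbrakk>add b c e; add a e s\<rbrakk> \<Longrightarrow> \<exists>d. add a b d \<and> add d c s"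
  by (rule add_assoc[THEN iffD2]) blast

lemma comm: "add a b c \<Longrightarrow> add b a c"
  by (rule add_commute[THEN iffD1])

lemma add_le1: "add a b c \<Longrightarrow> le a c"
  unfolding le_def using add_closed by blast

lemma le_trans: "le a b \<Longrightarrow> le b c \<Longrightarrow> le a c"
  using assoc_right add_le1 unfolding le_def by metis

lemma add_le2: "add a b c \<Longrightarrow> le b c"
  by (rule add_le1) (rule comm)

lemma zero_add: "add zero a b \<Longrightarrow> a = b"
  using add_zero add_commute add_functional add_closed by metis

lemma le_zero: "le x zero \<Longrightarrow> x = zero"
  using le_antisym add_zero add_commute add_closed zero_closed unfolding le_def by metis

lemma polarD: "\<lbrakk>y \<in> polar X; z \<in> X; le x y; le x z\<rbrakk> \<Longrightarrow> x = zero"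
  unfolding polar_def orth_def le_def using add_closed by blast

lemma decomposition_unique:
  assumes p: "u \<in> X" "v \<in> X" "y \<in> polar X" "z \<in> polar X" "add u y x" "add v z x"
  shows "u = v \<and> y = z"
proof -
  obtain c d e f where c: "add c d u" "add e f y" "add c e v" "add d f z"
    using refinement[OF p(5,6)] by blast
  have "d = zero" using polarD[OF p(4) p(1) add_le1[OF c(4)] add_le2[OF c(1)]] .
  moreover have "e = zero" using polarD[OF p(3) p(2) add_le1[OF c(2)] add_le2[OF c(3)]] .
  ultimately show ?thesis using c zero_add comm by metis
qed

lemma polar_add:
  assumes "y \<in> polar X" "z \<in> polar X" "add y z w"
  shows "w \<in> polar X"
proof -
  have "x = zero" if x: "u \<in> X" "le x w" "le x u" for x u
  proof -
    obtain r where r: "add x r w" using x unfolding le_def by blast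
    obtain c d e f where c: "add c d x" "add e f r" "add c e y" "add d f z"
      using refinement[OF r assms(3)] by blast
    have "c = zero"
      using polarD[OF assms(1) x(1) add_le1[OF c(3)] le_trans[OF add_le1[OF c(1)] x(3)]] .
    moreover have "d = zero"
      using polarD[OF assms(2) x(1) add_le1[OF c(4)] le_trans[OF add_le2[OF c(1)] x(3)]] .
    ultimately show ?thesis using c zero_add by blast
  qed
  thus ?thesis using assms(3) add_closed unfolding polar_def orth_def by blast
qed

lemma add_interchange:
  assumes "add a b x" "add c d y" "add x y s" "add a c u"
  shows "\<exists>v. add b d v \<and> add u v s"
proof -
  obtain e where e: "add b y e" "add a e s" using assoc_right[OF assms(1,3)] by blast
  obtain v where v: "add d b v" "add c v e" using assoc_right[OF assms(2) comm[OF e(1)]] by blast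
  obtain g where g: "add a c g" "add g v s" using assoc_left[OF v(2) e(2)] by blast
  have "g = u" using add_functional[OF g(1) assms(4)] .
  thus ?thesis using g(2) comm[OF v(1)] by blast
qed

lemma proj_compl_unique:
  assumes p: "projection p"
  shows "\<exists>!q. projection q \<and> q ` S = polar (p ` S)"
    and "\<And>x. x \<in> S \<Longrightarrow> add (p x) (proj_compl p x) x"
proof -
  let ?P = "polar (p ` S)"
  have pS: "p x \<in> p ` S" "p x \<in> S" if "x \<in> S" for x using p that unfolding projection_def by auto
  define q where "q = restrict (\<lambda>x. SOME y. y \<in> ?P \<and> add (p x) y x) S"
  have q: "q x \<in> ?P" "add (p x) (q x) x" if "x \<in> S" for x
  proof -
    have "\<exists>y. y \<in> ?P \<and> add (p x) y x" using p that unfolding projection_def by blast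
    from someI_ex[OF this] show "q x \<in> ?P" "add (p x) (q x) x" using that unfolding q_def by auto
  qed
  have fixed: "q y = y" if y: "y \<in> ?P" for y
  proof -
    have yS: "y \<in> S" using y unfolding polar_def by blast
    have "p y = zero"
      using polarD[OF y pS(1)[OF yS] add_le1[OF q(2)[OF yS]] le_refl[OF pS(2)[OF yS]]] .
    thus ?thesis using q(2)[OF yS] zero_add by simp
  qed
  have im: "q ` S = ?P"
  proof
    show "q ` S \<subseteq> ?P" using q by blast
    show "?P \<subseteq> q ` S"
    proof
      fix y assume y: "y \<in> ?P"
      hence "y \<in> S" unfolding polar_def by simp
      thus "y \<in> q ` S" using fixed[OF y] by (metis image_eqI)
    qed
  qed
  have zP: "zero \<in> ?P"
    unfolding polar_def orth_def using zero_closed le_zero by simp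
  have q0: "q zero = zero" using fixed[OF zP] .
  have qadd: "add (q a) (q b) (q c)" if abc: "add a b c" for a b c
  proof -
    have S: "a \<in> S" "b \<in> S" "c \<in> S" using add_closed abc by blast+
    have "add (p a) (p b) (p c)" using p abc unfolding projection_def by blast
    then obtain v where v: "add (q a) (q b) v" "add (p c) v c"
      using add_interchange[OF q(2)[OF S(1)] q(2)[OF S(2)] abc] by blast
    have "v \<in> ?P" using polar_add[OF q(1)[OF S(1)] q(1)[OF S(2)] v(1)] .
    hence "v = q c"
      using decomposition_unique[OF pS(1) pS(1) _ q(1) v(2) q(2)] S by blast
    thus ?thesis using v by simp
  qed
  have "p x \<in> polar (q ` S)" if "x \<in> S" for x
  proof -
    have "orth (p x) y" if y: "y \<in> ?P" for y
      unfolding orth_def using polarD[OF y pS(1)[OF \<open>x \<in> S\<close>]] by blast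
    thus ?thesis unfolding im using pS(2)[OF that] unfolding polar_def by auto
  qed
  moreover have "q \<in> S \<rightarrow>\<^sub>E S" using q add_closed unfolding q_def by fastforce
  ultimately have pq: "projection q"
    unfolding projection_def using q0 qadd q(2)[THEN comm] by simp blast
  have uniq: "r = q" if r: "projection r" "r ` S = ?P" for r
  proof -
    have "r x = q x" if x: "x \<in> S" for x
    proof -
      obtain y where y: "y \<in> polar (r ` S)" "add (r x) y x" using r(1) x unfolding projection_def by blast
      have yy: "y \<in> polar ?P" using y r(2) by simp
      have p': "p x \<in> polar ?P"
        using \<open>\<And>x. x \<in> S \<Longrightarrow> p x \<in> polar (q ` S)\<close>[OF x] im by simp
      have rx: "r x \<in> ?P" using r(2) x by blast
      have "add (q x) (p x) x" using comm[OF q(2)[OF x]] .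
      thus ?thesis using decomposition_unique[OF rx q(1)[OF x] yy p' y(2)] by blast
    qed
    moreover have "r \<in> extensional S" "q \<in> extensional S"
      using r(1) pq unfolding projection_def by (auto simp: PiE_def)
    ultimately show ?thesis by (meson extensionalityI)
  qed
  show "\<exists>!q. projection q \<and> q ` S = ?P"
    by (rule ex1I[of _ q]) (simp_all add: pq im uniq)
  have "proj_compl p = q"
    unfolding proj_compl_def by (rule the_equality) (simp_all add: pq im uniq)
  thus "\<And>x. x \<in> S \<Longrightarrow> add (p x) (proj_compl p x) x" using q(2) by simp
qed

end

subsection \<open>Families with arbitrary index sets\<close>

context espalier
begin

lemma lzero_le: "(lzero::'a) \<le> x"
proof -
  obtain z :: 'a where z: "isGlb UNIV UNIV z" using L1 by blast
  hence "\<forall>x. z \<le> x" unfolding isGlb_def isLb_def greatestP_def setle_def setge_def by auto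
  hence "lzero = z" unfolding lzero_def by (intro the_equality) (auto intro: antisym)
  thus ?thesis using \<open>\<forall>x. z \<le> x\<close> by simp
qed

lemma lub_iff: "isLub UNIV A s \<longleftrightarrow> (\<forall>x\<in>A. x \<le> s) \<and> (\<forall>u. (\<forall>x\<in>A. x \<le> u) \<longrightarrow> s \<le> (u::'a))"
  unfolding isLub_def isUb_def leastP_def setle_def setge_def by auto

lemma osum_lzero: "osum perp s lzero t \<longleftrightarrow> t = s" "osum perp lzero s t \<longleftrightarrow> t = s"
  unfolding osum_def lub_iff using L2_i L2_ii lzero_le by (auto intro: antisym)

lemma fin_osum_finite: "fin_osum perp a J s \<Longrightarrow> finite J"
  by (induction rule: fin_osum.induct) auto

lemma fin_osum_reindex:
  "\<lbrakk>fin_osum perp a J s; inj_on f J; \<And>i. i \<in> J \<Longrightarrow> b (f i) = a i\<rbrakk> \<Longrightarrow> fin_osum perp b (f ` J) s"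
proof (induction rule: fin_osum.induct)
  case empty
  show ?case using fin_osum.empty by simp
next
  case (insert i J s t)
  hence "fin_osum perp b (f ` J) s" "f i \<notin> f ` J" "b (f i) = a i" by auto
  thus ?case using fin_osum.insert[of "f i" "f ` J" perp b s t] insert.hyps by simp
qed

lemma fin_osum_nonzero: "fin_osum perp a J s \<Longrightarrow> fin_osum perp a {i\<in>J. a i \<noteq> lzero} s"
proof (induction rule: fin_osum.induct)
  case empty
  show ?case using fin_osum.empty by simp
next
  case (insert i J s t)
  show ?case
  proof (cases "a i = lzero")
    case True
    hence "{j\<in>insert i J. a j \<noteq> lzero} = {j\<in>J. a j \<noteq> lzero}" by auto
    thus ?thesis using insert True osum_lzero by simp
  next
    case False
    hence "{j\<in>insert i J. a j \<noteq> lzero} = insert i {j\<in>J. a j \<noteq> lzero}" by auto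
    thus ?thesis using fin_osum.insert[OF _ insert.IH insert.hyps(3)] insert.hyps(1) by simp
  qed
qed

lemma fin_osum_add_zeros:
  assumes "finite K" "fin_osum perp a J s" "\<And>i. i \<in> K \<Longrightarrow> a i = lzero"
  shows "fin_osum perp a (J \<union> K) s"
  using assms(1,3)
proof (induction K rule: finite_induct)
  case empty
  show ?case using assms(2) by simp
next
  case (insert k K)
  show ?case
  proof (cases "k \<in> J")
    case True
    thus ?thesis using insert by (simp add: insert_absorb)
  next
    case False
    hence "fin_osum perp a (insert k (J \<union> K)) s"
      using insert osum_lzero by (intro fin_osum.insert) auto
    thus ?thesis by simp
  qed
qed

lemma fin_osum_perp:
  assumes "fin_osum perp a J s" "i \<in> J" "j \<in> J" "i \<noteq> j"
  shows "perp (a i) (a j)"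
proof -
  have "(\<forall>i\<in>J. a i \<le> s) \<and> (\<forall>i\<in>J. \<forall>j\<in>J. i \<noteq> j \<longrightarrow> perp (a i) (a j))"
    using assms(1)
  proof (induction rule: fin_osum.induct)
    case empty
    show ?case by simp
  next
    case (insert i J s t)
    have "s \<le> t" "a i \<le> t" "perp s (a i)" using insert(3) unfolding osum_def lub_iff by auto
    moreover have "perp (a j) (a i)" if "j \<in> J" for j
      using insert.IH that by (intro L2_iii[OF _ \<open>perp s (a i)\<close>]) simp
    moreover have "perp (a i) (a j)" if "j \<in> J" for j
      using L2_ii calculation(4) that by simp
    moreover have "\<forall>j\<in>J. a j \<le> t" using insert.IH \<open>s \<le> t\<close> order_trans by blast
    ultimately show ?case using insert.IH by simp
  qed
  thus ?thesis using assms by blast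
qed

lemma orthogonal_inj:
  assumes "orthogonal_family perp I a"
  shows "inj_on a {i\<in>I. a i \<noteq> lzero}"
proof (rule inj_onI)
  fix i j assume ij: "i \<in> {i\<in>I. a i \<noteq> lzero}" "j \<in> {i\<in>I. a i \<noteq> lzero}" "a i = a j"
  have "finite {i, j}" "{i, j} \<subseteq> I" using ij by auto
  then obtain s where "fin_osum perp a {i, j} s" using assms unfolding orthogonal_family_def by blast
  hence "i \<noteq> j \<Longrightarrow> perp (a i) (a j)" by (rule fin_osum_perp) simp_all
  hence "i \<noteq> j \<Longrightarrow> a j = lzero" using L2_v[of "a j"] ij(3) by simp
  thus "i = j" using ij(2) by blast
qed

lemma lub_nonzero: "isLub UNIV (a ` {i\<in>I. a i \<noteq> (lzero::'a)}) s \<longleftrightarrow> isLub UNIV (a ` I) s"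
proof -
  have "(\<forall>x\<in>a ` {i\<in>I. a i \<noteq> lzero}. x \<le> u) \<longleftrightarrow> (\<forall>x\<in>a ` I. x \<le> u)" for u
  proof -
    have "a i \<le> u" if "a i \<noteq> lzero \<longrightarrow> a i \<le> u" for i
      using that lzero_le[of u] by (cases "a i = lzero") simp_all
    thus ?thesis by auto
  qed
  thus ?thesis unfolding lub_iff by simp
qed

lemma big_osum_reindex:
  assumes "big_osum perp I a s" "inj_on f {i\<in>I. a i \<noteq> lzero}"
    and "\<And>i. i \<in> I \<Longrightarrow> a i \<noteq> lzero \<Longrightarrow> b (f i) = a i"
  shows "big_osum perp (f ` {i\<in>I. a i \<noteq> lzero}) b s"
proof -
  let ?N = "{i\<in>I. a i \<noteq> lzero}"
  have im: "b ` f ` ?N = a ` ?N" using assms(3) by (force simp: image_image)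
  have "\<exists>s. fin_osum perp b J s" if J: "finite J" "J \<subseteq> f ` ?N" for J
  proof -
    obtain K where K: "K \<subseteq> ?N" "finite K" "J = f ` K" using J by (meson finite_subset_image)
    hence "K \<subseteq> I" by blast
    then obtain t where t: "fin_osum perp a K t"
      using assms(1) K unfolding big_osum_def orthogonal_family_def by blast
    have "inj_on f K" using assms(2) K(1) by (rule inj_on_subset)
    hence "fin_osum perp b (f ` K) t"
      by (rule fin_osum_reindex[OF t]) (use assms(3) K in auto)
    thus ?thesis using K by blast
  qed
  moreover have "\<exists>u. \<forall>i\<in>f ` ?N. b i \<le> u"
    using assms(1,3) unfolding big_osum_def orthogonal_family_def by auto
  moreover have "isLub UNIV (b ` f ` ?N) s"
    unfolding im lub_nonzero using assms(1) unfolding big_osum_def by blast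
  ultimately show ?thesis unfolding big_osum_def orthogonal_family_def by blast
qed

lemma big_osum_transfer:
  assumes "big_osum perp (f ` N) b s" "inj_on f N" "N \<subseteq> I"
    and "\<And>i. i \<in> N \<Longrightarrow> a i = b (f i)" "\<And>i. i \<in> I - N \<Longrightarrow> a i = lzero"
  shows "big_osum perp I a s"
proof -
  have lub: "isLub UNIV (b ` f ` N) s" using assms(1) unfolding big_osum_def by blast
  have "isLub UNIV (a ` I) s"
    unfolding lub_iff
  proof (intro conjI ballI allI impI)
    fix x assume "x \<in> a ` I"
    then obtain i where "i \<in> I" "x = a i" by blast
    thus "x \<le> s" using lub assms(4,5) lzero_le unfolding lub_iff by (cases "i \<in> N") auto
  next
    fix u assume u: "\<forall>x\<in>a ` I. x \<le> u"
    have "\<forall>x\<in>b ` f ` N. x \<le> u" using u assms(3,4) by fastforce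
    thus "s \<le> u" using lub unfolding lub_iff by blast
  qed
  moreover have "\<exists>t. fin_osum perp a J t" if J: "finite J" "J \<subseteq> I" for J
  proof -
    have "finite (f ` (J \<inter> N))" "f ` (J \<inter> N) \<subseteq> f ` N" using J by auto
    then obtain t where t: "fin_osum perp b (f ` (J \<inter> N)) t"
      using assms(1) unfolding big_osum_def orthogonal_family_def by blast
    have inj: "inj_on f (J \<inter> N)" using assms(2) by (rule inj_on_subset) simp
    have "fin_osum perp a (inv_into (J \<inter> N) f ` f ` (J \<inter> N)) t"
      using t by (rule fin_osum_reindex) (auto simp: inj_on_inv_into inj assms(4))
    moreover have "inv_into (J \<inter> N) f ` f ` (J \<inter> N) = J \<inter> N" using inj by simp
    ultimately have "fin_osum perp a (J \<inter> N \<union> (J - N)) t"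
      using J assms(5) by (intro fin_osum_add_zeros) auto
    moreover have "J \<inter> N \<union> (J - N) = J" by blast
    ultimately show ?thesis by auto
  qed
  ultimately show ?thesis
    unfolding big_osum_def orthogonal_family_def lub_iff by blast
qed

lemma L4_any_index:
  fixes I :: "'i set"
  assumes "big_osum perp I b t"
    and "\<And>J s. \<lbrakk>finite J; J \<subseteq> I; fin_osum perp b J s\<rbrakk> \<Longrightarrow> perp a s"
  shows "perp a t"
proof -
  let ?N = "{i\<in>I. b i \<noteq> lzero}"
  have inj: "inj_on b ?N" using assms(1) orthogonal_inj unfolding big_osum_def by blast
  have "big_osum perp (b ` ?N) (\<lambda>x. x) t" by (rule big_osum_reindex[OF assms(1) inj]) simp
  moreover have "perp a s" if J: "finite J" "J \<subseteq> b ` ?N" "fin_osum perp (\<lambda>x. x) J s" for J s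
  proof -
    have "fin_osum perp b (inv_into ?N b ` J) s"
      using J(3) by (rule fin_osum_reindex) (use J(2) in \<open>auto simp: inj_on_inv_into f_inv_into_f subset_iff\<close>)
    moreover have "inv_into ?N b ` J \<subseteq> ?N"
      using J(2) inv_into_into[of _ b ?N] by blast
    ultimately show ?thesis using assms(2)[of "inv_into ?N b ` J"] J(1) by blast
  qed
  ultimately show ?thesis by (rule L4)
qed

lemma L6_any_index:
  fixes I :: "'i set"
  assumes "big_osum perp I b t" "sim a t"
  shows "\<exists>c. big_osum perp I c a \<and> (\<forall>i\<in>I. sim (c i) (b i))"
proof -
  let ?N = "{i\<in>I. b i \<noteq> lzero}"
  have inj: "inj_on b ?N" using assms(1) orthogonal_inj unfolding big_osum_def by blast
  have "big_osum perp (b ` ?N) (\<lambda>x. x) t" by (rule big_osum_reindex[OF assms(1) inj]) simp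
  from L6[OF this assms(2)] obtain c
    where c: "big_osum perp (b ` ?N) c a" "\<forall>x\<in>b ` ?N. sim (c x) x" by blast
  define d where "d i = (if i \<in> ?N then c (b i) else lzero)" for i
  have "big_osum perp I d a" using c(1) inj by (rule big_osum_transfer) (auto simp: d_def)
  moreover have "\<forall>i\<in>I. sim (d i) (b i)"
    using c(2) equivp_reflp[OF sim_equiv] unfolding d_def by auto
  ultimately show ?thesis by blast
qed

lemma L7_any_index:
  fixes I :: "'i set"
  assumes "big_osum perp I a s" "big_osum perp I b t" "\<And>i. i \<in> I \<Longrightarrow> sim (a i) (b i)"
  shows "sim s t"
proof -
  let ?N = "{i\<in>I. a i \<noteq> lzero}"
  have inj: "inj_on a ?N" using assms(1) orthogonal_inj unfolding big_osum_def by blast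
  have N: "?N = {i\<in>I. b i \<noteq> lzero}" 
  proof -
    have "a i = lzero \<longleftrightarrow> b i = lzero" if "i \<in> I" for i
      using assms(3)[OF that] equivp_symp[OF sim_equiv, of "a i" "b i"] L5[of "a i"] L5[of "b i"]
      by auto
    thus ?thesis by blast
  qed
  have "big_osum perp (a ` ?N) (\<lambda>x. x) s" by (rule big_osum_reindex[OF assms(1) inj]) simp
  moreover have "big_osum perp (a ` ?N) (b \<circ> inv_into ?N a) t"
  proof -
    have "inj_on a {i\<in>I. b i \<noteq> lzero}" using inj unfolding N .
    from big_osum_reindex[OF assms(2) this, of "b \<circ> inv_into ?N a"] show ?thesis
      using inj inv_into_f_f[OF inj] N by fastforce
  qed
  moreover have "\<And>x. x \<in> a ` ?N \<Longrightarrow> sim x ((b \<circ> inv_into ?N a) x)"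
    using assms(3) inj by (auto simp: inv_into_f_f)
  ultimately show ?thesis by (rule L7)
qed

end

end

(*
Write D(a) for the class of a. A common piece of several classes can be split off greedily: Zorn's
lemma gives a maximal orthogonal family of simultaneous choices of equivalent elements below
representatives of given classes, so every nonempty X has an m with x = m + r(x) for all x in X,
where the remainders r(x) have no common nonzero minorant. For the classes in a given polar, the
same exhaustion shows that each polar is the image of a projection; for the purely infinite
classes, it gives (M5). With X = {x, y}, the polars of the remainders give general comparability.

Since disjoint families of pieces of an element can be summed, inequalities hold as soon as they
hold locally. Locally, every element is directly finite or purely infinite, and any two elements
are comparable. Directly finite elements can be cancelled; if the common part m is purely infinite,
then locally either r(x) <= m for some x, and m = x, or m <= r(x) for all x, and m = 0. Hence m is
the infimum of X.

For (M6), a purely infinite element strictly larger than another one is locally an infinite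
multiple of it, so a local strict descent gives a descent of cardinals, and every nonempty set of
purely infinite elements has locally a least element. The least element required in (M6) is the
infimum m of the given set, because locally m belongs to the set.
*)

theory Submission
  imports Defs "HOL-Library.Equipollence"
begin

section \<open>Projections onto polars\<close>

text \<open>The obstacle is that purely infinite elements absorb, so differences of classes are
  neither unique nor monotone and a sum cannot simply be cancelled. Each inequality is therefore cut
  by a projection into pieces on which one case prevails, and recombined by \<open>le_split\<close>
  or \<open>le_local\<close>. "Locally" means: below every nonzero \<open>z\<close> there is a
  nonzero \<open>u\<close> such that the claim holds after applying \<open>near u\<close>, the
  projection onto the bipolar of \<open>u\<close>. The gluing behind this is done once, in
  \<open>dim_le_local\<close>. The order of the locales is forced: \<open>near\<close>, in terms of
  which \<open>le_local\<close> is stated, is a projection only because polars split every element.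
  Antisymmetry must come earlier still, since complements of projections rest on it. Sums of
  infinitely many classes make sense by \<open>L7\<close>, and can be realized below a prescribed
  representative by \<open>L6\<close>; these two facts carry all the passages between the espalier
  and its classes.\<close>

context refined_comm_monoid
begin

lemma leE: assumes "le a c" obtains b where "add a b c" using assms unfolding le_def by blast

lemma le_S: "le a b \<Longrightarrow> a \<in> S \<and> b \<in> S" unfolding le_def using add_closed by blast

lemma zero_le: "a \<in> S \<Longrightarrow> le zero a" using add_zero add_le2 by blast

lemma add_sub:
  assumes "add a b c" "le a' a" "le b' b"
  obtains c' where "add a' b' c'" "le c' c"
proof -
  have *: "\<exists>s'. add x y' s' \<and> le s' s" if "add x y s" "le y' y" for x y s y'
    using that assoc_left leE add_le1 by metis
  obtain d where d: "add a b' d" "le d c" using *[OF assms(1,3)] by blast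
  obtain e where "add b' a' e" "le e d" using *[OF comm[OF d(1)] assms(2)] by blast
  thus thesis using that comm le_trans d(2) by blast
qed

lemma add_mono: "add a b c \<Longrightarrow> add a' b' c' \<Longrightarrow> le a' a \<Longrightarrow> le b' b \<Longrightarrow> le c' c"
  using add_sub add_functional by metis

lemma orth_sym: "orth a b \<Longrightarrow> orth b a" unfolding orth_def by blast

lemma polar_S: "polar X \<subseteq> S" unfolding polar_def by blast

lemma polar_down: "x \<in> polar X \<Longrightarrow> le y x \<Longrightarrow> y \<in> polar X"
  unfolding polar_def orth_def using le_trans le_S by blast

lemma polar_antimono: "X \<subseteq> Y \<Longrightarrow> polar Y \<subseteq> polar X" unfolding polar_def by blast

lemma subset_polar_polar: "X \<subseteq> S \<Longrightarrow> X \<subseteq> polar (polar X)"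
  unfolding polar_def using orth_sym by blast

lemma polar_polar_polar: "X \<subseteq> S \<Longrightarrow> polar (polar (polar X)) = polar X"
  using subset_polar_polar polar_antimono polar_S by (meson subset_antisym)

lemma zero_in_polar: "zero \<in> polar X"
  unfolding polar_def orth_def using zero_closed le_zero by simp

lemma polarI: "s \<in> S \<Longrightarrow> (\<And>x z. x \<in> X \<Longrightarrow> le z s \<Longrightarrow> le z x \<Longrightarrow> z = zero) \<Longrightarrow> s \<in> polar X"
  unfolding polar_def orth_def by blast

lemma polar_self: "x \<in> X \<Longrightarrow> x \<in> polar X \<Longrightarrow> x = zero"
  using polarD le_refl polar_S by blast

lemma polar_singleton_sym: "x \<in> S \<Longrightarrow> y \<in> polar {x} \<Longrightarrow> x \<in> polar {y}"
  unfolding polar_def using orth_sym by blast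

lemma proj_compl_projection:
  assumes "projection p"
  shows "projection (proj_compl p)" "proj_compl p ` S = polar (p ` S)"
  using theI'[OF proj_compl_unique(1)[OF assms]] unfolding proj_compl_def by auto

lemma proj_split: "projection p \<Longrightarrow> x \<in> S \<Longrightarrow> add (p x) (proj_compl p x) x"
  by (rule proj_compl_unique(2))

lemma proj_add: "projection p \<Longrightarrow> add a b c \<Longrightarrow> add (p a) (p b) (p c)"
  unfolding projection_def by blast

lemma proj_mono: "projection p \<Longrightarrow> le a b \<Longrightarrow> le (p a) (p b)"
  using proj_add add_le1 leE by metis

lemma proj_in: "projection p \<Longrightarrow> x \<in> S \<Longrightarrow> p x \<in> S"
  unfolding projection_def by blast

lemma proj_zero: "projection p \<Longrightarrow> p zero = zero"
  unfolding projection_def by blast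

lemma proj_le_self: "projection p \<Longrightarrow> x \<in> S \<Longrightarrow> le (p x) x"
  using proj_split add_le1 by blast

lemma proj_compl_of_image:
  assumes "projection p" "x \<in> p ` S"
  shows "proj_compl p x = zero"
proof -
  have x: "x \<in> S" using assms proj_in by blast
  have "proj_compl p x \<in> polar (p ` S)" using proj_compl_projection(2)[OF assms(1)] x by blast
  moreover have "le (proj_compl p x) x"
    using proj_le_self proj_compl_projection(1) assms(1) x by blast
  ultimately show ?thesis using polarD[OF _ assms(2)] le_refl polar_S by blast
qed

lemma proj_image_iff:
  assumes "projection p" "x \<in> S"
  shows "x \<in> p ` S \<longleftrightarrow> p x = x" "x \<in> p ` S \<longleftrightarrow> proj_compl p x = zero"
proof -
  have "p x = x" if "proj_compl p x = zero"
    using proj_split[OF assms] that zero_add comm by metis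
  thus "x \<in> p ` S \<longleftrightarrow> p x = x" "x \<in> p ` S \<longleftrightarrow> proj_compl p x = zero"
    using proj_compl_of_image[OF assms(1)] assms(2) by (metis image_eqI)+
qed

lemma proj_of_compl_image: "projection p \<Longrightarrow> x \<in> polar (p ` S) \<Longrightarrow> p x = zero"
  using polarD[of x "p ` S" "p x" "p x"] proj_le_self proj_in le_refl polar_S by blast

lemma proj_compl_image_iff:
  assumes "projection p" "x \<in> S"
  shows "x \<in> polar (p ` S) \<longleftrightarrow> p x = zero" "x \<in> polar (p ` S) \<longleftrightarrow> proj_compl p x = x"
proof -
  have "proj_compl p x = x" if "p x = zero"
    using proj_split[OF assms] that zero_add by metis
  thus "x \<in> polar (p ` S) \<longleftrightarrow> p x = zero" "x \<in> polar (p ` S) \<longleftrightarrow> proj_compl p x = x"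
    using proj_of_compl_image[OF assms(1)] proj_compl_projection[OF assms(1)] assms(2)
      by (metis image_eqI)+
qed

lemma proj_image_down: "projection p \<Longrightarrow> x \<in> p ` S \<Longrightarrow> le y x \<Longrightarrow> y \<in> p ` S"
  using proj_image_iff(2) proj_mono[OF proj_compl_projection(1)] le_zero le_S by metis

lemma le_split:
  assumes "projection p" "x \<in> S" "y \<in> S" "le (p x) (p y)" "le (proj_compl p x) (proj_compl p y)"
  shows "le x y"
  using add_mono proj_split assms by blast

text \<open>Membership in the image of a projection can thus be tested by polars, which are closed
  under infinite sums; this is how projections are shown to commute with multiples.\<close>

lemma proj_image_polar: "projection p \<Longrightarrow> polar (polar (p ` S)) = p ` S"
proof
  assume p: "projection p"
  show "p ` S \<subseteq> polar (polar (p ` S))" by (rule subset_polar_polar) (use proj_in p in blast)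
  show "polar (polar (p ` S)) \<subseteq> p ` S"
  proof
    fix x assume x: "x \<in> polar (polar (p ` S))"
    hence "x \<in> S" using polar_S by blast
    moreover have "proj_compl p x = zero"
      using x proj_of_compl_image[OF proj_compl_projection(1)[OF p]] proj_compl_projection(2)[OF p]
        by simp
    ultimately show "x \<in> p ` S" using proj_image_iff p by blast
  qed
qed

section \<open>Directly finite and purely infinite elements\<close>

lemma directly_finite_le:
  assumes "directly_finite a" "le b a"
  shows "directly_finite b"
proof -
  obtain c where c: "add b c a" using leE assms(2) .
  have "x = zero" if x: "add x b b" for x
  proof -
    obtain e where "add b c e" "add x e a" using assoc_right[OF x c] by blast
    hence "add x a a" using c add_functional by blast
    thus ?thesis using assms(1) add_closed unfolding directly_finite_def by blast
  qed
  thus ?thesis using c add_closed unfolding directly_finite_def by blast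
qed

lemma purely_infinite_proj: "projection p \<Longrightarrow> purely_infinite a \<Longrightarrow> purely_infinite (p a)"
  unfolding purely_infinite_def using proj_add proj_in by blast

lemma directly_finite_proj: "projection p \<Longrightarrow> directly_finite a \<Longrightarrow> directly_finite (p a)"
  using directly_finite_le proj_le_self unfolding directly_finite_def by blast

lemma finite_infinite_zero: "directly_finite a \<Longrightarrow> purely_infinite a \<Longrightarrow> a = zero"
  unfolding directly_finite_def purely_infinite_def by blast

lemma purely_infinite_sum:
  assumes "purely_infinite a" "le x a" "le y a"
  obtains s where "add x y s" "le s a"
  using add_sub assms unfolding purely_infinite_def by blast

lemma purely_infinite_add_le: "purely_infinite a \<Longrightarrow> le x a \<Longrightarrow> le y a \<Longrightarrow> add x y s \<Longrightarrow> le s a"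
  using purely_infinite_sum add_functional by metis

lemma directly_finite_cancel: "directly_finite a \<Longrightarrow> add a x b \<Longrightarrow> le b a \<Longrightarrow> x = zero"
  unfolding directly_finite_def using le_antisym add_le1 comm add_closed by metis

end

section \<open>Projections onto bipolars, and localization\<close>

locale polar_monoid = refined_comm_monoid +
  assumes polar_decomposition:
    "\<lbrakk>X \<subseteq> S; x \<in> S\<rbrakk> \<Longrightarrow> \<exists>u v. u \<in> polar (polar X) \<and> v \<in> polar X \<and> add u v x"
begin

text \<open>The choice is harmless for X inside S: the polar of \<open>polar (polar X)\<close> is
  again \<open>polar X\<close>, so the component is determined by
  \<open>decomposition_unique\<close>; see \<open>proj_eq\<close>.\<close>

definition proj :: "'a set \<Rightarrow> 'a \<Rightarrow> 'a" where
  "proj X = restrict (\<lambda>x. SOME u. u \<in> polar (polar X) \<and> (\<exists>v\<in>polar X. add u v x)) S"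

lemma proj_ex:
  assumes "X \<subseteq> S" "x \<in> S"
  shows "proj X x \<in> polar (polar X)" "\<exists>v\<in>polar X. add (proj X x) v x"
proof -
  have "\<exists>u. u \<in> polar (polar X) \<and> (\<exists>v\<in>polar X. add u v x)"
    using polar_decomposition[OF assms] by blast
  from someI_ex[OF this]
  show "proj X x \<in> polar (polar X)" "\<exists>v\<in>polar X. add (proj X x) v x" 
    using assms(2) unfolding proj_def by auto
qed

lemma proj_eq:
  assumes "X \<subseteq> S" "u \<in> polar (polar X)" "v \<in> polar X" "add u v x"
  shows "proj X x = u"
proof -
  have "x \<in> S" using assms(4) add_closed by blast
  then obtain w where w: "w \<in> polar X" "add (proj X x) w x" "proj X x \<in> polar (polar X)"
    using proj_ex assms(1) by blast
  have "w \<in> polar (polar (polar X))" "v \<in> polar (polar (polar X))"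
    using w(1) assms(3) polar_polar_polar[OF assms(1)] by auto
  thus ?thesis using decomposition_unique[OF w(3) assms(2)] w(2) assms(4) by blast
qed

lemma proj_projection:
  assumes "X \<subseteq> S"
  shows "projection (proj X)" "proj X ` S = polar (polar X)"
proof -
  have fixed: "proj X u = u" if "u \<in> polar (polar X)" for u
    using proj_eq[OF assms that zero_in_polar add_zero] polar_S[THEN subsetD, OF that] .
  show im: "proj X ` S = polar (polar X)"
  proof
    show "proj X ` S \<subseteq> polar (polar X)" using proj_ex(1)[OF assms] by blast
    show "polar (polar X) \<subseteq> proj X ` S"
    proof
      fix u assume u: "u \<in> polar (polar X)"
      hence "u \<in> S" using polar_S by blast
      thus "u \<in> proj X ` S" using fixed[OF u, symmetric] by (rule rev_image_eqI)
    qed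
  qed
  show "projection (proj X)" unfolding projection_def
  proof (intro conjI allI impI ballI)
    show "proj X \<in> S \<rightarrow>\<^sub>E S"
      using proj_ex(1)[OF assms] polar_S unfolding proj_def by (auto simp: subset_iff)
    show "proj X zero = zero" using fixed zero_in_polar by blast
    show "\<exists>y\<in>polar (proj X ` S). add (proj X x) y x" if "x \<in> S" for x
      using proj_ex(2)[OF assms that] unfolding im polar_polar_polar[OF assms] .
    fix a b c assume abc: "add a b c"
    hence S: "a \<in> S" "b \<in> S" using add_closed by blast+
    obtain v w where v: "v \<in> polar X" "add (proj X a) v a" and w: "w \<in> polar X" "add (proj X b) w b"
      using proj_ex(2)[OF assms] S by blast
    obtain s where s: "add (proj X a) (proj X b) s"
      using add_sub[OF abc] add_le1[OF v(2)] add_le1[OF w(2)] by blast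
    obtain t where t: "add v w t" "add s t c" using add_interchange[OF v(2) w(2) abc s] by blast
    have "proj X c = s"
      by (rule proj_eq[OF assms _ _ t(2)])
        (use polar_add[OF _ _ s] polar_add[OF _ _ t(1)] proj_ex(1)[OF assms] S v w in blast)+
    thus "add (proj X a) (proj X b) (proj X c)" using s by simp
  qed
qed

text \<open>The part of an element that lives over \<open>u\<close>: what is disjoint from
  \<open>u\<close> is sent to zero, and \<open>u\<close> itself is fixed.\<close>

abbreviation "near u \<equiv> proj {u}"

lemma near_projection: "u \<in> S \<Longrightarrow> projection (near u)"
  by (rule proj_projection) simp

lemma near_self: "u \<in> S \<Longrightarrow> near u u = u"
  using proj_image_iff(1)[OF near_projection, of u u] proj_projection(2)[of "{u}"]
    subset_polar_polar[of "{u}"] by simp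

lemma near_image: "u \<in> S \<Longrightarrow> near u ` S = polar (polar {u})"
  by (rule proj_projection) simp

lemma near_zero_iff: "u \<in> S \<Longrightarrow> x \<in> S \<Longrightarrow> near u x = zero \<longleftrightarrow> x \<in> polar {u}"
  using proj_compl_image_iff(1)[OF near_projection, of u x] near_image[of u] polar_polar_polar[of "{u}"]
  by simp

text \<open>The complement of \<open>p\<close> takes values disjoint from \<open>u\<close>, so
  \<open>near u\<close> kills it. This carries a comparison known after applying \<open>p\<close>
  over to any \<open>u\<close> in the image of \<open>p\<close>.\<close>

lemma near_proj:
  assumes "projection p" "u \<in> p ` S" "x \<in> S"
  shows "near u (p x) = near u x"
proof -
  have u: "u \<in> S" using assms proj_in by blast
  have "proj_compl p x \<in> polar (p ` S)"
    using proj_compl_projection(2)[OF assms(1)] assms(3) by blast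
  moreover have "polar (p ` S) \<subseteq> polar {u}" using assms(2) by (intro polar_antimono) simp
  ultimately have "near u (proj_compl p x) = zero"
    using near_zero_iff[OF u] polar_S by blast
  thus ?thesis
    using proj_add[OF near_projection[OF u] proj_split[OF assms(1,3)]] zero_add comm by metis
qed

lemma near_near: "le u v \<Longrightarrow> x \<in> S \<Longrightarrow> near u (near v x) = near u x"
proof -
  assume u: "le u v" and x: "x \<in> S"
  have v: "v \<in> S" using le_S u by blast
  have "v \<in> near v ` S" using near_self[OF v] proj_image_iff(1)[OF near_projection[OF v] v] by simp
  hence "u \<in> near v ` S" using proj_image_down near_projection v u by blast
  thus ?thesis using near_proj near_projection v x by blast
qed

end

section \<open>Comparability, cancellation and infima\<close>

text \<open>These are the consequences of completeness. In \<open>le_local\<close> the test points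
  run only below \<open>x\<close>, because the part of \<open>y\<close> disjoint from
  \<open>x\<close> does not matter. In \<open>common_part\<close> the remainders merely have no
  common minorant; that \<open>m\<close> is then the infimum is a separate matter, since
  cancellation can fail.\<close>

locale local_monoid = polar_monoid +
  assumes le_local: "\<lbrakk>x \<in> S; y \<in> S;
      \<And>z. \<lbrakk>le z x; z \<noteq> zero\<rbrakk> \<Longrightarrow> \<exists>u. le u z \<and> u \<noteq> zero \<and> le (near u x) (near u y)\<rbrakk> \<Longrightarrow> le x y"
    and common_part: "\<lbrakk>X \<subseteq> S; X \<noteq> {}\<rbrakk> \<Longrightarrow>
      \<exists>m r. (\<forall>x\<in>X. add m (r x) x) \<and> (\<forall>z. (\<forall>x\<in>X. le z (r x)) \<longrightarrow> z = zero)"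
    and finite_infinite: "x \<in> S \<Longrightarrow> \<exists>d e. directly_finite d \<and> purely_infinite e \<and> add d e x"
begin

text \<open>The two remainders are disjoint: the projection onto the bipolar of \<open>r y\<close>
  kills \<open>r x\<close>, and its complement kills \<open>r y\<close>. On each side one of the
  elements is reduced to the common part.\<close>

lemma comparability:
  assumes "x \<in> S" "y \<in> S"
  obtains p where "projection p" "le (p x) (p y)" "le (proj_compl p y) (proj_compl p x)"
proof -
  obtain m r where r: "add m (r x) x" "add m (r y) y"
      "\<And>z. le z (r x) \<Longrightarrow> le z (r y) \<Longrightarrow> z = zero"
    using common_part[of "{x, y}"] assms by auto
  have S: "r x \<in> S" "r y \<in> S" using r add_closed by blast+
  let ?p = "near (r y)"
  let ?q = "proj_compl ?p"
  have p: "projection ?p" "projection ?q"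
    using near_projection[OF S(2)] proj_compl_projection by blast+
  have "r x \<in> polar {r y}" by (rule polarI[OF S(1)]) (use r(3) in blast)
  hence "?p (r x) = zero" using near_zero_iff S by blast
  hence "?p x = ?p m" using proj_add[OF p(1) r(1)] zero_add comm by metis
  hence 1: "le (?p x) (?p y)" using proj_mono[OF p(1)] add_le1[OF r(2)] by simp
  have "r y \<in> ?p ` S" using near_image[OF S(2)] subset_polar_polar[of "{r y}"] S(2) by simp
  hence "?q (r y) = zero" by (rule proj_compl_of_image[OF p(1)])
  hence "?q y = ?q m" using proj_add[OF p(2) r(2)] zero_add comm by metis
  hence 2: "le (?q y) (?q x)" using proj_mono[OF p(2)] add_le1[OF r(1)] by simp
  show thesis using that p(1) 1 2 .
qed

text \<open>Collect every \<open>u\<close> over which \<open>a\<close> lies below \<open>b\<close>,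
  and project onto the bipolar of that set. A nonzero element of the bipolar has a nonzero minorant
  below some such \<open>u\<close>, so the inequality holds locally there.\<close>

lemma largest_projection:
  assumes "a \<in> S" "b \<in> S"
  obtains p where "projection p" "le (p a) (p b)"
    "\<And>q. projection q \<Longrightarrow> le (q a) (q b) \<Longrightarrow> q ` S \<subseteq> p ` S"
proof -
  define U where "U = {u \<in> S. le (near u a) (near u b)}"
  have U: "U \<subseteq> S" unfolding U_def by blast
  let ?p = "proj U"
  have p: "projection ?p" "?p ` S = polar (polar U)" using proj_projection[OF U] by blast+
  have pS: "?p a \<in> S" "?p b \<in> S" using proj_in p(1) assms by blast+
  have "le (?p a) (?p b)"
  proof (rule le_local[OF pS])
    fix z assume z: "le z (?p a)" "z \<noteq> zero"
    have zi: "z \<in> ?p ` S" using proj_image_down[OF p(1) _ z(1)] assms(1) by blast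
    hence "z \<notin> polar U" using p(2) polar_self[of z "polar U"] z(2) by blast
    then obtain u v where u: "u \<in> U" "le v z" "le v u" "v \<noteq> zero"
      using polarI[of z U] le_S[OF z(1)] by blast
    have S: "u \<in> S" "v \<in> S" using u(1) U le_S[OF u(2)] by blast+
    have v: "v \<in> ?p ` S" using proj_image_down[OF p(1) zi u(2)] .
    have n: "near v (?p x) = near v x" if "x \<in> S" for x using near_proj[OF p(1) v that] .
    have "le (near u a) (near u b)" using u(1) unfolding U_def by blast
    from proj_mono[OF near_projection[OF S(2)] this]
    have "le (near v a) (near v b)" using near_near u(3) assms by simp
    thus "\<exists>u. le u z \<and> u \<noteq> zero \<and> le (near u (?p a)) (near u (?p b))"
      using u n assms by auto
  qed
  moreover have "q ` S \<subseteq> ?p ` S" if q: "projection q" "le (q a) (q b)" for q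
  proof -
    have "s \<in> U" if s: "s \<in> q ` S" for s
    proof -
      have S: "s \<in> S" using s q proj_in by blast
      have "le (near s a) (near s b)"
        using proj_mono[OF near_projection[OF S] q(2)] near_proj[OF q(1) s] assms by simp
      thus ?thesis using S unfolding U_def by blast
    qed
    thus ?thesis using subset_polar_polar[OF U] p(2) by blast
  qed
  ultimately show thesis using that p(1) by blast
qed

text \<open>Refine \<open>e + e = m + r\<close> and compare \<open>m1\<close> with
  \<open>r2\<close>. Where \<open>m1\<close> lies below \<open>r2\<close>, the first copy
  \<open>m1 + r1\<close> of \<open>e\<close> fits into \<open>r\<close>; elsewhere the second copy
  \<open>m2 + r2\<close> fits into \<open>m\<close>. Either way \<open>e\<close> is directly finite
  and purely infinite.\<close>

lemma directly_finite_no_infinite_part: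
  assumes "directly_finite m" "directly_finite r" "add m r e" "purely_infinite e"
  shows "e = zero"
proof -
  have ee: "add e e e" using assms(4) unfolding purely_infinite_def by blast
  obtain m1 r1 m2 r2 where d: "add m1 r1 e" "add m2 r2 e" "add m1 m2 m" "add r1 r2 r"
    using refinement[OF ee assms(3)] by blast
  have S: "m1 \<in> S" "r2 \<in> S" "e \<in> S" using d add_closed by blast+
  obtain p where p: "projection p" "le (p m1) (p r2)" "le (proj_compl p r2) (proj_compl p m1)"
    using comparability S by blast
  let ?q = "proj_compl p"
  have q: "projection ?q" using proj_compl_projection p(1) by blast
  have "le (p e) (p r)"
    using add_mono[OF comm[OF proj_add[OF p(1) d(4)]] proj_add[OF p(1) d(1)] p(2)]
      le_refl proj_in[OF p(1)] d(4) add_closed by blast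
  hence "p e = zero"
    using finite_infinite_zero directly_finite_le directly_finite_proj[OF p(1) assms(2)]
      purely_infinite_proj[OF p(1) assms(4)] by blast
  moreover have "le (?q e) (?q m)"
    using add_mono[OF comm[OF proj_add[OF q d(3)]] proj_add[OF q d(2)] _ p(3)]
      le_refl proj_in[OF q] d(3) add_closed by blast
  hence "?q e = zero"
    using finite_infinite_zero directly_finite_le directly_finite_proj[OF q assms(1)]
      purely_infinite_proj[OF q assms(4)] by blast
  ultimately show ?thesis using proj_split[OF p(1) S(3)] zero_add by metis
qed

lemma directly_finite_add:
  assumes "directly_finite m" "directly_finite r" "add m r a"
  shows "directly_finite a"
proof -
  obtain d e where d: "directly_finite d" "purely_infinite e" "add d e a"
    using finite_infinite assms(3) add_closed by blast
  obtain m' m'' r' r'' where "add m' r' e" "add m'' m' m" "add r'' r' r"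
    using refinement[OF d(3) assms(3)] by blast
  hence "add m' r' e" "le m' m" "le r' r" using add_le2 by blast+
  hence "e = zero" using directly_finite_no_infinite_part directly_finite_le assms d(2) by blast
  thus ?thesis using d zero_add comm by metis
qed

text \<open>Where \<open>r\<close> lies below \<open>z\<close>, write \<open>z = r + w\<close>.
  Adding \<open>w\<close> to the directly finite total \<open>m + r\<close> keeps it below itself,
  so \<open>w\<close> vanishes and \<open>z = r\<close> there.\<close>

lemma directly_finite_cancel_le_finite:
  assumes "directly_finite m" "directly_finite r" "add m z s" "add m r t" "le s t"
  shows "le z r"
proof -
  have S: "r \<in> S" "z \<in> S" "m \<in> S" "s \<in> S" "t \<in> S" using assms(3,4) add_closed by blast+
  obtain p where p: "projection p" "le (p r) (p z)" "le (proj_compl p z) (proj_compl p r)"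
    using comparability S by blast
  obtain w where w: "add (p r) w (p z)" using leE p(2) .
  have ms: "add (p m) (p z) (p s)" "add (p m) (p r) (p t)" using proj_add p(1) assms by blast+
  obtain v where v: "add (p m) (p r) v" "add v w (p s)" using assoc_left[OF w ms(1)] by blast
  have "v = p t" using add_functional v(1) ms(2) by blast
  hence "w = zero"
    using directly_finite_cancel[of "p t"] v(2) proj_mono[OF p(1) assms(5)]
      directly_finite_proj[OF p(1) directly_finite_add[OF assms(1,2,4)]] by blast
  hence "p z = p r" using w zero_add comm by metis
  thus ?thesis using le_split[OF p(1) S(2,1)] p(3) le_refl proj_in p(1) S by metis
qed

lemma directly_finite_cancel_le:
  assumes "directly_finite m" "add m z s" "add m r t" "le s t"
  shows "le z r"
proof -
  have S: "r \<in> S" "z \<in> S" "m \<in> S" using assms add_closed by blast+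
  obtain d e where d: "directly_finite d" "purely_infinite e" "add d e r"
    using finite_infinite S by blast
  obtain n where n: "add m d n" "add n e t" using assoc_left[OF d(3) assms(3)] by blast
  have fin: "directly_finite n" using directly_finite_add[OF assms(1) d(1) n(1)] .
  have nS: "n \<in> S" "e \<in> S" using n add_closed by blast+
  \<comment> \<open>Where \<open>n\<close> lies below \<open>e\<close>, the whole of
    \<open>t = n + e\<close> lies below \<open>e\<close>, hence below \<open>r\<close>, and no
    cancellation takes place. Elsewhere \<open>e\<close> is directly finite, hence zero, and
    \<open>r\<close> is directly finite.\<close>
  obtain p where p: "projection p" "le (p n) (p e)" "le (proj_compl p e) (proj_compl p n)"
    using comparability nS by blast
  let ?q = "proj_compl p"
  have q: "projection ?q" using proj_compl_projection p(1) by blast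
  have "le (p t) (p e)"
    using purely_infinite_add_le[OF purely_infinite_proj[OF p(1) d(2)] p(2) le_refl proj_add[OF p(1) n(2)]]
      proj_in[OF p(1) nS(2)] .
  hence 1: "le (p z) (p r)"
    using le_trans proj_mono[OF p(1)] assms(4) add_le2[OF assms(2)] add_le2[OF d(3)] by blast
  have "?q e = zero"
    using finite_infinite_zero directly_finite_le[OF directly_finite_proj[OF q fin] p(3)]
      purely_infinite_proj[OF q d(2)] by blast
  hence "?q r = ?q d" using proj_add[OF q d(3)] comm zero_add by metis
  hence "directly_finite (?q r)" using directly_finite_proj[OF q d(1)] by simp
  hence 2: "le (?q z) (?q r)"
    using directly_finite_cancel_le_finite[OF directly_finite_proj[OF q assms(1)]]
      proj_add[OF q] assms(2,3) proj_mono[OF q assms(4)] by blast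
  show ?thesis using le_split[OF p(1) S(2,1) 1 2] .
qed

text \<open>Where \<open>m\<close> lies below \<open>l\<close>, cancelling \<open>m\<close> from
  \<open>l = m + z\<close> against each \<open>m + r i\<close> puts \<open>z\<close> below all
  remainders, so \<open>z\<close> is zero.\<close>

lemma common_part_greatest_finite:
  assumes "directly_finite m" "I \<noteq> {}" "\<forall>i\<in>I. add m (r i) (f i)"
    and "\<forall>i\<in>I. le l (f i)" "\<And>z. \<forall>i\<in>I. le z (r i) \<Longrightarrow> z = zero"
  shows "le l m"
proof -
  obtain i where i: "i \<in> I" using assms(2) by blast
  have S: "l \<in> S" "m \<in> S" using i assms(3,4) add_closed le_S by blast+
  obtain p where p: "projection p" "le (p l) (p m)" "le (proj_compl p m) (proj_compl p l)"
    using comparability S by blast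
  let ?q = "proj_compl p"
  have q: "projection ?q" using proj_compl_projection p(1) by blast
  obtain z where z: "add (?q m) z (?q l)" using leE p(3) .
  have "le z (r j)" if j: "j \<in> I" for j
  proof -
    have a: "add m (r j) (f j)" "le l (f j)" using assms(3,4) j by blast+
    have "le z (?q (r j))"
      using directly_finite_cancel_le[OF directly_finite_proj[OF q assms(1)] z proj_add[OF q a(1)]
          proj_mono[OF q a(2)]] .
    thus ?thesis using le_trans proj_le_self[OF q] a(1) add_closed by blast
  qed
  hence "z = zero" using assms(5) by blast
  hence "?q l = ?q m" using z zero_add comm by metis
  thus ?thesis using le_split[OF p(1) S p(2)] le_refl proj_in[OF q] S by metis
qed

lemma common_part_greatest_infinite:
  assumes "purely_infinite m" "I \<noteq> {}" "\<forall>i\<in>I. add m (r i) (f i)"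
    and "\<forall>i\<in>I. le l (f i)" "\<And>z. \<forall>i\<in>I. le z (r i) \<Longrightarrow> z = zero"
  shows "le l m"
proof -
  have S: "l \<in> S" "m \<in> S" "r i \<in> S" "f i \<in> S" if "i \<in> I" for i
    using that assms(3,4) add_closed le_S by blast+
  show ?thesis
  proof (rule le_local)
    show "l \<in> S" "m \<in> S" using S assms(2) by blast+
    fix z assume z: "le z l" "z \<noteq> zero"
    have zS: "z \<in> S" using le_S z(1) by blast
    show "\<exists>u. le u z \<and> u \<noteq> zero \<and> le (near u l) (near u m)"
    \<comment> \<open>If some \<open>p\<close> with \<open>r i\<close> below \<open>m\<close> does
      not kill \<open>z\<close>, then \<open>p z\<close> serves as the neighbourhood: over it
      \<open>m\<close> absorbs \<open>r i\<close>, so \<open>f i\<close>, and with it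
      \<open>l\<close>, lies below \<open>m\<close>. The other case is contradictory.\<close>
    proof (cases "\<exists>i\<in>I. \<exists>p. projection p \<and> le (p (r i)) (p m) \<and> p z \<noteq> zero")
      case True
      then obtain i p where p: "i \<in> I" "projection p" "le (p (r i)) (p m)" "p z \<noteq> zero" by blast
      let ?u = "p z"
      have u: "?u \<in> p ` S" "?u \<in> S" using zS proj_in p(2) by blast+
      have n: "projection (near ?u)" using near_projection[OF u(2)] .
      have "le (near ?u (r i)) (near ?u m)"
        using proj_mono[OF n p(3)] near_proj[OF p(2) u(1)] S[OF p(1)] by simp
      hence "le (near ?u (f i)) (near ?u m)"
        using purely_infinite_add_le[OF purely_infinite_proj[OF n assms(1)] le_refl]
          proj_add[OF n] assms(3) p(1) proj_in[OF n] S(2)[OF p(1)] by blast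
      hence "le (near ?u l) (near ?u m)" using le_trans proj_mono[OF n] assms(4) p(1) by blast
      thus ?thesis using p(4) proj_le_self[OF p(2) zS] by blast
    next
      case False
      have n: "projection (near z)" using near_projection[OF zS] .
      have nr: "le (near z m) (near z (r i))" if i: "i \<in> I" for i
      proof -
        obtain p where p: "projection p" "le (p (r i)) (p m)" "le (proj_compl p m) (proj_compl p (r i))"
          using comparability S[OF i] by blast
        let ?q = "proj_compl p"
        have q: "projection ?q" using proj_compl_projection p(1) by blast
        \<comment> \<open>Otherwise \<open>i\<close> and \<open>p\<close> would fall under the first
          case. Hence \<open>z\<close> lives on the complement of \<open>p\<close>, where
          \<open>m\<close> lies below \<open>r i\<close>.\<close>
        have "p z = zero" using False i p by blast
        hence zq: "z \<in> ?q ` S"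
          using proj_compl_image_iff(1)[OF p(1) zS] proj_compl_projection(2)[OF p(1)] by simp
        show ?thesis using proj_mono[OF n p(3)] near_proj[OF q zq] S[OF i] by simp
      qed
      have nrS: "le (near z (r i)) (r i)" if "i \<in> I" for i
        using proj_le_self[OF n] S(3) that by blast
      have "near z m = zero" using assms(5)[of "near z m"] le_trans[OF nr nrS] by blast
      \<comment> \<open>Since \<open>m\<close> vanishes near \<open>z\<close>, each
        \<open>f i\<close> coincides there with its remainder, which makes \<open>z\<close> itself a
        common minorant of the remainders.\<close>
      hence nf: "near z (f i) = near z (r i)" if "i \<in> I" for i
        using proj_add[OF n] assms(3) that zero_add by metis
      have "le z (r i)" if i: "i \<in> I" for i
      proof -
        have "le z (f i)" using z(1) assms(4) i le_trans by blast
        hence "le (near z z) (near z (f i))" by (rule proj_mono[OF n])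
        thus ?thesis using near_self[OF zS] nf[OF i] nrS[OF i] le_trans by simp
      qed
      hence "z = zero" using assms(5) by blast
      thus ?thesis using z(2) by blast
    qed
  qed
qed

text \<open>The common part may be of mixed kind, but comparing its two components separates the
  kinds: where \<open>d\<close> lies below \<open>e\<close> it equals \<open>e\<close>, and
  elsewhere \<open>e\<close> lies below \<open>d\<close>, is of both kinds at once, and
  vanishes.\<close>

lemma infimum_exists:
  assumes "X \<subseteq> S" "X \<noteq> {}"
  obtains m where "is_inf X m"
proof -
  obtain m r where r: "\<forall>x\<in>X. add m (r x) x" "\<forall>z. (\<forall>x\<in>X. le z (r x)) \<longrightarrow> z = zero"
    using common_part[OF assms] by blast
  obtain x where "x \<in> X" using assms(2) by blast
  hence mS: "m \<in> S" using r(1) add_closed by blast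
  obtain d e where d: "directly_finite d" "purely_infinite e" "add d e m"
    using finite_infinite mS by blast
  have dS: "d \<in> S" "e \<in> S" using d(3) add_closed by blast+
  obtain p where p: "projection p" "le (p d) (p e)" "le (proj_compl p e) (proj_compl p d)"
    using comparability[OF dS] by blast
  let ?q = "proj_compl p"
  have q: "projection ?q" using proj_compl_projection p(1) by blast
  have "le (p m) (p e)"
    using purely_infinite_add_le[OF purely_infinite_proj[OF p(1) d(2)] p(2) le_refl proj_add[OF p(1) d(3)]]
      proj_in[OF p(1) dS(2)] .
  hence "p m = p e" using le_antisym proj_mono[OF p(1) add_le2[OF d(3)]] by blast
  hence pm: "purely_infinite (p m)" using purely_infinite_proj[OF p(1) d(2)] by simp
  have "?q e = zero"
    using finite_infinite_zero directly_finite_le[OF directly_finite_proj[OF q d(1)] p(3)]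
      purely_infinite_proj[OF q d(2)] by blast
  hence "?q m = ?q d" using proj_add[OF q d(3)] comm zero_add by metis
  hence qm: "directly_finite (?q m)" using directly_finite_proj[OF q d(1)] by simp
  have local: "\<forall>x\<in>X. add (h m) (h (r x)) (h x)" "\<forall>z. (\<forall>x\<in>X. le z (h (r x))) \<longrightarrow> z = zero"
    "\<And>l. \<forall>x\<in>X. le l x \<Longrightarrow> \<forall>x\<in>X. le (h l) (h x)"
    if h: "projection h" for h
  proof -
    show "\<forall>x\<in>X. add (h m) (h (r x)) (h x)" using r(1) proj_add[OF h] by blast
    have "le (h (r x)) (r x)" if "x \<in> X" for x
      using r(1) that proj_le_self[OF h] add_closed by blast
    thus "\<forall>z. (\<forall>x\<in>X. le z (h (r x))) \<longrightarrow> z = zero" using r(2) le_trans by blast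
    show "\<And>l. \<forall>x\<in>X. le l x \<Longrightarrow> \<forall>x\<in>X. le (h l) (h x)" using proj_mono[OF h] by blast
  qed
  have "le l m" if l: "l \<in> S" "\<forall>x\<in>X. le l x" for l
  proof (rule le_split[OF p(1) l(1) mS])
    show "le (p l) (p m)"
      using common_part_greatest_infinite[OF pm assms(2) local(1)[OF p(1)] local(3)[OF p(1) l(2)]]
        local(2)[OF p(1)] by blast
    show "le (?q l) (?q m)"
      using common_part_greatest_finite[OF qm assms(2) local(1)[OF q] local(3)[OF q l(2)]]
        local(2)[OF q] by blast
  qed
  hence "is_inf X m" unfolding is_inf_def using mS r(1) add_le1 by blast
  thus thesis by (rule that)
qed

text \<open>To use remoteness of the full elements, write \<open>p b = c + d\<close> with
  \<open>c\<close> below \<open>p a\<close> and \<open>d\<close> below \<open>x\<close>, and add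
  back the complementary part of \<open>b\<close> to get \<open>e\<close>. Then
  \<open>b = c + e\<close> lies below \<open>a + e\<close>, hence below \<open>e\<close>; projecting
  again leaves \<open>p b\<close> below \<open>d\<close>. The sums exist because all summands lie
  below the purely infinite \<open>b\<close>.\<close>

lemma rem_ll_proj:
  assumes "projection p" "purely_infinite b" "rem_ll a b"
  shows "rem_ll (p a) (p b)"
proof -
  have ab: "le a b" "\<And>x t. add a x t \<Longrightarrow> le b t \<Longrightarrow> le b x"
    using assms(3) add_closed unfolding rem_ll_def by blast+
  have S: "a \<in> S" "b \<in> S" using le_S ab(1) by blast+
  let ?q = "proj_compl p"
  have q: "projection ?q" using proj_compl_projection assms(1) by blast
  have "le (p b) x" if x: "add (p a) x t" "le (p b) t" for x t
  proof -
    obtain y where "add (p b) y t" using x(2) leE by blast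
    then obtain c d where c: "add c d (p b)" "le c (p a)" "le d x"
      using refinement[OF x(1), of "p b" y] add_le1 comm by metis
    have "le d b" using le_trans add_le2[OF c(1)] proj_le_self assms(1) S by blast
    moreover have "le (?q b) b" using proj_le_self q S by blast
    ultimately obtain e where e: "add d (?q b) e" "le e b"
      using purely_infinite_sum[OF assms(2)] by blast
    obtain s where s: "add a e s" using purely_infinite_sum[OF assms(2) ab(1) e(2)] by blast
    obtain c' where c': "add c d (p b)" "add (p b) (?q b) b"
      using c(1) proj_split[OF assms(1) S(2)] by blast
    obtain e' where "add d (?q b) e'" "add c e' b" using assoc_right[OF c'] by blast
    hence "add c e b" using add_functional e(1) by blast
    hence "le b s"
      using add_mono[OF s] le_trans[OF c(2) proj_le_self[OF assms(1) S(1)]] le_refl e(1) add_closed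
        by blast
    hence "le b e" using ab(2) s by blast
    hence "le (p b) (p e)" by (rule proj_mono[OF assms(1)])
    moreover have "p (?q b) = zero"
      using proj_of_compl_image[OF assms(1)] proj_compl_projection(2)[OF assms(1)] S(2) by blast
    hence "p e = p d" using proj_add[OF assms(1) e(1)] zero_add comm by metis
    moreover have "le (p d) d" using proj_le_self assms(1) e(1) add_closed by blast
    ultimately show ?thesis using le_trans c(3) by metis
  qed
  thus ?thesis unfolding rem_ll_def using proj_mono[OF assms(1) ab(1)] by blast
qed

end

section \<open>Multiples of purely infinite elements\<close>

text \<open>\<open>mult I x m\<close> reads: \<open>m\<close> is the sum of \<open>I\<close> copies of \<open>x\<close>.\<close>

locale cardinal_monoid = local_monoid +
  fixes mult :: "'i set \<Rightarrow> 'a \<Rightarrow> 'a \<Rightarrow> bool"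
  assumes mult_proj: "\<lbrakk>projection p; mult I x m\<rbrakk> \<Longrightarrow> mult I (p x) (p m)"
    and mult_exhaust: "\<lbrakk>x \<in> S; y \<in> S; x \<noteq> zero\<rbrakk> \<Longrightarrow> \<exists>I m r. mult I x m \<and> add m r y \<and> \<not> le x r"
    and mult_finite: "\<lbrakk>purely_infinite x; finite I; mult I x m\<rbrakk> \<Longrightarrow> le m x"
    and mult_absorb: "\<lbrakk>infinite I; mult I x m; x \<in> S\<rbrakk> \<Longrightarrow> add m x m"
    and mult_mult: "\<lbrakk>infinite I; I \<lesssim> J; mult I y w; mult J x y\<rbrakk> \<Longrightarrow> w = y"
begin

text \<open>Exhaust \<open>x\<close> by copies of a suitable \<open>x'\<close> and pass to a piece
  where the remainder lies below \<open>x'\<close>. There finitely many copies would put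
  \<open>x\<close> below \<open>x'\<close>, so the multiplicity is infinite and absorbs the
  remainder.\<close>

lemma strict_multiple:
  assumes Y: "\<And>x. x \<in> Y \<Longrightarrow> purely_infinite x"
    and no_min: "\<And>x u. \<lbrakk>x \<in> Y; le u z; u \<noteq> zero\<rbrakk> \<Longrightarrow> \<exists>x'\<in>Y. \<not> le (near u x) (near u x')"
    and x: "x \<in> Y" "le u z" "u \<noteq> zero"
  shows "\<exists>x'\<in>Y. \<exists>v I. le v u \<and> v \<noteq> zero \<and> infinite I \<and> mult I (near v x') (near v x) \<and>
    (\<forall>w. le w v \<longrightarrow> w \<noteq> zero \<longrightarrow> \<not> le (near w x) (near w x'))"
proof -
  obtain x' where x': "x' \<in> Y" "\<not> le (near u x) (near u x')" using no_min x by blast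
  have S: "x \<in> S" "x' \<in> S" "u \<in> S" using Y x x' le_S unfolding purely_infinite_def by blast+
  obtain q where q: "projection q" "le (q x) (q x')"
    "\<And>h. projection h \<Longrightarrow> le (h x) (h x') \<Longrightarrow> h ` S \<subseteq> q ` S"
    using largest_projection[OF S(1,2)] by blast
  \<comment> \<open>Off the largest projection \<open>q\<close> the inequality fails over every
    nonzero element, not just over \<open>?v\<close>; this hereditary failure survives any later
    shrinking.\<close>
  let ?v = "proj_compl q u"
  have qc: "projection (proj_compl q)" "?v \<in> polar (q ` S)" "le ?v u"
    using proj_compl_projection[OF q(1)] proj_le_self S(3) by blast+
  have vS: "?v \<in> S" using le_S qc(3) by blast
  have v0: "?v \<noteq> zero"
  proof
    assume "?v = zero"
    hence u: "u \<in> q ` S" using proj_image_iff(2)[OF q(1) S(3)] by blast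
    have "le (near u x) (near u x')"
      using proj_mono[OF near_projection[OF S(3)] q(2)] near_proj[OF q(1) u] S by simp
    thus False using x'(2) by blast
  qed
  have strict: "\<not> le (near w x) (near w x')" if w: "le w ?v" "w \<noteq> zero" for w
  proof
    have wS: "w \<in> S" using le_S w(1) by blast
    assume "le (near w x) (near w x')"
    hence "near w ` S \<subseteq> q ` S" by (rule q(3)[OF near_projection[OF wS]])
    moreover have "w \<in> near w ` S"
      using proj_image_iff(1)[OF near_projection[OF wS] wS] near_self[OF wS] by simp
    ultimately have "w \<in> q ` S" by blast
    thus False using polar_self polar_down[OF qc(2) w(1)] w(2) by blast
  qed
  let ?x = "near ?v x" and ?x' = "near ?v x'"
  have n: "projection (near ?v)" using near_projection[OF vS] .
  have nS: "?x \<in> S" "?x' \<in> S" using proj_in[OF n] S by blast+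
  \<comment> \<open>A zero value would be least over \<open>?v\<close>, against
    \<open>no_min\<close>.\<close>
  have "?x' \<noteq> zero"
  proof
    assume e: "?x' = zero"
    obtain x'' where "x'' \<in> Y" "\<not> le ?x' (near ?v x'')"
      using no_min[OF x'(1) le_trans[OF qc(3) x(2)] v0] by blast
    thus False unfolding e using zero_le proj_in[OF n] Y unfolding purely_infinite_def by blast
  qed
  then obtain I m r where I: "mult I ?x' m" "add m r ?x" "\<not> le ?x' r"
    using mult_exhaust[OF nS(2,1)] by blast
  have rS: "r \<in> S" using I(2) add_closed by blast
  obtain p where p: "projection p" "le (p r) (p ?x')" "le (proj_compl p ?x') (proj_compl p r)"
    using comparability[OF rS nS(2)] by blast
  let ?w = "p ?v"
  have w: "le ?w ?v" "?w \<in> p ` S" "?w \<in> S"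
    using proj_le_self[OF p(1) vS] vS proj_in[OF p(1)] by blast+
  \<comment> \<open>If \<open>p\<close> killed \<open>?v\<close>, it would also kill
    \<open>?x'\<close>, which lies in the bipolar of \<open>?v\<close>; comparability would then
    give \<open>?x'\<close> below \<open>r\<close>, against the exhaustion.\<close>
  have w0: "?w \<noteq> zero"
  proof
    assume "?w = zero"
    hence "?v \<in> polar (p ` S)" using proj_compl_image_iff(1)[OF p(1) vS] by blast
    moreover have "p ` S \<subseteq> S" using proj_in[OF p(1)] by blast
    ultimately have "p ?x' \<in> polar {?v}"
      using nS(2) orth_sym unfolding polar_def by blast
    moreover have "?x' \<in> polar (polar {?v})" using near_image[OF vS] S(2) by blast
    hence "p ?x' \<in> polar (polar {?v})" using polar_down proj_le_self[OF p(1) nS(2)] by blast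
    ultimately have "p ?x' = zero" using polar_self by blast
    hence "le (p ?x') (p r)" using zero_le proj_in[OF p(1) rS] by simp
    thus False using le_split[OF p(1) nS(2) rS _ p(3)] I(3) by blast
  qed
  have h: "projection (near ?w)" using near_projection[OF w(3)] .
  have hx: "near ?w ?x = near ?w x" "near ?w ?x' = near ?w x'" using near_near[OF w(1)] S by blast+
  have inf: "purely_infinite (near ?w x')" using purely_infinite_proj[OF h Y[OF x'(1)]] .
  have hr: "le (near ?w r) (near ?w x')"
    using proj_mono[OF h p(2)] near_proj[OF p(1) w(2)] rS nS hx by simp
  let ?m = "near ?w m"
  have m: "mult I (near ?w x') ?m" "add ?m (near ?w r) (near ?w x)"
    using mult_proj[OF h I(1)] proj_add[OF h I(2)] unfolding hx by blast+
  have I_inf: "infinite I"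
  proof
    assume "finite I"
    hence "le ?m (near ?w x')" using mult_finite[OF inf _ m(1)] by blast
    hence "le (near ?w x) (near ?w x')" using purely_infinite_add_le[OF inf _ hr m(2)] by blast
    thus False using strict[OF w(1) w0] by blast
  qed
  have "add ?m (near ?w x') ?m" using mult_absorb[OF I_inf m(1) proj_in[OF h S(2)]] .
  hence "le (near ?w x) ?m" using add_mono[OF _ m(2) _ hr] le_refl m(2) add_closed by blast
  hence "near ?w x = ?m" using le_antisym add_le1[OF m(2)] by blast
  hence "mult I (near ?w x') (near ?w x)" using m(1) by simp
  moreover have "le ?w u" using le_trans w(1) qc(3) by blast
  moreover have "\<forall>v. le v ?w \<longrightarrow> v \<noteq> zero \<longrightarrow> \<not> le (near v x) (near v x')"
    using strict le_trans w(1) by blast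
  ultimately show ?thesis using x'(1) w0 I_inf by blast
qed

text \<open>Otherwise the values of \<open>Y\<close> near \<open>z\<close> decrease strictly, each one being an infinite multiple of a
  smaller one; the next multiplicity after a least possible one \<open>I\<close> is at least \<open>I\<close>, and absorbs it.\<close>

lemma purely_infinite_local_min:
  assumes Y: "\<And>x. x \<in> Y \<Longrightarrow> purely_infinite x" "Y \<noteq> {}" and z: "z \<in> S" "z \<noteq> zero"
  obtains u x where "le u z" "u \<noteq> zero" "x \<in> Y" "\<And>x'. x' \<in> Y \<Longrightarrow> le (near u x) (near u x')"
proof (rule ccontr)
  note obtained = that
  assume neg: "\<not> thesis"
  have no_min: "\<exists>x'\<in>Y. \<not> le (near u x) (near u x')" if "x \<in> Y" "le u z" "u \<noteq> zero" for x u
    using neg obtained that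
    by blast
  \<comment> \<open>The failure is required over all smaller pieces because the next descent step
    replaces \<open>v\<close> by some \<open>w\<close> below it, and the contradiction arises over
    that \<open>w\<close>.\<close>
  define R where "R x x' v I \<longleftrightarrow> x \<in> Y \<and> x' \<in> Y \<and> le v z \<and> v \<noteq> zero \<and> infinite I \<and>
    mult I (near v x') (near v x) \<and> (\<forall>w. le w v \<longrightarrow> w \<noteq> zero \<longrightarrow> \<not> le (near w x) (near w x'))"
    for x x' v and I :: "'i set"
  have step: "\<exists>x' v I. le v u \<and> R x x' v I" if xu: "x \<in> Y" "le u z" "u \<noteq> zero" for x u
  proof -
    obtain x' v I where v: "x' \<in> Y" "le v u" "v \<noteq> zero" "infinite I" "mult I (near v x') (near v x)"
      "\<forall>w. le w v \<longrightarrow> w \<noteq> zero \<longrightarrow> \<not> le (near w x) (near w x')"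
      using strict_multiple[of Y z, OF Y(1) no_min xu] by blast
    thus ?thesis using le_trans[OF v(2) xu(2)] xu(1) unfolding R_def by blast
  qed
  define C where "C = {card_of I | I. \<exists>x x' v. R x x' v I}"
  obtain x0 where "x0 \<in> Y" using Y(2) by blast
  then obtain x' v I where "R x0 x' v I" using step[OF _ le_refl[OF z(1)] z(2)] by blast
  hence "card_of I \<in> C" unfolding C_def by blast
  hence "C \<noteq> {}" by blast
  moreover have "\<forall>c\<in>C. Card_order c" unfolding C_def using card_of_Card_order by blast
  ultimately have "\<exists>c\<in>C. \<forall>c'\<in>C. (c, c') \<in> ordLeq" by (rule exists_minim_Card_order)
  then obtain c where c: "c \<in> C" "\<forall>c'\<in>C. (c, c') \<in> ordLeq" by blast
  then obtain I x x' v where I: "R x x' v I" "c = card_of I" unfolding C_def by blast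
  obtain x'' w J where J: "le w v" "R x' x'' w J" using step[of x' v] I(1) unfolding R_def by blast
  have "(card_of I, card_of J) \<in> ordLeq" using c(2) J(2) I(2) unfolding C_def by blast
  hence le: "I \<lesssim> J" unfolding lepoll_def card_of_ordLeq[symmetric] by blast
  have S: "x \<in> S" "x' \<in> S" "x'' \<in> S" "w \<in> S" "v \<in> S"
    using I(1) J Y(1) le_S unfolding R_def purely_infinite_def by blast+
  have "mult I (near v x') (near v x)" using I(1) unfolding R_def by blast
  hence "mult I (near w (near v x')) (near w (near v x))"
    by (rule mult_proj[OF near_projection[OF S(4)]])
  hence 1: "mult I (near w x') (near w x)" using near_near[OF J(1)] S by simp
  have 2: "mult J (near w x'') (near w x')" "infinite I" using I(1) J(2) unfolding R_def by blast+
  have "near w x = near w x'"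
    using mult_mult[OF 2(2) le 1 2(1)] .
  moreover have "\<not> le (near w x) (near w x')" using I(1) J unfolding R_def by blast
  ultimately show False using le_refl proj_in[OF near_projection[OF S(4)] S(2)] by simp
qed

lemma least_remote:
  assumes "purely_infinite a" "purely_infinite b" "rem_ll a b"
  shows "\<exists>m. (purely_infinite m \<and> rem_ll a m \<and> polar {m} = polar {b}) \<and>
    (\<forall>x. purely_infinite x \<and> rem_ll a x \<and> polar {x} = polar {b} \<longrightarrow> le m x)"
proof -
  define Y where "Y = {x. purely_infinite x \<and> rem_ll a x \<and> polar {x} = polar {b}}"
  have bY: "b \<in> Y" using assms unfolding Y_def by blast
  have YS: "Y \<subseteq> S" unfolding Y_def purely_infinite_def by blast
  obtain m where "is_inf Y m" using infimum_exists[OF YS] bY by blast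
  hence m: "m \<in> S" "\<And>x. x \<in> Y \<Longrightarrow> le m x" "\<And>l. l \<in> S \<Longrightarrow> \<forall>x\<in>Y. le l x \<Longrightarrow> le l m"
    unfolding is_inf_def by blast+
  have mb: "le m b" using m(2) bY .
  have S: "a \<in> S" "b \<in> S" using assms unfolding purely_infinite_def by blast+
  have local: "\<exists>u x. le u z \<and> u \<noteq> zero \<and> x \<in> Y \<and> near u m = near u x" if z: "z \<in> S" "z \<noteq> zero" for z
  proof -
    obtain u x where u: "le u z" "u \<noteq> zero" "x \<in> Y" "\<And>x'. x' \<in> Y \<Longrightarrow> le (near u x) (near u x')"
      using purely_infinite_local_min[of Y z] z bY unfolding Y_def by blast
    have uS: "u \<in> S" "x \<in> S" using u le_S YS by blast+
    let ?p = "near u" and ?q = "proj_compl (near u)"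
    have p: "projection ?p" "projection ?q"
      using near_projection[OF uS(1)] proj_compl_projection by blast+
    have "le (?p x) b" using le_trans[OF u(4)[OF bY] proj_le_self[OF p(1) S(2)]] .
    moreover have "le (?q m) b" using le_trans[OF proj_le_self[OF p(2) m(1)] mb] .
    \<comment> \<open>Gluing the locally least \<open>x\<close> over \<open>u\<close> to
      \<open>m\<close> elsewhere gives another lower bound of \<open>Y\<close>. It lies below the
      infimum, so \<open>m\<close> and \<open>x\<close> agree over \<open>u\<close>. The sum is
      defined because both pieces lie below the purely infinite \<open>b\<close>.\<close>
    ultimately obtain l where l: "add (?p x) (?q m) l"
      using purely_infinite_sum[OF assms(2)] by blast
    have "le l x'" if x': "x' \<in> Y" for x'
    proof -
      have "x' \<in> S" using x' YS by blast
      from add_mono[OF proj_split[OF p(1) this] l u(4)[OF x'] proj_mono[OF p(2) m(2)[OF x']]]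
      show ?thesis .
    qed
    hence "le l m" using m(3) l add_closed by blast
    hence 1: "le (?p l) (?p m)" by (rule proj_mono[OF p(1)])
    have "?p x \<in> ?p ` S" using uS by blast
    hence "?p (?p x) = ?p x" using proj_image_iff(1)[OF p(1) proj_in[OF p(1) uS(2)]] by blast
    hence "le (?p x) (?p l)" using proj_mono[OF p(1) add_le1[OF l]] by simp
    hence "le (?p x) (?p m)" using 1 le_trans by blast
    moreover have "le (?p m) (?p x)" using proj_mono[OF p(1) m(2)[OF u(3)]] .
    ultimately show ?thesis using u le_antisym by blast
  qed
  have inf: "purely_infinite m"
  proof -
    obtain t where t: "add m m t" using purely_infinite_sum[OF assms(2) mb mb] by blast
    have tS: "t \<in> S" using t add_closed by blast
    have "le t m"
    proof (rule le_local[OF tS m(1)])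
      fix z assume z: "le z t" "z \<noteq> zero"
      obtain u x where u: "le u z" "u \<noteq> zero" "x \<in> Y" "near u m = near u x"
        using local le_S z by blast
      have p: "projection (near u)" using near_projection le_S u(1) by blast
      have "purely_infinite (near u m)" 
        using purely_infinite_proj[OF p] u(3) unfolding u(4) Y_def by blast
      hence "near u t = near u m" 
        using proj_add[OF p t] add_functional unfolding purely_infinite_def by blast
      thus "\<exists>u. le u z \<and> u \<noteq> zero \<and> le (near u t) (near u m)"
        using u le_refl proj_in[OF p tS] by metis
    qed
    hence "t = m" using le_antisym add_le1[OF t] by blast
    thus ?thesis unfolding purely_infinite_def using t m(1) by simp
  qed
  have am: "le a m" by (rule m(3)[OF S(1)]) (auto simp: Y_def rem_ll_def)
  have rem: "rem_ll a m"
  proof -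
    have "le m x" if x: "x \<in> S" "add a x t" "le m t" for x t
    proof (rule le_local[OF m(1) x(1)])
      fix z assume z: "le z m" "z \<noteq> zero"
      obtain u y where u: "le u z" "u \<noteq> zero" "y \<in> Y" "near u m = near u y"
        using local le_S z by blast
      have p: "projection (near u)" using near_projection le_S u(1) by blast
      have "rem_ll (near u a) (near u y)" using rem_ll_proj[OF p] u(3) unfolding Y_def by blast
      hence "le (near u m) (near u x)"
        unfolding u(4)[symmetric] rem_ll_def
        using proj_add[OF p x(2)] proj_mono[OF p x(3)] proj_in[OF p x(1)] by blast
      thus "\<exists>u. le u z \<and> u \<noteq> zero \<and> le (near u m) (near u x)" using u by blast
    qed
    thus ?thesis unfolding rem_ll_def using am by blast
  qed
  have "polar {m} = polar {b}"
  proof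
    show "polar {b} \<subseteq> polar {m}" unfolding polar_def orth_def using mb le_trans by blast
    show "polar {m} \<subseteq> polar {b}"
    proof
      fix s assume s: "s \<in> polar {m}"
      show "s \<in> polar {b}"
      proof (rule polarI)
        show "s \<in> S" using s polar_S by blast
        fix x c assume "x \<in> {b}" and c: "le c s" "le c x"
        hence cb: "le c b" by simp
        show "c = zero"
        proof (rule ccontr)
          assume "c \<noteq> zero"
          then obtain u y where u: "le u c" "u \<noteq> zero" "y \<in> Y" "near u m = near u y"
            using local le_S c(1) by blast
          have uS: "u \<in> S" "y \<in> S" using u le_S YS by blast+
          \<comment> \<open>Over \<open>u\<close> the infimum agrees with \<open>y\<close>, so
            \<open>u\<close> is disjoint from \<open>y\<close>. As \<open>y\<close> has the same
            polar as \<open>b\<close>, it is also disjoint from \<open>b\<close>, although it lies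
            below \<open>b\<close>.\<close>
          have "u \<in> polar {m}" using polar_down s le_trans u(1) c(1) by blast
          hence "m \<in> polar {u}" using polar_singleton_sym m(1) by blast
          hence "near u y = zero" using near_zero_iff[OF uS(1) m(1)] u(4) by simp
          hence "y \<in> polar {u}" using near_zero_iff[OF uS] by blast
          hence "u \<in> polar {b}" using polar_singleton_sym[OF uS(2)] polar_singleton_sym u(3) uS 
            unfolding Y_def by blast
          thus False using polarD[of u "{b}" b u] le_refl[OF uS(1)] le_trans[OF u(1) cb] u(2) by blast
        qed
      qed
    qed
  qed
  hence "m \<in> Y" unfolding Y_def using inf rem by blast
  thus ?thesis using m(2) unfolding Y_def by blast
qed

lemma continuous: "continuous_dimension_scale S add zero"
proof
  show "\<And>X. X \<subseteq> S \<Longrightarrow> X \<noteq> {} \<Longrightarrow> \<exists>m. is_inf X m" using infimum_exists by blast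
  show "\<exists>p. projection p \<and> le (p x) (p y) \<and> le (proj_compl p y) (proj_compl p x)"
    if "x \<in> S" "y \<in> S" for x y using comparability[OF that] by blast
  show "\<exists>p. projection p \<and> le (p a) (p b) \<and> (\<forall>q. projection q \<and> le (q a) (q b) \<longrightarrow> proj_le q p)"
    if "a \<in> S" "b \<in> S" for a b using largest_projection[OF that] unfolding proj_le_def by metis
  show "\<And>x. x \<in> S \<Longrightarrow> \<exists>d e. directly_finite d \<and> purely_infinite e \<and> add d e x"
    by (rule finite_infinite)
qed (rule least_remote)

end

section \<open>Orthogonal sums in an espalier\<close>

context espalier
begin

section \<open>Bounded suprema and binary orthogonal sums\<close>

lemma glb_iff: "isGlb UNIV A s \<longleftrightarrow> (\<forall>x\<in>A. s \<le> x) \<and> (\<forall>u. (\<forall>x\<in>A. u \<le> x) \<longrightarrow> u \<le> (s::'a))"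
  unfolding isGlb_def isLb_def greatestP_def setle_def setge_def by auto

lemma bounded_lub:
  assumes "\<And>x. x \<in> A \<Longrightarrow> x \<le> (u::'a)"
  obtains s where "isLub UNIV A s" "s \<le> u"
proof -
  have "u \<in> {v. \<forall>x\<in>A. x \<le> v}" using assms by simp
  hence "{v. \<forall>x\<in>A. x \<le> v} \<noteq> {}" by (metis empty_iff)
  then obtain s where s: "isGlb UNIV {v. \<forall>x\<in>A. x \<le> v} s" using L1[of "{v. \<forall>x\<in>A. x \<le> v}"] by metis
  have "isLub UNIV A s" unfolding lub_iff
  proof (intro conjI ballI allI impI)
    show "x \<le> s" if "x \<in> A" for x using s that unfolding glb_iff by simp
    show "s \<le> v" if "\<forall>x\<in>A. x \<le> v" for v using s that unfolding glb_iff by simp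
  qed
  moreover have "s \<le> u" using s assms unfolding glb_iff by simp
  ultimately show thesis by (rule that)
qed

lemma lub_unique: "isLub UNIV A s \<Longrightarrow> isLub UNIV A t \<Longrightarrow> s = (t::'a)"
  unfolding lub_iff by (metis antisym)

lemma lubD: "isLub UNIV A s \<Longrightarrow> x \<in> A \<Longrightarrow> x \<le> (s::'a)"
  unfolding lub_iff by blast

lemma lub_least: "isLub UNIV A s \<Longrightarrow> (\<And>x. x \<in> A \<Longrightarrow> x \<le> u) \<Longrightarrow> s \<le> (u::'a)"
  unfolding lub_iff by blast

lemma meet_exists: obtains m where "isGlb UNIV {a, b::'a} m" "m \<le> a" "m \<le> b"
proof -
  obtain m where m: "isGlb UNIV {a, b} m" using L1[of "{a, b}"] by blast
  thus thesis using that unfolding glb_iff by blast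
qed

lemma perp_mono: "perp b d \<Longrightarrow> a \<le> b \<Longrightarrow> c \<le> d \<Longrightarrow> perp a c"
  using L2_ii L2_iii by blast

lemma perp_disjoint: "perp a b \<Longrightarrow> x \<le> a \<Longrightarrow> x \<le> b \<Longrightarrow> x = lzero"
  using L2_v perp_mono by blast

lemma osum_commute: "osum perp a b c \<longleftrightarrow> osum perp b a c"
  unfolding osum_def using L2_ii by (auto simp: insert_commute)

lemma osum_le: "osum perp a b c \<Longrightarrow> a \<le> c \<and> b \<le> c"
  unfolding osum_def lub_iff by blast

lemma osum_least: "osum perp a b c \<Longrightarrow> a \<le> u \<Longrightarrow> b \<le> u \<Longrightarrow> c \<le> u"
  unfolding osum_def lub_iff by blast

lemma osum_exists:
  assumes "perp a b" "a \<le> u" "b \<le> u"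
  obtains c where "osum perp a b c" "c \<le> u"
proof -
  obtain c where "isLub UNIV {a, b} c" "c \<le> u"
    using bounded_lub[of "{a, b}" u] assms by blast
  thus thesis using that assms unfolding osum_def by blast
qed

lemma perp_shift:
  assumes "osum perp a b d" "perp d c" "osum perp b c e" "d \<le> u" "c \<le> u"
  shows "perp a e"
proof (rule L2_iv)
  show "isUb UNIV {a, b, c} u"
    unfolding isUb_def setle_def using assms osum_le[OF assms(1)] by auto
qed (use assms in \<open>auto simp: osum_def\<close>)

lemma osum_assoc:
  assumes "osum perp a b d" "osum perp d c s"
  obtains e where "osum perp b c e" "osum perp a e s"
proof -
  have le: "a \<le> s" "b \<le> s" "c \<le> s" "d \<le> s" "b \<le> d" "a \<le> d"
    using osum_le[OF assms(1)] osum_le[OF assms(2)] by auto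
  have "perp d c" using assms(2) unfolding osum_def by blast
  hence "perp b c" using perp_mono le by blast
  then obtain e where e: "osum perp b c e" "e \<le> s" using osum_exists le by blast
  have "perp a e" using perp_shift[OF assms(1) \<open>perp d c\<close> e(1)] le by blast
  moreover have "isLub UNIV {a, e} s"
    unfolding lub_iff
  proof (intro conjI allI impI)
    show "\<forall>x\<in>{a, e}. x \<le> s" using le e by simp
    fix u assume u: "\<forall>x\<in>{a, e}. x \<le> u"
    hence "b \<le> u" "c \<le> u" using osum_le[OF e(1)] by (auto intro: order_trans)
    thus "s \<le> u" using osum_least[OF assms(2) osum_least[OF assms(1)]] u by blast
  qed
  ultimately show thesis using that e unfolding osum_def by blast
qed

text \<open>This is \<open>L8\<close> for \<open>x\<close> and \<open>a\<close>, which meet in zero: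
  then \<open>x\<close> complements the meet inside \<open>x\<close>, while \<open>y\<close>
  complements \<open>a\<close> inside the join.\<close>

lemma complement_sim:
  assumes "osum perp a x c" "osum perp a y c"
  shows "sim x y"
proof -
  have "isLub UNIV {x, a} c" "perp a x"
    using assms(1) unfolding osum_def by (auto simp: insert_commute)
  moreover have "isGlb UNIV {x, a} lzero"
    unfolding glb_iff using lzero_le perp_disjoint[OF \<open>perp a x\<close>] by auto
  ultimately show ?thesis using L8[of x a c lzero x y] assms osum_lzero by blast
qed

lemma parallelogram:
  fixes a b c
  assumes "a \<le> c" "b \<le> c"
  obtains m x y j where "osum perp m x a" "m \<le> b" "osum perp b y j" "sim x y" "j \<le> c" "a \<le> j"
    "isGlb UNIV {a, b} m" "isLub UNIV {a, b} j"
proof -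
  obtain m where m: "isGlb UNIV {a, b} m" "m \<le> a" "m \<le> b" using meet_exists by blast
  obtain j where j: "isLub UNIV {a, b} j" "j \<le> c"
    using bounded_lub[of "{a, b}" c] assms by blast
  have "a \<le> j" "b \<le> j" using j(1) lubD by blast+
  obtain x where x: "osum perp m x a" using L3 m by blast
  obtain y where y: "osum perp b y j" using L3 \<open>b \<le> j\<close> by blast
  show thesis using that[OF x m(3) y L8[OF j(1) m(1) x y] j(2) \<open>a \<le> j\<close> m(1) j(1)] .
qed

section \<open>An independence criterion for orthogonal families\<close>

lemma fin_osum_lub: "fin_osum perp a J s \<Longrightarrow> isLub UNIV (a ` J) s"
proof (induction rule: fin_osum.induct)
  case empty
  show ?case using lzero_le unfolding lub_iff by simp
next
  case (insert i J s t)
  have t: "s \<le> t" "a i \<le> t" "\<And>u. s \<le> u \<Longrightarrow> a i \<le> u \<Longrightarrow> t \<le> u"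
    using insert(3) osum_le osum_least by blast+
  have s: "\<forall>x\<in>a ` J. x \<le> s" "\<And>u. \<forall>x\<in>a ` J. x \<le> u \<Longrightarrow> s \<le> u"
    using insert.IH unfolding lub_iff by blast+
  show ?case unfolding lub_iff
  proof (intro conjI allI impI)
    show "\<forall>x\<in>a ` insert i J. x \<le> t" using s(1) t order_trans by auto
    show "t \<le> u" if "\<forall>x\<in>a ` insert i J. x \<le> u" for u using t(3)[OF s(2)] that by simp
  qed
qed

text \<open>With the converse \<open>fin_osum_exists\<close> this replaces the inductive definition
  by a condition free of enumerations: each member is perpendicular to some bound of all the
  others.\<close>

lemma fin_osum_independent:
  assumes "fin_osum perp a J s" "i \<in> J"
  shows "\<exists>t\<le>s. perp (a i) t \<and> (\<forall>j\<in>J - {i}. a j \<le> t)"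
  using assms
proof (induction arbitrary: i rule: fin_osum.induct)
  case empty
  thus ?case by simp
next
  case (insert k J s u)
  have u: "s \<le> u" "a k \<le> u" "perp s (a k)" using insert.hyps(3) unfolding osum_def lub_iff by auto
  have J: "\<forall>j\<in>J. a j \<le> s" using fin_osum_lub[OF insert.hyps(2)] unfolding lub_iff by blast
  show ?case
  proof (cases "i = k")
    case True
    have "\<forall>j\<in>insert k J - {i}. a j \<le> s" using J True by auto
    thus ?thesis using True u L2_ii by blast
  next
    case False
    hence "i \<in> J" using insert.prems by blast
    then obtain t where t: "t \<le> s" "perp (a i) t" "\<forall>j\<in>J - {i}. a j \<le> t"
      using insert.IH by blast
    obtain d where d: "osum perp (a i) t d" "d \<le> s"
      using osum_exists[OF t(2)] J \<open>i \<in> J\<close> t(1) by blast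
    have dk: "perp d (a k)" "perp t (a k)" using u(3) d(2) t(1) perp_mono by blast+
    obtain e where e: "osum perp t (a k) e" "e \<le> u"
      using osum_exists[OF dk(2)] t(1) u order_trans by blast
    \<comment> \<open>The sum of \<open>a i\<close> and \<open>t\<close> stays below
      \<open>s\<close>, hence is perpendicular to the new member; \<open>L2_iv\<close> moves that
      member over to the side of \<open>t\<close>.\<close>
    have "perp (a i) e" using perp_shift[OF d(1) dk(1) e(1)] d(2) u order_trans by blast
    moreover have "\<forall>j\<in>insert k J - {i}. a j \<le> e"
      using t(3) osum_le[OF e(1)] order_trans by blast
    ultimately show ?thesis using e by blast
  qed
qed

lemma fin_osum_exists:
  assumes "finite J" "\<And>i. i \<in> J \<Longrightarrow> a i \<le> u"
    and "\<And>i. i \<in> J \<Longrightarrow> \<exists>t. perp (a i) t \<and> (\<forall>j\<in>J - {i}. a j \<le> t)"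
  shows "\<exists>s. fin_osum perp a J s"
  using assms
proof (induction J rule: finite_induct)
  case empty
  show ?case using fin_osum.empty by blast
next
  case (insert i J)
  have "\<exists>t. perp (a k) t \<and> (\<forall>j\<in>J - {k}. a j \<le> t)" if "k \<in> J" for k
    using insert.prems(2)[of k] that by blast
  then obtain s where s: "fin_osum perp a J s" using insert.IH insert.prems(1) by blast
  obtain t where t: "perp (a i) t" "\<forall>j\<in>J. a j \<le> t"
    using insert.prems(2)[of i] insert.hyps(2) by auto
  have "s \<le> t" "s \<le> u"
    using lub_least[OF fin_osum_lub[OF s]] t insert.prems(1) by blast+
  hence "perp s (a i)" using t(1) perp_mono L2_ii by blast
  then obtain v where "osum perp s (a i) v"
    using osum_exists \<open>s \<le> u\<close> insert.prems(1) by blast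
  thus ?case using fin_osum.insert[OF insert.hyps(2) s] by blast
qed

lemma big_osum_lub: "big_osum perp I a s \<Longrightarrow> isLub UNIV (a ` I) s"
  unfolding big_osum_def by blast

lemma big_osum_le: "big_osum perp I a s \<Longrightarrow> i \<in> I \<Longrightarrow> a i \<le> s"
  using big_osum_lub lubD by blast

lemma big_osum_least: "big_osum perp I a s \<Longrightarrow> (\<And>i. i \<in> I \<Longrightarrow> a i \<le> u) \<Longrightarrow> s \<le> u"
  using big_osum_lub lub_least by blast

lemma big_osumI:
  assumes "isLub UNIV (a ` I) s"
    and "\<And>i. i \<in> I \<Longrightarrow> \<exists>t. perp (a i) t \<and> (\<forall>j\<in>I - {i}. a j \<le> t)"
  shows "big_osum perp I a s"
proof -
  have le: "a i \<le> s" if "i \<in> I" for i using lubD[OF assms(1)] that by blast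
  have "\<exists>t. fin_osum perp a J t" if "finite J" "J \<subseteq> I" for J
  proof (rule fin_osum_exists[OF that(1)])
    show "a i \<le> s" if "i \<in> J" for i using le that \<open>J \<subseteq> I\<close> by blast
    show "\<exists>t. perp (a i) t \<and> (\<forall>j\<in>J - {i}. a j \<le> t)" if "i \<in> J" for i
      using assms(2)[of i] that \<open>J \<subseteq> I\<close> by blast
  qed
  thus ?thesis using assms(1) le unfolding big_osum_def orthogonal_family_def by blast
qed

text \<open>The supremum of the other members works: \<open>a i\<close> is perpendicular to each of
  their finite partial sums, and \<open>L4\<close> passes to the supremum.\<close>

lemma big_osum_independent:
  assumes "big_osum perp I a s" "i \<in> I"
  obtains t where "t \<le> s" "perp (a i) t" "\<forall>j\<in>I - {i}. a j \<le> t"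
proof -
  let ?K = "I - {i}"
  obtain t where t: "isLub UNIV (a ` ?K) t" "t \<le> s"
    using bounded_lub[of "a ` ?K" s] big_osum_le[OF assms(1)] by blast
  have fin: "\<exists>u. fin_osum perp a J u" if "finite J" "J \<subseteq> I" for J
    using assms(1) that unfolding big_osum_def orthogonal_family_def by blast
  have "orthogonal_family perp ?K a"
    unfolding orthogonal_family_def using fin big_osum_le[OF assms(1)] by blast
  hence "big_osum perp ?K a t" using t(1) unfolding big_osum_def by blast
  moreover have "perp (a i) v" if J: "finite J" "J \<subseteq> ?K" "fin_osum perp a J v" for J v
  proof -
    obtain u where u: "fin_osum perp a (insert i J) u" using fin[of "insert i J"] J assms(2) by auto
    obtain w where w: "perp (a i) w" "\<forall>j\<in>insert i J - {i}. a j \<le> w"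
      using fin_osum_independent[OF u, of i] by blast
    have "v \<le> w" using lub_least[OF fin_osum_lub[OF J(3)]] w(2) J(2) by blast
    thus ?thesis using w(1) perp_mono by blast
  qed
  ultimately have "perp (a i) t" by (rule L4_any_index)
  thus thesis using that[OF t(2)] lubD[OF t(1)] by blast
qed

lemma big_osum_exists:
  assumes "\<And>i. i \<in> I \<Longrightarrow> a i \<le> u"
    and "\<And>i. i \<in> I \<Longrightarrow> \<exists>t. perp (a i) t \<and> (\<forall>j\<in>I - {i}. a j \<le> t)"
  obtains s where "big_osum perp I a s" "s \<le> u"
proof -
  obtain s where "isLub UNIV (a ` I) s" "s \<le> u" using bounded_lub[of "a ` I" u] assms(1) by blast
  thus thesis using that big_osumI assms(2) by blast
qed

text \<open>Meant for unions of chains in \<open>exhaustion\<close>. The uniform bound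
  \<open>u\<close> supplies the upper bound that finite subfamilies alone do not give.\<close>

lemma big_osum_finite_character:
  assumes "\<And>J. finite J \<Longrightarrow> J \<subseteq> I \<Longrightarrow> \<exists>s\<le>u. big_osum perp J a s"
  obtains s where "big_osum perp I a s" "s \<le> u"
proof -
  have le: "a i \<le> u" if "i \<in> I" for i
    using assms[of "{i}"] that big_osum_le order_trans
      by (metis empty_subsetI finite.emptyI finite_insert insert_subset singletonI)
  obtain s where s: "isLub UNIV (a ` I) s" "s \<le> u" using bounded_lub[of "a ` I" u] le by blast
  have "\<exists>t. fin_osum perp a J t" if "finite J" "J \<subseteq> I" for J
    using assms[OF that] that unfolding big_osum_def orthogonal_family_def by blast
  hence "big_osum perp I a s" unfolding big_osum_def orthogonal_family_def using le s(1) by blast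
  thus thesis using that s(2) by blast
qed

lemma big_osum_subset:
  assumes "big_osum perp I a s" "J \<subseteq> I"
  obtains t where "big_osum perp J a t" "t \<le> s"
proof -
  have "\<exists>t. perp (a i) t \<and> (\<forall>j\<in>J - {i}. a j \<le> t)" if i: "i \<in> J" for i
  proof -
    have "i \<in> I" using i assms(2) by blast
    obtain t where "t \<le> s" "perp (a i) t" "\<forall>j\<in>I - {i}. a j \<le> t"
      using big_osum_independent[OF assms(1) \<open>i \<in> I\<close>] .
    thus ?thesis using assms(2) by blast
  qed
  thus thesis using big_osum_exists[of J a s] that big_osum_le[OF assms(1)] assms(2) by blast
qed

lemma perp_big_osum:
  assumes "big_osum perp I b t"
    and "\<And>J s. finite J \<Longrightarrow> J \<subseteq> I \<Longrightarrow> big_osum perp J b s \<Longrightarrow> perp a s"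
  shows "perp a t"
proof (rule L4_any_index[OF assms(1)])
  fix J s assume J: "finite J" "J \<subseteq> I" "fin_osum perp b J s"
  obtain s' where "big_osum perp J b s'" using big_osum_subset[OF assms(1) J(2)] .
  moreover have "s' = s" using lub_unique[OF big_osum_lub[OF calculation] fin_osum_lub[OF J(3)]] .
  ultimately show "perp a s" using assms(2) J by blast
qed

lemma big_osum_insert:
  assumes "big_osum perp I a s" "osum perp s (a i) t" "i \<notin> I"
  shows "big_osum perp (insert i I) a t"
proof (rule big_osumI)
  have t: "s \<le> t" "a i \<le> t" "perp s (a i)" using assms(2) unfolding osum_def lub_iff by auto
  show "isLub UNIV (a ` insert i I) t"
    unfolding lub_iff
  proof (intro conjI allI impI)
    show "\<forall>x\<in>a ` insert i I. x \<le> t" using big_osum_le[OF assms(1)] t order_trans by auto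
    show "t \<le> u" if "\<forall>x\<in>a ` insert i I. x \<le> u" for u
      using osum_least[OF assms(2)] big_osum_least[OF assms(1), of u] that by simp
  qed
  fix k assume k: "k \<in> insert i I"
  show "\<exists>v. perp (a k) v \<and> (\<forall>j\<in>insert i I - {k}. a j \<le> v)"
  proof (cases "k = i")
    case True
    have "\<forall>j\<in>insert i I - {k}. a j \<le> s" using big_osum_le[OF assms(1)] True by auto
    thus ?thesis using L2_ii t(3) True by blast
  next
    case False
    then obtain v where v: "v \<le> s" "perp (a k) v" "\<forall>j\<in>I - {k}. a j \<le> v"
      using big_osum_independent[OF assms(1)] k by blast
    obtain d where d: "osum perp (a k) v d" "d \<le> s"
      using osum_exists[OF v(2) big_osum_le[OF assms(1)] v(1)] k False by blast
    have di: "perp d (a i)" "perp v (a i)" using t(3) d(2) v(1) perp_mono by blast+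
    obtain e where e: "osum perp v (a i) e"
      using osum_exists[OF di(2) order_trans[OF v(1) t(1)] t(2)] .
    have "perp (a k) e" using perp_shift[OF d(1) di(1) e] d(2) t order_trans by blast
    moreover have "\<forall>j\<in>insert i I - {k}. a j \<le> e" using v(3) osum_le[OF e] order_trans by blast
    ultimately show ?thesis by blast
  qed
qed

section \<open>Regrouping infinite orthogonal sums\<close>

lemma big_osum_disjoint_perp:
  assumes "big_osum perp I a s" "J \<subseteq> I" "K \<subseteq> I" "J \<inter> K = {}"
    and "big_osum perp J a u" "big_osum perp K a v"
  shows "perp u v"
proof -
  have "perp v w" if "finite F" "F \<subseteq> J" "big_osum perp F a w" for F w
    using that
  proof (induction F arbitrary: w rule: finite_induct)
    case empty
    hence "w = lzero" using big_osum_least[of "{}" a w lzero] lzero_le antisym by (metis empty_iff)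
    thus ?case using L2_i by simp
  next
    case (insert i F)
    obtain w' where w': "big_osum perp F a w'" "w' \<le> w"
      using big_osum_subset[OF insert.prems(2), of F] by blast
    have vw: "perp v w'" using insert.IH w' insert.prems by blast
    have iI: "i \<in> I" "i \<notin> K" using insert.prems(1) assms(2,4) by auto
    obtain t where t: "t \<le> s" "perp (a i) t" "\<forall>j\<in>I - {i}. a j \<le> t"
      using big_osum_independent[OF assms(1) iI(1)] by blast
    have "v \<le> t" by (rule big_osum_least[OF assms(6)]) (use assms(3) iI t(3) in blast)
    have "w' \<le> t"
      by (rule big_osum_least[OF w'(1)]) (use insert.prems(1) insert.hyps(2) assms(2) t(3) in blast)
    \<comment> \<open>The bound \<open>t\<close> of everything but \<open>a i\<close> dominates both
      \<open>v\<close> and \<open>w'\<close>, so their sum is perpendicular to \<open>a i\<close>,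
      and \<open>perp_shift\<close> moves \<open>a i\<close> next to \<open>w'\<close>.\<close>
    obtain d where d: "osum perp v w' d" "d \<le> t" using osum_exists[OF vw \<open>v \<le> t\<close> \<open>w' \<le> t\<close>] .
    have "perp d (a i)" "perp w' (a i)" using t(2) d(2) \<open>w' \<le> t\<close> perp_mono L2_ii by blast+
    moreover have "a i \<le> s" "d \<le> s" "w' \<le> s" 
      using big_osum_le[OF assms(1) iI(1)] d(2) \<open>w' \<le> t\<close> t(1) order_trans by blast+
    moreover obtain e where e: "osum perp w' (a i) e" using osum_exists calculation by blast
    ultimately have "perp v e" using perp_shift[OF d(1) _ e] by blast
    moreover have "big_osum perp (insert i F) a e"
      using big_osum_insert[OF w'(1) e insert.hyps(2)] .
    hence "w = e" using lub_unique big_osum_lub insert.prems(2) by blast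
    ultimately show ?case by simp
  qed
  hence "perp v u" using perp_big_osum[OF assms(5)] by blast
  thus ?thesis by (rule L2_ii)
qed

lemma big_osum_group:
  assumes "big_osum perp (Sigma J I) (\<lambda>(j, i). a j i) s"
  shows "\<exists>b. big_osum perp J b s \<and> (\<forall>j\<in>J. big_osum perp (I j) (a j) (b j))"
proof -
  let ?a = "\<lambda>(j, i). a j i"
  have le: "a j i \<le> s" if "j \<in> J" "i \<in> I j" for j i
    using big_osum_le[OF assms, of "(j, i)"] that by simp
  have sub: "\<exists>b. big_osum perp ({j} \<times> I j) ?a b" if "j \<in> J" for j
    using big_osum_subset[OF assms, of "{j} \<times> I j"] that by blast
  then obtain b where b: "\<And>j. j \<in> J \<Longrightarrow> big_osum perp ({j} \<times> I j) ?a (b j)" by metis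
  have ble: "b j \<le> s" if "j \<in> J" for j using big_osum_least[OF b[OF that]] le that by auto
  have aux: "?a ` ({j} \<times> I j) = a j ` I j" for j by force
  have inner: "big_osum perp (I j) (a j) (b j)" if j: "j \<in> J" for j
  proof (rule big_osumI)
    show "isLub UNIV (a j ` I j) (b j)" using big_osum_lub[OF b[OF j]] unfolding aux .
    fix i assume i: "i \<in> I j"
    hence ji: "(j, i) \<in> {j} \<times> I j" by blast
    obtain t where t: "t \<le> b j" "perp (?a (j, i)) t" "\<forall>k\<in>{j} \<times> I j - {(j, i)}. ?a k \<le> t"
      using big_osum_independent[OF b[OF j] ji] .
    have "a j k \<le> t" if "k \<in> I j - {i}" for k using bspec[OF t(3), of "(j, k)"] that by simp
    thus "\<exists>t. perp (a j i) t \<and> (\<forall>k\<in>I j - {i}. a j k \<le> t)" using t(2) by auto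
  qed
  have "big_osum perp J b s"
  proof (rule big_osumI)
    show "isLub UNIV (b ` J) s" unfolding lub_iff
    proof (intro conjI allI impI)
      show "\<forall>x\<in>b ` J. x \<le> s" using ble by blast
      fix u assume u: "\<forall>x\<in>b ` J. x \<le> u"
      have "a j i \<le> u" if "j \<in> J" "i \<in> I j" for j i
        using big_osum_le[OF inner] that u order_trans by blast
      thus "s \<le> u" using big_osum_least[OF assms, of u] by auto
    qed
    fix j assume j: "j \<in> J"
    let ?K = "Sigma (J - {j}) I"
    obtain t where t: "big_osum perp ?K ?a t" using big_osum_subset[OF assms, of ?K] by blast
    have "perp (b j) t"
      by (rule big_osum_disjoint_perp[OF assms _ _ _ b[OF j] t]) (use j in auto)
    moreover have "b k \<le> t" if "k \<in> J - {j}" for k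
    proof -
      have "k \<in> J" using that by simp
      thus ?thesis
        using big_osum_least[OF inner, of k t] big_osum_le[OF t] that by force
    qed
    ultimately show "\<exists>t. perp (b j) t \<and> (\<forall>k\<in>J - {j}. b k \<le> t)" by blast
  qed
  thus ?thesis using inner by blast
qed

lemma big_osum_Sigma:
  assumes "big_osum perp J b s" "\<And>j. j \<in> J \<Longrightarrow> big_osum perp (I j) (a j) (b j)"
  shows "big_osum perp (Sigma J I) (\<lambda>(j, i). a j i) s"
proof (rule big_osumI)
  show "isLub UNIV ((\<lambda>(j, i). a j i) ` Sigma J I) s" unfolding lub_iff
  proof (intro conjI allI impI)
    show "\<forall>x\<in>(\<lambda>(j, i). a j i) ` Sigma J I. x \<le> s"
      using big_osum_le[OF assms(2)] big_osum_le[OF assms(1)] by (fastforce intro: order_trans)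
    fix u assume u: "\<forall>x\<in>(\<lambda>(j, i). a j i) ` Sigma J I. x \<le> u"
    have "a j i \<le> u" if "j \<in> J" "i \<in> I j" for j i using u that by blast
    thus "s \<le> u" using big_osum_least[OF assms(1)] big_osum_least[OF assms(2)] by blast
  qed
  fix k assume "k \<in> Sigma J I"
  then obtain j i where k: "k = (j, i)" "j \<in> J" "i \<in> I j" by blast
  obtain T where T: "T \<le> s" "perp (b j) T" "\<forall>l\<in>J - {j}. b l \<le> T"
    using big_osum_independent[OF assms(1) k(2)] by blast
  obtain t where t: "t \<le> b j" "perp (a j i) t" "\<forall>l\<in>I j - {i}. a j l \<le> t"
    using big_osum_independent[OF assms(2) k(3)] k(2) by blast
  have bj: "b j \<le> s" using big_osum_le[OF assms(1) k(2)] .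
  obtain d where d: "osum perp (a j i) t d" "d \<le> b j"
    using osum_exists[OF t(2) big_osum_le[OF assms(2)[OF k(2)] k(3)] t(1)] .
  have dT: "perp d T" "perp t T" using T(2) d(2) t(1) perp_mono by blast+
  \<comment> \<open>\<open>t\<close> dominates the rest of block \<open>j\<close> and
    \<open>T\<close> all other blocks, so their sum is the bound demanded by the independence
    criterion.\<close>
  obtain e where e: "osum perp t T e" using osum_exists[OF dT(2) order_trans[OF t(1) bj] T(1)] .
  have "perp (a j i) e" using perp_shift[OF d(1) dT(1) e] d(2) bj T(1) order_trans by blast
  moreover have "a l m \<le> e" if lm: "(l, m) \<in> Sigma J I - {k}" for l m
  proof (cases "l = j")
    case True
    thus ?thesis using t(3) lm k osum_le[OF e] order_trans by blast
  next
    case False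
    hence "a l m \<le> b l" "b l \<le> T" using lm big_osum_le[OF assms(2)] T(3) by auto
    thus ?thesis using osum_le[OF e] order_trans by blast
  qed
  ultimately show "\<exists>t. perp ((\<lambda>(j, i). a j i) k) t \<and> (\<forall>l\<in>Sigma J I - {k}. (\<lambda>(j, i). a j i) l \<le> t)"
    using k by (intro exI[of _ e]) auto
qed

lemma big_osum_image:
  assumes "inj_on f I"
  shows "big_osum perp (f ` I) a s \<longleftrightarrow> big_osum perp I (a \<circ> f) s"
proof
  assume A: "big_osum perp (f ` I) a s"
  show "big_osum perp I (a \<circ> f) s"
  proof (rule big_osumI)
    show "isLub UNIV ((a \<circ> f) ` I) s" using big_osum_lub[OF A] by (simp add: image_comp)
    fix i assume i: "i \<in> I"
    hence "f i \<in> f ` I" by blast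
    obtain t where "t \<le> s" "perp (a (f i)) t" "\<forall>j\<in>f ` I - {f i}. a j \<le> t"
      using big_osum_independent[OF A \<open>f i \<in> f ` I\<close>] .
    thus "\<exists>t. perp ((a \<circ> f) i) t \<and> (\<forall>j\<in>I - {i}. (a \<circ> f) j \<le> t)"
      using inj_on_eq_iff[OF assms] i by (intro exI[of _ t]) auto
  qed
next
  assume A: "big_osum perp I (a \<circ> f) s"
  show "big_osum perp (f ` I) a s"
  proof (rule big_osumI)
    show "isLub UNIV (a ` f ` I) s" using big_osum_lub[OF A] by (simp add: image_comp)
    fix k assume "k \<in> f ` I"
    then obtain i where i: "i \<in> I" "k = f i" by blast
    obtain t where "t \<le> s" "perp ((a \<circ> f) i) t"
      "\<forall>j\<in>I - {i}. (a \<circ> f) j \<le> t"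
      using big_osum_independent[OF A i(1)] .
    thus "\<exists>t. perp (a k) t \<and> (\<forall>j\<in>f ` I - {k}. a j \<le> t)" using i by (intro exI[of _ t]) auto
  qed
qed

text \<open>Binary sums become families over \<open>bool\<close>, so that splitting a family or its
  index set is an instance of regrouping.\<close>

lemma big_osum_bool: "big_osum perp (UNIV :: bool set) a s \<longleftrightarrow> osum perp (a True) (a False) s"
proof
  assume A: "big_osum perp (UNIV :: bool set) a s"
  have "a ` UNIV = {a True, a False}" unfolding UNIV_bool by auto
  hence "isLub UNIV {a True, a False} s" using big_osum_lub[OF A] by simp
  moreover obtain t where "t \<le> s" "perp (a True) t" "\<forall>j\<in>UNIV - {True}. a j \<le> t"
    using big_osum_independent[OF A, of True] by blast
  hence "perp (a True) (a False)" using perp_mono[of "a True" t] by simp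
  ultimately show "osum perp (a True) (a False) s" unfolding osum_def by blast
next
  assume A: "osum perp (a True) (a False) s"
  show "big_osum perp (UNIV :: bool set) a s"
  proof (rule big_osumI)
    have "a ` UNIV = {a True, a False}" unfolding UNIV_bool by auto
    thus "isLub UNIV (a ` UNIV) s" using A unfolding osum_def by simp
    fix i
    have "perp (a i) (a (\<not> i))" using A L2_ii unfolding osum_def by (cases i) auto
    moreover have "\<forall>j\<in>UNIV - {i}. a j \<le> a (\<not> i)" by auto
    ultimately show "\<exists>t. perp (a i) t \<and> (\<forall>j\<in>UNIV - {i}. a j \<le> t)" by blast
  qed
qed

end

section \<open>Sums of equivalence classes\<close>

context espalier
begin

abbreviation "cls \<equiv> dim_class sim"

lemma cls_eq: "cls a = cls b \<longleftrightarrow> sim a b"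
proof -
  have "cls x = Collect (sim x)" for x unfolding dim_class_def by auto
  moreover have "Collect (sim a) = Collect (sim b) \<longleftrightarrow> sim a = sim b" by (simp add: set_eq_iff fun_eq_iff)
  moreover have "sim a b \<longleftrightarrow> sim a = sim b" using sim_equiv unfolding equivp_def by blast
  ultimately show ?thesis by simp
qed

lemma cls_in: "cls a \<in> dim_set sim"
  unfolding dim_class_def dim_set_def by (rule quotientI) simp

lemma dim_set_cases:
  assumes "\<alpha> \<in> dim_set sim" obtains a where "\<alpha> = cls a"
  using assms unfolding dim_class_def dim_set_def by (auto elim: quotientE)

lemma cls_zero: "cls x = cls lzero \<longleftrightarrow> x = lzero"
  using cls_eq L5 by auto

text \<open>The extension of \<open>dim_add\<close> to families of arbitrary size, kept relational
  because the sum may be undefined. It is independent of representatives by \<open>L7\<close>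
  (\<open>bsum_unique\<close>).\<close>

definition bsum :: "'i set \<Rightarrow> ('i \<Rightarrow> 'a set) \<Rightarrow> 'a set \<Rightarrow> bool" where
  "bsum I \<alpha> \<sigma> \<longleftrightarrow> (\<exists>a s. big_osum perp I a s \<and> (\<forall>i\<in>I. \<alpha> i = cls (a i)) \<and> \<sigma> = cls s)"

lemma bsumI: "big_osum perp I a s \<Longrightarrow> (\<And>i. i \<in> I \<Longrightarrow> \<alpha> i = cls (a i)) \<Longrightarrow> bsum I \<alpha> (cls s)"
  unfolding bsum_def by blast

text \<open>\<open>L6\<close> transports the decomposition to the prescribed \<open>s\<close>. This
  is what allows sums of classes to be nested.\<close>

lemma bsum_rep:
  assumes "bsum I \<alpha> (cls s)"
  obtains a where "big_osum perp I a s" "\<forall>i\<in>I. \<alpha> i = cls (a i)"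
proof -
  obtain b t where b: "big_osum perp I b t" "\<forall>i\<in>I. \<alpha> i = cls (b i)" "sim s t"
    using assms cls_eq unfolding bsum_def by metis
  obtain c where "big_osum perp I c s" "\<forall>i\<in>I. sim (c i) (b i)"
    using L6_any_index[OF b(1,3)] by blast
  thus thesis using that b(2) cls_eq by metis
qed

lemma bsum_unique:
  assumes "bsum I \<alpha> \<sigma>" "bsum I \<alpha> \<tau>"
  shows "\<sigma> = \<tau>"
proof -
  obtain a s where a: "big_osum perp I a s" "\<forall>i\<in>I. \<alpha> i = cls (a i)" "\<sigma> = cls s"
    using assms(1) unfolding bsum_def by blast
  obtain b t where b: "big_osum perp I b t" "\<forall>i\<in>I. \<alpha> i = cls (b i)" "\<tau> = cls t"
    using assms(2) unfolding bsum_def by blast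
  have "sim s t" by (rule L7_any_index[OF a(1) b(1)]) (use a b cls_eq in metis)
  thus ?thesis using a b cls_eq by simp
qed

lemma bsum_cong: "(\<And>i. i \<in> I \<Longrightarrow> \<alpha> i = \<beta> i) \<Longrightarrow> bsum I \<alpha> \<sigma> \<longleftrightarrow> bsum I \<beta> \<sigma>"
  unfolding bsum_def by simp

lemma big_osum_cong:
  assumes "big_osum perp I a s" "\<And>i. i \<in> I \<Longrightarrow> a i = b i"
  shows "big_osum perp I b s"
proof (rule big_osumI)
  show "isLub UNIV (b ` I) s" using big_osum_lub[OF assms(1)] assms(2) by (simp cong: image_cong)
  fix i assume i: "i \<in> I"
  obtain t where "t \<le> s" "perp (a i) t" "\<forall>j\<in>I - {i}. a j \<le> t"
    using big_osum_independent[OF assms(1) i] .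
  thus "\<exists>t. perp (b i) t \<and> (\<forall>j\<in>I - {i}. b j \<le> t)" using assms(2) i by auto
qed

lemma bsum_image:
  assumes "inj_on f I"
  shows "bsum (f ` I) \<alpha> \<sigma> \<longleftrightarrow> bsum I (\<alpha> \<circ> f) \<sigma>"
proof
  assume "bsum (f ` I) \<alpha> \<sigma>"
  then obtain a s where "big_osum perp (f ` I) a s" "\<forall>i\<in>f ` I. \<alpha> i = cls (a i)" "\<sigma> = cls s"
    unfolding bsum_def by blast
  thus "bsum I (\<alpha> \<circ> f) \<sigma>"
    unfolding bsum_def using big_osum_image[OF assms] by (intro exI[of _ "a \<circ> f"] exI[of _ s]) auto
next
  assume "bsum I (\<alpha> \<circ> f) \<sigma>"
  then obtain a s where a: "big_osum perp I a s" "\<forall>i\<in>I. \<alpha> (f i) = cls (a i)" "\<sigma> = cls s"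
    unfolding bsum_def by auto
  let ?b = "a \<circ> inv_into I f"
  have "big_osum perp I (?b \<circ> f) s"
    using assms by (intro big_osum_cong[OF a(1)]) simp
  hence "big_osum perp (f ` I) ?b s" using big_osum_image[OF assms] by blast
  thus "bsum (f ` I) \<alpha> \<sigma>"
    unfolding bsum_def using a assms by (intro exI[of _ ?b] exI[of _ s]) auto
qed

lemma bsum_group:
  assumes "bsum (Sigma J I) (\<lambda>(j, i). \<alpha> j i) \<sigma>"
  obtains \<tau> where "bsum J \<tau> \<sigma>" "\<forall>j\<in>J. bsum (I j) (\<alpha> j) (\<tau> j)"
proof -
  obtain a s where a: "big_osum perp (Sigma J I) a s"
      "\<forall>k\<in>Sigma J I. (\<lambda>(j, i). \<alpha> j i) k = cls (a k)" "\<sigma> = cls s"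
    using assms unfolding bsum_def by blast
  have "big_osum perp (Sigma J I) (\<lambda>(j, i). a (j, i)) s" using a(1) by simp
  from big_osum_group[OF this] obtain b
    where b: "big_osum perp J b s" "\<forall>j\<in>J. big_osum perp (I j) (\<lambda>i. a (j, i)) (b j)" by blast
  have "bsum J (\<lambda>j. cls (b j)) \<sigma>" using bsumI[OF b(1)] a(3) by simp
  moreover have "bsum (I j) (\<alpha> j) (cls (b j))" if "j \<in> J" for j
    by (rule bsumI[of _ "\<lambda>i. a (j, i)"]) (use b(2) a(2) that in auto)
  ultimately show thesis using that by blast
qed

lemma bsum_Sigma:
  assumes "bsum J \<tau> \<sigma>" "\<And>j. j \<in> J \<Longrightarrow> bsum (I j) (\<alpha> j) (\<tau> j)"
  shows "bsum (Sigma J I) (\<lambda>(j, i). \<alpha> j i) \<sigma>"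
proof -
  obtain b s where b: "big_osum perp J b s" "\<forall>j\<in>J. \<tau> j = cls (b j)" "\<sigma> = cls s"
    using assms(1) unfolding bsum_def by blast
  have "\<exists>a. big_osum perp (I j) a (b j) \<and> (\<forall>i\<in>I j. \<alpha> j i = cls (a i))" if "j \<in> J" for j
    using bsum_rep[of "I j" "\<alpha> j" "b j"] assms(2)[OF that] b(2) that by metis
  then obtain a where a: "\<And>j. j \<in> J \<Longrightarrow> big_osum perp (I j) (a j) (b j)"
      "\<And>j. j \<in> J \<Longrightarrow> \<forall>i\<in>I j. \<alpha> j i = cls (a j i)" by metis
  have "big_osum perp (Sigma J I) (\<lambda>(j, i). a j i) s" using big_osum_Sigma[OF b(1) a(1)] .
  thus ?thesis unfolding b(3) by (rule bsumI) (use a(2) in auto)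
qed

lemma dim_add_bsum:
  "dim_add perp sim \<alpha> \<beta> \<gamma> \<longleftrightarrow> bsum UNIV (\<lambda>b. if b then \<alpha> else \<beta>) \<gamma>"
proof
  assume "dim_add perp sim \<alpha> \<beta> \<gamma>"
  then obtain a b c where "\<alpha> = cls a" "\<beta> = cls b" "\<gamma> = cls c" "osum perp a b c"
    unfolding dim_add_def by blast
  thus "bsum UNIV (\<lambda>b. if b then \<alpha> else \<beta>) \<gamma>"
    unfolding bsum_def by (intro exI[of _ "\<lambda>x. if x then a else b"] exI[of _ c]) (simp add: big_osum_bool)
next
  assume "bsum UNIV (\<lambda>b. if b then \<alpha> else \<beta>) \<gamma>"
  then obtain a c where a: "osum perp (a True) (a False) c" "\<gamma> = cls c"
      "\<forall>i. (if i then \<alpha> else \<beta>) = cls (a i)"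
    unfolding bsum_def big_osum_bool by auto
  have "\<alpha> = cls (a True)" "\<beta> = cls (a False)"
    using a(3)[rule_format, of True] a(3)[rule_format, of False] by simp_all
  thus "dim_add perp sim \<alpha> \<beta> \<gamma>" unfolding dim_add_def using a by blast
qed

lemma dim_addI: "osum perp a b c \<Longrightarrow> dim_add perp sim (cls a) (cls b) (cls c)"
  unfolding dim_add_def by blast

lemma dim_add_rep:
  assumes "dim_add perp sim \<alpha> \<beta> (cls c)"
  obtains a b where "osum perp a b c" "\<alpha> = cls a" "\<beta> = cls b"
proof -
  obtain a where a: "big_osum perp UNIV a c" "\<forall>i\<in>UNIV. (if i then \<alpha> else \<beta>) = cls (a i)"
    using bsum_rep assms unfolding dim_add_bsum by blast
  have "\<alpha> = cls (a True)" "\<beta> = cls (a False)"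
    using a(2)[rule_format, of True] a(2)[rule_format, of False] by simp_all
  thus thesis using that a(1) big_osum_bool by blast
qed

lemma dim_add_commute: "dim_add perp sim \<alpha> \<beta> \<gamma> \<longleftrightarrow> dim_add perp sim \<beta> \<alpha> \<gamma>"
  unfolding dim_add_def using osum_commute by blast

lemma dim_add_assoc:
  assumes "dim_add perp sim \<alpha> \<beta> \<delta>" "dim_add perp sim \<delta> \<gamma> \<sigma>"
  shows "\<exists>\<epsilon>. dim_add perp sim \<beta> \<gamma> \<epsilon> \<and> dim_add perp sim \<alpha> \<epsilon> \<sigma>"
proof -
  obtain d c s where d: "\<delta> = cls d" "\<gamma> = cls c" "\<sigma> = cls s" "osum perp d c s"
    using assms(2) unfolding dim_add_def by blast
  obtain a b where a: "osum perp a b d" "\<alpha> = cls a" "\<beta> = cls b"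
    using dim_add_rep assms(1) d(1) by blast
  obtain e where "osum perp b c e" "osum perp a e s" using osum_assoc[OF a(1) d(4)] .
  thus ?thesis using dim_addI d a by blast
qed

end

sublocale espalier \<subseteq> dim: partial_comm_monoid "dim_set sim" "dim_add perp sim" "dim_class sim lzero"
proof
  fix a b c d s :: "'a set"
  show "dim_add perp sim a b c \<Longrightarrow> a \<in> dim_set sim \<and> b \<in> dim_set sim \<and> c \<in> dim_set sim"
    unfolding dim_add_def using cls_in by blast
  show "dim_add perp sim a b c \<Longrightarrow> dim_add perp sim a b d \<Longrightarrow> c = d"
    unfolding dim_add_bsum by (rule bsum_unique)
  show "cls lzero \<in> dim_set sim" by (rule cls_in)
  show "dim_add perp sim a b c \<longleftrightarrow> dim_add perp sim b a c" by (rule dim_add_commute)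
  show "a \<in> dim_set sim \<Longrightarrow> dim_add perp sim a (cls lzero) a"
    using dim_set_cases dim_addI osum_lzero by metis
  show "(\<exists>d. dim_add perp sim a b d \<and> dim_add perp sim d c s) \<longleftrightarrow>
        (\<exists>e. dim_add perp sim b c e \<and> dim_add perp sim a e s)"
    using dim_add_assoc[of a b _ c s] dim_add_assoc[of c b _ a s] dim_add_commute by metis
qed

context espalier
begin

section \<open>Order, splitting and absorption of classes\<close>

lemma dim_le_rep:
  assumes "dim.le \<alpha> (cls b)" obtains a where "a \<le> b" "\<alpha> = cls a"
proof -
  obtain \<xi> where "dim_add perp sim \<alpha> \<xi> (cls b)" using assms unfolding dim.le_def by blast
  then obtain a x where "osum perp a x b" "\<alpha> = cls a" using dim_add_rep by blast
  thus thesis using that osum_le by blast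
qed

lemma dim_leI: "a \<le> b \<Longrightarrow> dim.le (cls a) (cls b)"
  unfolding dim.le_def using L3 dim_addI cls_in by metis

lemma dim_add_le: "dim_add perp sim \<alpha> \<beta> \<gamma> \<Longrightarrow> dim.le \<alpha> \<gamma> \<and> dim.le \<beta> \<gamma>"
  unfolding dim.le_def using dim.add_closed dim_add_commute by blast

lemma bsum_bool: "bsum UNIV \<alpha> \<sigma> \<longleftrightarrow> dim_add perp sim (\<alpha> True) (\<alpha> False) \<sigma>"
  unfolding dim_add_bsum by (rule bsum_cong) simp

text \<open>Sum over pairs of an index and a side, swap the coordinates, and regroup by
  side.\<close>

lemma bsum_split:
  assumes "bsum I \<alpha> \<sigma>" "\<And>i. i \<in> I \<Longrightarrow> dim_add perp sim (\<beta> i) (\<gamma> i) (\<alpha> i)"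
  obtains \<sigma>\<^sub>1 \<sigma>\<^sub>2 where "bsum I \<beta> \<sigma>\<^sub>1" "bsum I \<gamma> \<sigma>\<^sub>2" "dim_add perp sim \<sigma>\<^sub>1 \<sigma>\<^sub>2 \<sigma>"
proof -
  let ?z = "\<lambda>i b. if b then \<beta> i else \<gamma> i"
  have "bsum (I \<times> (UNIV :: bool set)) (\<lambda>(i, b). ?z i b) \<sigma>"
    using assms unfolding dim_add_bsum by (rule bsum_Sigma)
  moreover have "I \<times> (UNIV :: bool set) = prod.swap ` (UNIV \<times> I)" by auto
  moreover have "inj_on prod.swap (UNIV \<times> I)" by (auto intro: inj_onI)
  ultimately have "bsum (UNIV \<times> I) ((\<lambda>(i, b). ?z i b) \<circ> prod.swap) \<sigma>"
    using bsum_image[of prod.swap "UNIV \<times> I" "\<lambda>(i, b). ?z i b" \<sigma>] by simp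
  moreover have "(\<lambda>(i, b). ?z i b) \<circ> prod.swap = (\<lambda>(b, i). ?z i b)" by auto
  ultimately have "bsum (UNIV \<times> I) (\<lambda>(b, i). ?z i b) \<sigma>" by simp
  then obtain \<tau> where \<tau>: "bsum UNIV \<tau> \<sigma>" "\<forall>b\<in>UNIV. bsum I (\<lambda>i. ?z i b) (\<tau> b)"
    by (rule bsum_group)
  have "bsum I \<beta> (\<tau> True)" "bsum I \<gamma> (\<tau> False)"
    using bspec[OF \<tau>(2), of True] bspec[OF \<tau>(2), of False] by simp_all
  thus thesis using that \<tau>(1) bsum_bool by blast
qed

lemma bsum_Un:
  assumes "I \<inter> J = {}"
  shows "bsum (I \<union> J) \<alpha> \<sigma> \<longleftrightarrow> (\<exists>\<sigma>\<^sub>1 \<sigma>\<^sub>2. bsum I \<alpha> \<sigma>\<^sub>1 \<and> bsum J \<alpha> \<sigma>\<^sub>2 \<and> dim_add perp sim \<sigma>\<^sub>1 \<sigma>\<^sub>2 \<sigma>)"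
proof -
  let ?K = "\<lambda>b. if b then I else J"
  have "snd ` Sigma UNIV ?K = (\<Union>b. ?K b)" by (simp only: snd_image_Sigma)
  hence "snd ` Sigma UNIV ?K = I \<union> J" unfolding UNIV_bool by auto
  moreover have "inj_on snd (Sigma UNIV ?K)" using assms by (auto intro!: inj_onI split: if_splits)
  ultimately have "bsum (I \<union> J) \<alpha> \<sigma> \<longleftrightarrow> bsum (Sigma UNIV ?K) (\<alpha> \<circ> snd) \<sigma>" using bsum_image by metis
  also have "\<alpha> \<circ> snd = (\<lambda>(b, i). \<alpha> i)" by auto
  also have "bsum (Sigma UNIV ?K) (\<lambda>(b, i). \<alpha> i) \<sigma> \<longleftrightarrow>
      (\<exists>\<tau>. bsum UNIV \<tau> \<sigma> \<and> (\<forall>b. bsum (?K b) \<alpha> (\<tau> b)))"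
    (is "?L \<longleftrightarrow> ?R")
  proof
    assume ?L
    then obtain \<tau> where "bsum UNIV \<tau> \<sigma>" "\<forall>b\<in>UNIV. bsum (?K b) \<alpha> (\<tau> b)" by (rule bsum_group)
    thus ?R by blast
  next
    show "?R \<Longrightarrow> ?L" using bsum_Sigma[of UNIV _ \<sigma> ?K "\<lambda>_. \<alpha>"] by blast
  qed
  also have "\<dots> \<longleftrightarrow> (\<exists>\<sigma>\<^sub>1 \<sigma>\<^sub>2. bsum I \<alpha> \<sigma>\<^sub>1 \<and> bsum J \<alpha> \<sigma>\<^sub>2 \<and> dim_add perp sim \<sigma>\<^sub>1 \<sigma>\<^sub>2 \<sigma>)"
  proof
    assume "\<exists>\<tau>. bsum UNIV \<tau> \<sigma> \<and> (\<forall>b. bsum (?K b) \<alpha> (\<tau> b))"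
    then obtain \<tau> where "bsum UNIV \<tau> \<sigma>" "\<forall>b. bsum (?K b) \<alpha> (\<tau> b)" by blast
    from this(1) this(2)[rule_format, of True] this(2)[rule_format, of False]
    show "\<exists>\<sigma>\<^sub>1 \<sigma>\<^sub>2. bsum I \<alpha> \<sigma>\<^sub>1 \<and> bsum J \<alpha> \<sigma>\<^sub>2 \<and> dim_add perp sim \<sigma>\<^sub>1 \<sigma>\<^sub>2 \<sigma>"
      unfolding bsum_bool by auto
  next
    assume "\<exists>\<sigma>\<^sub>1 \<sigma>\<^sub>2. bsum I \<alpha> \<sigma>\<^sub>1 \<and> bsum J \<alpha> \<sigma>\<^sub>2 \<and> dim_add perp sim \<sigma>\<^sub>1 \<sigma>\<^sub>2 \<sigma>"
    then obtain \<sigma>\<^sub>1 \<sigma>\<^sub>2 where "bsum I \<alpha> \<sigma>\<^sub>1" "bsum J \<alpha> \<sigma>\<^sub>2" "dim_add perp sim \<sigma>\<^sub>1 \<sigma>\<^sub>2 \<sigma>" by blast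
    thus "\<exists>\<tau>. bsum UNIV \<tau> \<sigma> \<and> (\<forall>b. bsum (?K b) \<alpha> (\<tau> b))"
      unfolding bsum_bool by (intro exI[of _ "\<lambda>b. if b then \<sigma>\<^sub>1 else \<sigma>\<^sub>2"]) simp
  qed
  finally show ?thesis .
qed

lemma bsum_empty: "bsum {} \<alpha> \<sigma> \<longleftrightarrow> \<sigma> = cls lzero"
proof -
  have "big_osum perp {} a s \<longleftrightarrow> s = lzero" for a :: "'i \<Rightarrow> 'a" and s
  proof
    assume "big_osum perp {} a s"
    thus "s = lzero" using big_osum_least[of "{}" a s lzero] lzero_le antisym by (metis empty_iff)
  next
    show "s = lzero \<Longrightarrow> big_osum perp {} a s" by (rule big_osumI) (simp_all add: lub_iff lzero_le)
  qed
  thus ?thesis unfolding bsum_def by auto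
qed

lemma bsum_singleton:
  assumes "\<alpha> i \<in> dim_set sim"
  shows "bsum {i} \<alpha> \<sigma> \<longleftrightarrow> \<sigma> = \<alpha> i"
proof -
  obtain a where a: "\<alpha> i = cls a" using dim_set_cases[OF assms] .
  have "big_osum perp {i} (\<lambda>_. a) a"
    by (rule big_osumI) (use L2_i in \<open>auto simp: lub_iff\<close>)
  hence "bsum {i} \<alpha> (\<alpha> i)" unfolding a by (rule bsumI) (simp add: a)
  thus ?thesis using bsum_unique by blast
qed

lemma bsum_const_eqpoll:
  assumes "I \<approx> J" "bsum I (\<lambda>_. \<zeta>) \<sigma>"
  shows "bsum J (\<lambda>_. \<zeta>) \<sigma>"
proof -
  obtain f where f: "bij_betw f J I" using eqpoll_sym[OF assms(1)] unfolding eqpoll_def by blast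
  hence "f ` J = I" "inj_on f J" unfolding bij_betw_def by auto
  thus ?thesis using bsum_image[of f J "\<lambda>_. \<zeta>" \<sigma>] assms(2) by (simp add: comp_def)
qed

text \<open>An infinite index set stays equipotent to itself when one index is removed, so the
  removed copy is absorbed.\<close>

lemma bsum_infinite_absorb:
  assumes "infinite I" "bsum I (\<lambda>_. \<zeta>) \<sigma>" "\<zeta> \<in> dim_set sim"
  shows "dim_add perp sim \<sigma> \<zeta> \<sigma>"
proof -
  obtain i where i: "i \<in> I" using assms(1) infinite_imp_nonempty by blast
  have inf: "infinite (I - {i})" using assms(1) by simp
  hence e: "I \<approx> I - {i}" using infinite_insert_eqpoll[of "I - {i}" i] i by (simp add: insert_absorb)
  have "(I - {i}) \<union> {i} = I" using i by blast
  then obtain \<sigma>\<^sub>1 \<sigma>\<^sub>2 where s: "bsum (I - {i}) (\<lambda>_. \<zeta>) \<sigma>\<^sub>1" "bsum {i} (\<lambda>_. \<zeta>) \<sigma>\<^sub>2" "dim_add perp sim \<sigma>\<^sub>1 \<sigma>\<^sub>2 \<sigma>"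
    using bsum_Un[of "I - {i}" "{i}" "\<lambda>_. \<zeta>" \<sigma>] assms(2) by auto
  have "\<sigma>\<^sub>1 = \<sigma>" using bsum_unique[OF s(1) bsum_const_eqpoll[OF e assms(2)]] .
  moreover have "\<sigma>\<^sub>2 = \<zeta>" using s(2) bsum_singleton[of "\<lambda>_. \<zeta>" i] assms(3) by simp
  ultimately show ?thesis using s(3) by simp
qed

text \<open>Since what remains after splitting off one copy again has class \<open>\<alpha>\<close>,
  copies can be split off forever inside one fixed representative.\<close>

lemma absorbed_copies:
  assumes "dim_add perp sim \<alpha> \<zeta> \<alpha>"
  obtains \<sigma> \<rho> where "bsum (UNIV :: nat set) (\<lambda>_. \<zeta>) \<sigma>" "dim_add perp sim \<sigma> \<rho> \<alpha>"
proof -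
  obtain a where a: "\<alpha> = cls a" using assms dim.add_closed dim_set_cases by blast
  \<comment> \<open>\<open>c\<close> is the part already used up and \<open>d\<close> the rest,
    which still has class \<open>\<alpha>\<close>; \<open>Q\<close> moves one more copy of
    \<open>\<zeta>\<close> from \<open>d\<close> to \<open>c\<close>.\<close>
  define P where "P = (\<lambda>(n::nat) (c, d). osum perp c d a \<and> cls d = \<alpha>)"
  define Q where "Q = (\<lambda>(n::nat) (c, d) (c', d'). \<exists>z. cls z = \<zeta> \<and> osum perp c z c' \<and> osum perp z d' d)"
  have "\<exists>f. \<forall>n. P n (f n) \<and> Q n (f n) (f (Suc n))"
  proof (rule dependent_nat_choice)
    show "\<exists>x. P 0 x" using osum_lzero a unfolding P_def by (intro exI[of _ "(lzero, a)"]) simp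
    fix x n assume "P n x"
    then obtain c d where x: "x = (c, d)" "osum perp c d a" "cls d = \<alpha>" unfolding P_def by auto
    obtain d' z where d: "osum perp d' z d" "\<alpha> = cls d'" "\<zeta> = cls z"
      using dim_add_rep[of \<alpha> \<zeta> d] assms x(3) by auto
    obtain c' where "osum perp z c c'" "osum perp d' c' a"
      using osum_assoc[OF d(1), of c a] x(2) osum_commute by blast
    hence "P (Suc n) (c', d')" "Q n x (c', d')"
      unfolding P_def Q_def x(1) using d osum_commute by auto
    thus "\<exists>y. P (Suc n) y \<and> Q n x y" by blast
  qed
  then obtain f where f: "\<And>n. P n (f n)" "\<And>n. Q n (f n) (f (Suc n))" by blast
  define c d where "c n = fst (f n)" and "d n = snd (f n)" for n
  have fcd: "f n = (c n, d n)" for n by (simp add: c_def d_def)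
  have cd: "osum perp (c n) (d n) a" for n using f(1)[of n] unfolding P_def fcd by simp
  have "\<exists>z. cls z = \<zeta> \<and> osum perp (c n) z (c (Suc n)) \<and> osum perp z (d (Suc n)) (d n)" for n
    using f(2)[of n] unfolding Q_def fcd by simp
  then obtain z where z: "\<And>n. cls (z n) = \<zeta>" "\<And>n. osum perp (c n) (z n) (c (Suc n))"
      "\<And>n. osum perp (z n) (d (Suc n)) (d n)" by metis
  have cmono: "c m \<le> c n" if "m \<le> n" for m n
    using that by (rule lift_Suc_mono_le[rotated]) (use osum_le[OF z(2)] in blast)
  have dmono: "d n \<le> d m" if "m \<le> n" for m n
    using that by (rule lift_Suc_antimono_le[rotated]) (use osum_le[OF z(3)] in blast)
  obtain s where s: "big_osum perp UNIV z s" "s \<le> a"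
  proof (rule big_osum_exists[of UNIV z a])
    show "z n \<le> a" for n using osum_le[OF z(3)[of n]] osum_le[OF cd[of n]] order_trans by blast
    fix n
    have "osum perp (z n) (c n) (c (Suc n))" using z(2) osum_commute by blast
    then obtain e where e: "osum perp (c n) (d (Suc n)) e" "osum perp (z n) e a"
      using osum_assoc[OF _ cd[of "Suc n"]] by blast
    \<comment> \<open>All earlier copies lie below \<open>c n\<close> and all later ones below
      \<open>d (Suc n)\<close>, so the sum \<open>e\<close> of these two dominates every copy other
      than \<open>z n\<close>.\<close>
    have "z m \<le> e" if "m \<noteq> n" for m
    proof (cases "m < n")
      case True
      hence "c (Suc m) \<le> c n" using cmono by simp
      thus ?thesis using osum_le[OF z(2)[of m]] osum_le[OF e(1)] order_trans by blast
    next
      case False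
      hence "d m \<le> d (Suc n)" using dmono that by simp
      thus ?thesis using osum_le[OF z(3)[of m]] osum_le[OF e(1)] order_trans by blast
    qed
    thus "\<exists>t. perp (z n) t \<and> (\<forall>j\<in>UNIV - {n}. z j \<le> t)" using e(2) unfolding osum_def by auto
  qed
  obtain r where "osum perp s r a" using L3[OF s(2)] by blast
  thus thesis using that[OF bsumI[OF s(1)] ] z(1) dim_addI a by blast
qed

text \<open>If \<open>\<alpha> + \<xi> + \<eta> = \<alpha>\<close>, then \<open>\<alpha>\<close> contains infinitely many copies of \<open>\<xi>\<close>, so that \<open>\<alpha> + \<xi> = \<alpha>\<close>.\<close>

lemma dim_le_antisym:
  assumes "dim.le \<alpha> \<beta>" "dim.le \<beta> \<alpha>"
  shows "\<alpha> = \<beta>"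
proof -
  obtain \<xi> \<eta> where x: "dim_add perp sim \<alpha> \<xi> \<beta>" and y: "dim_add perp sim \<beta> \<eta> \<alpha>"
    using assms unfolding dim.le_def by blast
  obtain \<zeta> where z: "dim_add perp sim \<xi> \<eta> \<zeta>" "dim_add perp sim \<alpha> \<zeta> \<alpha>"
    using dim_add_assoc[OF x y] by blast
  obtain \<sigma> \<rho> where s: "bsum (UNIV :: nat set) (\<lambda>_. \<zeta>) \<sigma>" "dim_add perp sim \<sigma> \<rho> \<alpha>"
    using absorbed_copies[OF z(2)] .
  obtain \<sigma>\<^sub>1 \<sigma>\<^sub>2 where t: "bsum (UNIV :: nat set) (\<lambda>_. \<xi>) \<sigma>\<^sub>1" "dim_add perp sim \<sigma>\<^sub>1 \<sigma>\<^sub>2 \<sigma>"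
    using bsum_split[OF s(1), of "\<lambda>_. \<xi>" "\<lambda>_. \<eta>"] z(1) by blast
  have x1: "dim_add perp sim \<xi> \<sigma>\<^sub>1 \<sigma>\<^sub>1"
    using bsum_infinite_absorb[OF infinite_UNIV_nat t(1)] dim.add_closed[OF x] dim_add_commute
      by blast
  obtain \<tau> where u: "dim_add perp sim \<sigma>\<^sub>1 \<tau> \<alpha>" using dim_add_assoc[OF t(2) s(2)] by blast
  obtain \<epsilon> where e: "dim_add perp sim \<sigma>\<^sub>1 \<tau> \<epsilon>" "dim_add perp sim \<xi> \<epsilon> \<alpha>"
    using dim_add_assoc[OF x1 u] by blast
  have "\<epsilon> = \<alpha>" using dim.add_functional[OF e(1) u] .
  thus ?thesis using e(2) x dim_add_commute dim.add_functional by blast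
qed

text \<open>The four pieces come from the meet \<open>m\<close>, the join \<open>j\<close> and the
  complement \<open>w\<close> of \<open>j\<close> in \<open>s\<close>. Using \<open>L8\<close> with
  \<open>a\<close> and \<open>b\<close> in both orders identifies the complements of
  \<open>m\<close> in \<open>a\<close> and \<open>b\<close> with those of \<open>b\<close> and
  \<open>a\<close> in \<open>j\<close>, so the pieces are the classes of \<open>m\<close>,
  \<open>x\<close>, \<open>x'\<close> and \<open>w\<close>.\<close>

lemma dim_refinement:
  assumes "dim_add perp sim \<alpha>\<^sub>0 \<alpha>\<^sub>1 \<sigma>" "dim_add perp sim \<beta>\<^sub>0 \<beta>\<^sub>1 \<sigma>"
  shows "\<exists>\<gamma>\<^sub>0\<^sub>0 \<gamma>\<^sub>0\<^sub>1 \<gamma>\<^sub>1\<^sub>0 \<gamma>\<^sub>1\<^sub>1. dim_add perp sim \<gamma>\<^sub>0\<^sub>0 \<gamma>\<^sub>0\<^sub>1 \<alpha>\<^sub>0 \<and> dim_add perp sim \<gamma>\<^sub>1\<^sub>0 \<gamma>\<^sub>1\<^sub>1 \<alpha>\<^sub>1 \<and>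
    dim_add perp sim \<gamma>\<^sub>0\<^sub>0 \<gamma>\<^sub>1\<^sub>0 \<beta>\<^sub>0 \<and> dim_add perp sim \<gamma>\<^sub>0\<^sub>1 \<gamma>\<^sub>1\<^sub>1 \<beta>\<^sub>1"
proof -
  obtain s where s: "\<sigma> = cls s" using assms(1) dim.add_closed dim_set_cases by blast
  obtain a a' where a: "osum perp a a' s" "\<alpha>\<^sub>0 = cls a" "\<alpha>\<^sub>1 = cls a'"
    using dim_add_rep assms(1) s by blast
  obtain b b' where b: "osum perp b b' s" "\<beta>\<^sub>0 = cls b" "\<beta>\<^sub>1 = cls b'"
    using dim_add_rep assms(2) s by blast
  have le: "a \<le> s" "b \<le> s" using osum_le a(1) b(1) by blast+
  obtain m x y j where j: "osum perp m x a" "m \<le> b" "osum perp b y j" "sim x y" "j \<le> s" "a \<le> j"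
    "isGlb UNIV {a, b} m" "isLub UNIV {a, b} j"
    using parallelogram[OF le] .
  obtain x' where x': "osum perp m x' b" using L3[OF j(2)] by blast
  obtain y' where y': "osum perp a y' j" using L3[OF j(6)] by blast
  have ba: "{b, a} = {a, b}" by blast
  have xy': "sim x' y'" using L8[of b a j m x' y'] j(7,8) x' y' unfolding ba by blast
  obtain w where w: "osum perp j w s" using L3[OF j(5)] by blast
  obtain e where e: "osum perp y w e" "osum perp b e s" using osum_assoc[OF j(3) w] .
  obtain e' where e': "osum perp y' w e'" "osum perp a e' s" using osum_assoc[OF y' w] .
  have "cls b' = cls e" "cls a' = cls e'" "cls x = cls y" "cls x' = cls y'"
    using complement_sim b(1) e(2) a(1) e'(2) j(4) xy' cls_eq by blast+
  thus ?thesis using dim_addI[OF j(1)] dim_addI[OF x'] dim_addI[OF e(1)] dim_addI[OF e'(1)] a b by metis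
qed

end

sublocale espalier \<subseteq> dim: refined_comm_monoid "dim_set sim" "dim_add perp sim" "dim_class sim lzero"
  by unfold_locales (fact dim_refinement, fact dim_le_antisym)

section \<open>Exhaustion\<close>

context espalier
begin

text \<open>The part \<open>x\<close> of \<open>w\<close> outside \<open>z'\<close> is equivalent,
  by \<open>L8\<close>, to an element below a complement of \<open>z'\<close>, and such a complement
  is equivalent to \<open>z\<close>. Disjointness of classes forces \<open>x\<close> to vanish. This
  turns disjoint classes into perpendicular elements.\<close>

lemma le_complement_of_orth:
  assumes "dim.orth (cls w) (cls z)" "w \<le> c" "osum perp z z' c"
  shows "w \<le> z'"
proof -
  have "z' \<le> c" using osum_le assms(3) by blast
  obtain m x y j where m: "osum perp m x w" "m \<le> z'" "osum perp z' y j" "sim x y" "j \<le> c" "w \<le> j"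
    "isGlb UNIV {w, z'} m" "isLub UNIV {w, z'} j"
    using parallelogram[OF assms(2) \<open>z' \<le> c\<close>] .
  obtain s where s: "osum perp j s c" using L3[OF m(5)] by blast
  obtain e where e: "osum perp y s e" "osum perp z' e c" using osum_assoc[OF m(3) s] .
  have "sim e z" using complement_sim[OF e(2)] assms(3) osum_commute by blast
  hence "dim.le (cls x) (cls z)"
    using dim_leI[of y e] osum_le[OF e(1)] m(4) cls_eq by metis
  moreover have "dim.le (cls x) (cls w)" using dim_leI osum_le[OF m(1)] by blast
  ultimately have "cls x = cls lzero" using assms(1) cls_in unfolding dim.orth_def by blast
  hence "x = lzero" using cls_zero by blast
  hence "w = m" using m(1) osum_lzero by blast
  thus ?thesis using m(2) by simp
qed

lemma bsum_in:
  assumes "bsum I \<alpha> \<sigma>" shows "\<sigma> \<in> dim_set sim" "i \<in> I \<Longrightarrow> \<alpha> i \<in> dim_set sim"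
  using assms cls_in unfolding bsum_def by auto

lemma bsum_insert:
  assumes "bsum (insert i I) \<alpha> \<sigma>" "i \<notin> I"
  obtains \<tau> where "bsum I \<alpha> \<tau>" "dim_add perp sim \<tau> (\<alpha> i) \<sigma>"
proof -
  have "bsum (I \<union> {i}) \<alpha> \<sigma>" "I \<inter> {i} = {}" using assms by simp_all
  then obtain \<tau> \<tau>' where "bsum I \<alpha> \<tau>" "bsum {i} \<alpha> \<tau>'" "dim_add perp sim \<tau> \<tau>' \<sigma>"
    using bsum_Un[of I "{i}" \<alpha> \<sigma>] by blast
  moreover have "\<alpha> i \<in> dim_set sim" using bsum_in(2)[OF assms(1)] by simp
  ultimately show thesis using that by (simp add: bsum_singleton)
qed

lemma finite_bsum_polar:
  assumes "finite I" "bsum I \<alpha> \<sigma>" "\<And>i. i \<in> I \<Longrightarrow> \<alpha> i \<in> dim.polar X"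
  shows "\<sigma> \<in> dim.polar X"
  using assms
proof (induction I arbitrary: \<sigma> rule: finite_induct)
  case empty
  thus ?case using dim.zero_in_polar by (simp add: bsum_empty)
next
  case (insert i I)
  obtain \<tau> where "bsum I \<alpha> \<tau>" "dim_add perp sim \<tau> (\<alpha> i) \<sigma>"
    using bsum_insert[OF insert.prems(1) insert.hyps(2)] .
  thus ?case using insert.IH insert.prems(2) dim.polar_add by blast
qed

text \<open>Represent a common minorant by \<open>w\<close> below \<open>s\<close>. It is
  perpendicular to all finite partial sums by \<open>le_complement_of_orth\<close>, hence to
  \<open>s\<close> itself by \<open>L4\<close>, and so is zero.\<close>

lemma bsum_polar:
  assumes "bsum I \<alpha> \<sigma>" "\<And>i. i \<in> I \<Longrightarrow> \<alpha> i \<in> dim.polar X"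
  shows "\<sigma> \<in> dim.polar X"
proof -
  obtain a s where a: "big_osum perp I a s" "\<forall>i\<in>I. \<alpha> i = cls (a i)" "\<sigma> = cls s"
    using assms(1) unfolding bsum_def by blast
  show ?thesis unfolding a(3)
  proof (rule dim.polarI[OF cls_in])
    fix \<xi> \<zeta> assume xz: "\<xi> \<in> X" "dim.le \<zeta> (cls s)" "dim.le \<zeta> \<xi>"
    obtain w where w: "w \<le> s" "\<zeta> = cls w" using dim_le_rep[OF xz(2)] .
    have "perp w t" if J: "finite J" "J \<subseteq> I" "big_osum perp J a t" for J t
    proof -
      have "bsum J \<alpha> (cls t)" by (rule bsumI[OF J(3)]) (use a(2) J(2) in blast)
      hence t: "cls t \<in> dim.polar X" using finite_bsum_polar[OF J(1)] assms(2) J(2) by blast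
      have "dim.orth (cls w) (cls t)" unfolding dim.orth_def
        using dim.polarD[OF t xz(1)] dim.le_trans xz(3) w(2) by blast
      have "t \<le> s" using big_osum_least[OF J(3)] big_osum_le[OF a(1)] J(2) by blast
      then obtain t' where t': "osum perp t t' s" using L3 by blast
      have "w \<le> t'" using le_complement_of_orth[OF \<open>dim.orth (cls w) (cls t)\<close> w(1) t'] .
      thus ?thesis using t' L2_ii L2_iii unfolding osum_def by blast
    qed
    hence "perp w s" using perp_big_osum[OF a(1)] by blast
    hence "w = lzero" using perp_disjoint[of w s w] w(1) by blast
    thus "\<zeta> = cls lzero" using w(2) by simp
  qed
qed

text \<open>The index set consists of simultaneous choices of pairwise equivalent elements, one below a
  representative of each element of \<open>X\<close>.\<close>

lemma exhaustion:
  assumes "X \<subseteq> dim_set sim" "X \<noteq> {}"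
  obtains E :: "('a set \<Rightarrow> 'a) set" and \<alpha> \<mu> \<rho> where
    "\<And>i. i \<in> E \<Longrightarrow> \<alpha> i \<in> Q" "bsum E \<alpha> \<mu>" "\<And>\<xi>. \<xi> \<in> X \<Longrightarrow> dim_add perp sim \<mu> (\<rho> \<xi>) \<xi>"
    "\<And>\<eta>. \<eta> \<in> Q \<Longrightarrow> \<forall>\<xi>\<in>X. dim.le \<eta> (\<rho> \<xi>) \<Longrightarrow> \<eta> = cls lzero"
proof -
  have "\<exists>b. \<xi> = cls b" if "\<xi> \<in> X" for \<xi> using dim_set_cases assms(1) that by blast
  then obtain b where b: "\<And>\<xi>. \<xi> \<in> X \<Longrightarrow> \<xi> = cls (b \<xi>)" by metis
  define G where "G = {E :: ('a set \<Rightarrow> 'a) set. (\<forall>h\<in>E. \<exists>q\<in>Q. \<forall>\<xi>\<in>X. cls (h \<xi>) = q) \<and>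
      (\<forall>\<xi>\<in>X. \<exists>s\<le>b \<xi>. big_osum perp E (\<lambda>h. h \<xi>) s)}"
  have "\<exists>E\<in>G. \<forall>F\<in>G. E \<subseteq> F \<longrightarrow> F = E"
  proof (rule subset_Zorn_nonempty)
    have "big_osum perp {} a lzero" for a :: "('a set \<Rightarrow> 'a) \<Rightarrow> 'a"
      by (rule big_osumI) (simp_all add: lub_iff lzero_le)
    hence "{} \<in> G" unfolding G_def using lzero_le by blast
    thus "G \<noteq> {}" by blast
    fix C assume C: "C \<noteq> {}" "subset.chain G C"
    have CG: "C \<subseteq> G" using C(2) by (rule subset.chain_def[THEN iffD1, THEN conjunct1])
    have "\<exists>s\<le>b \<xi>. big_osum perp (\<Union>C) (\<lambda>h. h \<xi>) s" if \<xi>: "\<xi> \<in> X" for \<xi>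
    proof -
      \<comment> \<open>A finite part of the union of a chain lies in one member, and
        \<open>b \<xi>\<close> bounds the sums of all members alike.\<close>
      have "\<exists>s\<le>b \<xi>. big_osum perp J (\<lambda>h. h \<xi>) s" if J: "finite J" "J \<subseteq> \<Union>C" for J
      proof -
        obtain E where E: "E \<in> C" "J \<subseteq> E" using finite_subset_Union_chain[OF J C] .
        then obtain s where s: "s \<le> b \<xi>" "big_osum perp E (\<lambda>h. h \<xi>) s"
          using CG \<xi> unfolding G_def by blast
        obtain t where "big_osum perp J (\<lambda>h. h \<xi>) t" "t \<le> s" using big_osum_subset[OF s(2) E(2)] .
        thus ?thesis using s(1) order_trans by blast
      qed
      thus ?thesis using big_osum_finite_character[of "\<Union>C" "b \<xi>" "\<lambda>h. h \<xi>"] by blast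
    qed
    moreover have "\<forall>h\<in>\<Union>C. \<exists>q\<in>Q. \<forall>\<xi>\<in>X. cls (h \<xi>) = q" using CG unfolding G_def by blast
    ultimately show "\<Union>C \<in> G" unfolding G_def by simp
  qed
  then obtain E where E: "E \<in> G" "\<And>F. F \<in> G \<Longrightarrow> E \<subseteq> F \<Longrightarrow> F = E" by blast
  have EQ: "\<forall>h\<in>E. \<exists>q\<in>Q. \<forall>\<xi>\<in>X. cls (h \<xi>) = q" using E(1) unfolding G_def by simp
  have "\<exists>s r. big_osum perp E (\<lambda>h. h \<xi>) s \<and> osum perp s r (b \<xi>)" if "\<xi> \<in> X" for \<xi>
    using E(1) L3 that unfolding G_def by blast
  then obtain s r where s: "\<And>\<xi>. \<xi> \<in> X \<Longrightarrow> big_osum perp E (\<lambda>h. h \<xi>) (s \<xi>)"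
      "\<And>\<xi>. \<xi> \<in> X \<Longrightarrow> osum perp (s \<xi>) (r \<xi>) (b \<xi>)" by metis
  obtain \<xi>\<^sub>0 where x0: "\<xi>\<^sub>0 \<in> X" using assms(2) by blast
  let ?\<alpha> = "\<lambda>h. cls (h \<xi>\<^sub>0)"
  have \<alpha>: "?\<alpha> h = cls (h \<xi>)" if "h \<in> E" "\<xi> \<in> X" for h \<xi> using EQ that x0 by metis
  have bs: "bsum E ?\<alpha> (cls (s \<xi>))" if "\<xi> \<in> X" for \<xi>
    by (rule bsumI[OF s(1)[OF that]]) (rule \<alpha>[OF _ that])
  have add: "dim_add perp sim (cls (s \<xi>\<^sub>0)) (cls (r \<xi>)) \<xi>" if "\<xi> \<in> X" for \<xi>
    using dim_addI[OF s(2)[OF that]] bsum_unique[OF bs[OF that] bs[OF x0]] b[OF that] by simp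
  have max: "\<eta> = cls lzero" if \<eta>: "\<eta> \<in> Q" "\<forall>\<xi>\<in>X. dim.le \<eta> (cls (r \<xi>))" for \<eta>
  proof -
    have "\<forall>\<xi>\<in>X. \<exists>h. h \<le> r \<xi> \<and> \<eta> = cls h" using \<eta>(2) dim_le_rep by metis
    then obtain h where h: "\<And>\<xi>. \<xi> \<in> X \<Longrightarrow> h \<xi> \<le> r \<xi> \<and> \<eta> = cls (h \<xi>)" by metis
    have sr: "perp (s \<xi>) (h \<xi>)" if "\<xi> \<in> X" for \<xi>
      using s(2)[OF that] h[OF that] perp_mono unfolding osum_def by blast
    \<comment> \<open>Maximality only forces \<open>h\<close> into \<open>E\<close>. As a member it
      lies below \<open>s\<close>, and as part of the remainder it is perpendicular to
      \<open>s\<close>, which makes it zero.\<close>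
    have "h \<in> E"
    proof (rule ccontr)
      assume hE: "h \<notin> E"
      have "\<exists>t\<le>b \<xi>. big_osum perp (insert h E) (\<lambda>h. h \<xi>) t" if \<xi>: "\<xi> \<in> X" for \<xi>
      proof -
        have "s \<xi> \<le> b \<xi>" "h \<xi> \<le> b \<xi>" using osum_le[OF s(2)[OF \<xi>]] h[OF \<xi>] order_trans by blast+
        then obtain t where t: "osum perp (s \<xi>) (h \<xi>) t" "t \<le> b \<xi>"
          using osum_exists[OF sr[OF \<xi>]] by blast
        show ?thesis using big_osum_insert[OF s(1)[OF \<xi>] t(1) hE] t(2) by blast
      qed
      moreover have "\<exists>q\<in>Q. \<forall>\<xi>\<in>X. cls (h \<xi>) = q" using h \<eta>(1) by metis
      ultimately have "insert h E \<in> G" using EQ unfolding G_def by simp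
      thus False using E(2) hE by blast
    qed
    hence "h \<xi>\<^sub>0 = lzero" using perp_disjoint[OF sr[OF x0]] big_osum_le[OF s(1)[OF x0]] by blast
    thus ?thesis using h[OF x0] by simp
  qed
  show thesis
    by (rule that[of E ?\<alpha> "cls (s \<xi>\<^sub>0)" "\<lambda>\<xi>. cls (r \<xi>)"]) (use EQ x0 bs[OF x0] add max in auto)
qed

text \<open>The greedy part is the component in \<open>polar X\<close>. The remainder lies in the
  bipolar because any minorant it shares with a member of \<open>polar X\<close> belongs to
  \<open>polar X\<close> too, and exhaustion makes it zero.\<close>

lemma dim_polar_decomposition:
  assumes "x \<in> dim_set sim"
  shows "\<exists>u v. u \<in> dim.polar (dim.polar X) \<and> v \<in> dim.polar X \<and> dim_add perp sim u v x"
proof -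
  obtain E :: "('a set \<Rightarrow> 'a) set" and \<alpha> m r where e:
    "\<And>i. i \<in> E \<Longrightarrow> \<alpha> i \<in> dim.polar X" "bsum E \<alpha> m" "\<And>y. y \<in> {x} \<Longrightarrow> dim_add perp sim m (r y) y"
    "\<And>y. y \<in> dim.polar X \<Longrightarrow> \<forall>z\<in>{x}. dim.le y (r z) \<Longrightarrow> y = cls lzero"
    by (rule exhaustion[of "{x}" "dim.polar X"]) (use assms in auto)
  have a: "dim_add perp sim m (r x) x" using e(3) by blast
  have "m \<in> dim.polar X" using bsum_polar[OF e(2,1)] .
  moreover have "r x \<in> dim.polar (dim.polar X)"
  proof (rule dim.polarI)
    show "r x \<in> dim_set sim" using a dim.add_closed by blast
    fix y z assume "y \<in> dim.polar X" "dim.le z (r x)" "dim.le z y"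
    thus "z = cls lzero" using e(4)[of z] dim.polar_down by blast
  qed
  ultimately show ?thesis using dim.comm[OF a] by blast
qed

end

sublocale espalier \<subseteq> dim: polar_monoid "dim_set sim" "dim_add perp sim" "dim_class sim lzero"
  by unfold_locales (rule dim_polar_decomposition)

section \<open>Finite and infinite parts, gluing, and multiples of classes\<close>

context espalier
begin

text \<open>The even and the odd indices each carry a full set of copies.\<close>

lemma bsum_nat_purely_infinite:
  assumes "bsum (UNIV :: nat set) (\<lambda>_. \<zeta>) \<sigma>"
  shows "dim.purely_infinite \<sigma>"
proof -
  let ?f = "\<lambda>n::nat. 2 * n" and ?g = "\<lambda>n::nat. 2 * n + 1"
  have "range ?f \<union> range ?g = UNIV"
  proof -
    have "n \<in> range ?f \<union> range ?g" for n by (cases "even n") (auto elim: evenE oddE)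
    thus ?thesis by blast
  qed
  moreover have "range ?f \<inter> range ?g = {}" by (auto, presburger)
  ultimately obtain \<sigma>\<^sub>1 \<sigma>\<^sub>2 where s: "bsum (range ?f) (\<lambda>_. \<zeta>) \<sigma>\<^sub>1" "bsum (range ?g) (\<lambda>_. \<zeta>) \<sigma>\<^sub>2"
      "dim_add perp sim \<sigma>\<^sub>1 \<sigma>\<^sub>2 \<sigma>"
    using bsum_Un[of "range ?f" "range ?g" "\<lambda>_. \<zeta>" \<sigma>] assms by auto
  have "inj ?f" "inj ?g" by (auto intro: injI)
  hence "bsum (UNIV :: nat set) (\<lambda>_. \<zeta>) \<sigma>\<^sub>1" "bsum (UNIV :: nat set) (\<lambda>_. \<zeta>) \<sigma>\<^sub>2"
    using s(1,2) bsum_image[of ?f UNIV "\<lambda>_. \<zeta>"] bsum_image[of ?g UNIV "\<lambda>_. \<zeta>"]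
    by (simp_all add: comp_def)
  hence "\<sigma>\<^sub>1 = \<sigma>" "\<sigma>\<^sub>2 = \<sigma>" using bsum_unique assms by blast+
  thus ?thesis using s(3) bsum_in[OF assms] unfolding dim.purely_infinite_def by simp
qed

text \<open>If the remainder absorbs \<open>\<zeta>\<close>, it contains countably many copies of
  it, whose sum is purely infinite. Exhaustion makes that sum zero, and \<open>\<zeta>\<close> with
  it.\<close>

lemma dim_finite_infinite:
  assumes "x \<in> dim_set sim"
  shows "\<exists>d e. dim.directly_finite d \<and> dim.purely_infinite e \<and> dim_add perp sim d e x"
proof -
  obtain E :: "('a set \<Rightarrow> 'a) set" and \<alpha> m r where e:
    "\<And>i. i \<in> E \<Longrightarrow> \<alpha> i \<in> Collect dim.purely_infinite" "bsum E \<alpha> m"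
    "\<And>y. y \<in> {x} \<Longrightarrow> dim_add perp sim m (r y) y"
    "\<And>y. y \<in> Collect dim.purely_infinite \<Longrightarrow> \<forall>z\<in>{x}. dim.le y (r z) \<Longrightarrow> y = cls lzero"
    by (rule exhaustion[of "{x}" "Collect dim.purely_infinite"]) (use assms in auto)
  have a: "dim_add perp sim m (r x) x" using e(3) by blast
  obtain \<sigma>\<^sub>1 \<sigma>\<^sub>2 where s: "bsum E \<alpha> \<sigma>\<^sub>1" "bsum E \<alpha> \<sigma>\<^sub>2" "dim_add perp sim \<sigma>\<^sub>1 \<sigma>\<^sub>2 m"
    using bsum_split[OF e(2), of \<alpha> \<alpha>] e(1) unfolding dim.purely_infinite_def by blast
  hence "\<sigma>\<^sub>1 = m" "\<sigma>\<^sub>2 = m" using bsum_unique e(2) by blast+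
  hence "dim.purely_infinite m" unfolding dim.purely_infinite_def using s(3) dim.add_closed by blast
  moreover have "\<zeta> = cls lzero" if z: "dim_add perp sim \<zeta> (r x) (r x)" for \<zeta>
  proof -
    obtain \<sigma> \<rho> where s: "bsum (UNIV :: nat set) (\<lambda>_. \<zeta>) \<sigma>" "dim_add perp sim \<sigma> \<rho> (r x)"
      using absorbed_copies[OF dim.comm[OF z]] .
    have "dim.le \<sigma> (r x)" using dim_add_le[OF s(2)] by blast
    hence "\<sigma> = cls lzero" using e(4) bsum_nat_purely_infinite[OF s(1)] by blast
    moreover have "dim_add perp sim \<sigma> \<zeta> \<sigma>"
      using bsum_infinite_absorb[OF infinite_UNIV_nat s(1)] z dim.add_closed by blast
    ultimately show ?thesis using dim_add_le dim.le_zero by blast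
  qed
  hence "dim.directly_finite (r x)" unfolding dim.directly_finite_def
    using a dim.add_closed by blast
  ultimately show ?thesis using dim.comm[OF a] by blast
qed

text \<open>Inside one representative of \<open>x\<close>, each piece lies below the complement of
  every other piece by \<open>le_complement_of_orth\<close>; these complements are the bounds for
  the independence criterion.\<close>

lemma orthogonal_bsum:
  assumes "x \<in> dim_set sim" "\<And>e. e \<in> E \<Longrightarrow> dim_add perp sim (\<alpha> e) (\<beta> e) x"
    and "\<And>e f. e \<in> E \<Longrightarrow> f \<in> E \<Longrightarrow> e \<noteq> f \<Longrightarrow> dim.orth (\<alpha> e) (\<alpha> f)"
  obtains \<sigma> \<rho> where "bsum E \<alpha> \<sigma>" "dim_add perp sim \<sigma> \<rho> x" "\<And>e. e \<in> E \<Longrightarrow> dim.le \<rho> (\<beta> e)"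
proof -
  obtain c where c: "x = cls c" using dim_set_cases[OF assms(1)] .
  have "\<exists>a b. osum perp a b c \<and> \<alpha> e = cls a \<and> \<beta> e = cls b" if "e \<in> E" for e
    using dim_add_rep[of "\<alpha> e" "\<beta> e" c] assms(2)[OF that] c by metis
  then obtain a b where ab: "\<And>e. e \<in> E \<Longrightarrow> osum perp (a e) (b e) c"
      "\<And>e. e \<in> E \<Longrightarrow> \<alpha> e = cls (a e)" "\<And>e. e \<in> E \<Longrightarrow> \<beta> e = cls (b e)" by metis
  have le: "a e \<le> c" if "e \<in> E" for e using osum_le ab(1) that by blast
  obtain s where s: "big_osum perp E a s" "s \<le> c"
  proof (rule big_osum_exists[of E a c, OF le])
    fix e assume e: "e \<in> E"
    have "a f \<le> b e" if "f \<in> E - {e}" for f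
      using le_complement_of_orth[OF _ le ab(1)[OF e], of f] assms(3)[of f e] ab(2) e that by auto
    moreover have "perp (a e) (b e)" using ab(1)[OF e] unfolding osum_def by blast
    ultimately show "\<exists>t. perp (a e) t \<and> (\<forall>f\<in>E - {e}. a f \<le> t)" by blast
  qed
  obtain r where r: "osum perp s r c" using L3[OF s(2)] by blast
  have "dim.le (cls r) (\<beta> e)" if e: "e \<in> E" for e
  proof -
    obtain t where t: "osum perp (a e) t s" using L3[OF big_osum_le[OF s(1) e]] by blast
    obtain d where d: "osum perp t r d" "osum perp (a e) d c" using osum_assoc[OF t r] .
    have "cls d = cls (b e)" using complement_sim[OF d(2) ab(1)[OF e]] cls_eq by blast
    thus ?thesis using dim_leI[of r d] osum_le[OF d(1)] ab(3)[OF e] by simp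
  qed
  thus thesis using that[OF bsumI[OF s(1) ab(2)]] dim_addI[OF r] c by blast
qed

text \<open>Take a maximal set of pairwise disjoint \<open>u\<close> over which \<open>x\<close>
  lies below \<open>y\<close>. The pieces of \<open>x\<close> over it exhaust \<open>x\<close>,
  because a remainder would contain a further \<open>u\<close> disjoint from them all. The same
  pieces lie disjointly below \<open>y\<close>, so their sum \<open>x\<close> does too.\<close>

lemma dim_le_local:
  assumes S: "x \<in> dim_set sim" "y \<in> dim_set sim"
    and local: "\<And>z. \<lbrakk>dim.le z x; z \<noteq> cls lzero\<rbrakk> \<Longrightarrow>
      \<exists>u. dim.le u z \<and> u \<noteq> cls lzero \<and> dim.le (dim.near u x) (dim.near u y)"
  shows "dim.le x y"
proof -
  define G where "G = {E. E \<subseteq> {u \<in> dim_set sim. dim.le (dim.near u x) (dim.near u y)} \<and>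
      (\<forall>e\<in>E. \<forall>f\<in>E. e \<noteq> f \<longrightarrow> dim.orth e f)}"
  have "\<exists>E\<in>G. \<forall>F\<in>G. E \<subseteq> F \<longrightarrow> F = E"
  proof (rule subset_Zorn_nonempty)
    show "G \<noteq> {}" unfolding G_def by blast
    fix C assume C: "C \<noteq> {}" "subset.chain G C"
    have CG: "C \<subseteq> G" "\<And>E F. E \<in> C \<Longrightarrow> F \<in> C \<Longrightarrow> E \<subseteq> F \<or> F \<subseteq> E"
      using C(2) unfolding subset.chain_def by blast+
    have "dim.orth e f" if ef: "e \<in> \<Union>C" "f \<in> \<Union>C" "e \<noteq> f" for e f
    proof -
      obtain E where "E \<in> C" "e \<in> E" "f \<in> E" using ef(1,2) CG(2) by blast
      thus ?thesis using CG(1) ef(3) unfolding G_def by blast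
    qed
    moreover have "\<Union>C \<subseteq> {u \<in> dim_set sim. dim.le (dim.near u x) (dim.near u y)}"
      using CG(1) unfolding G_def by blast
    ultimately show "\<Union>C \<in> G" unfolding G_def by simp
  qed
  then obtain E where E: "E \<in> G" "\<And>F. F \<in> G \<Longrightarrow> E \<subseteq> F \<Longrightarrow> F = E" by blast
  have ES: "e \<in> dim_set sim" "dim.le (dim.near e x) (dim.near e y)" if "e \<in> E" for e
    using E(1) that unfolding G_def by auto
  have Eo: "dim.orth e f" if "e \<in> E" "f \<in> E" "e \<noteq> f" for e f
    using E(1) that unfolding G_def by auto
  let ?\<alpha> = "\<lambda>e. dim.near e x" and ?\<beta> = "\<lambda>e. dim.proj_compl (dim.near e) x"
  have p: "dim.projection (dim.near e)" if "e \<in> E" for e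
    using dim.near_projection ES(1) that by blast
  have orth: "dim.orth (?\<alpha> e) (?\<alpha> f)" if ef: "e \<in> E" "f \<in> E" "e \<noteq> f" for e f
  proof -
    have "{e} \<subseteq> dim.polar {f}" using Eo[OF ef] ES(1)[OF ef(1)] unfolding dim.polar_def by simp
    hence "dim.polar (dim.polar {e}) \<subseteq> dim.polar (dim.polar (dim.polar {f}))"
      by (intro dim.polar_antimono)
    moreover have "?\<alpha> e \<in> dim.polar (dim.polar {e})" "?\<alpha> f \<in> dim.polar (dim.polar {f})"
      using dim.near_image ES(1) ef(1,2) S(1) by blast+
    ultimately show ?thesis unfolding dim.polar_def[of "dim.polar (dim.polar {f})"] by blast
  qed
  obtain \<sigma> \<rho> where s: "bsum E ?\<alpha> \<sigma>" "dim_add perp sim \<sigma> \<rho> x" "\<And>e. e \<in> E \<Longrightarrow> dim.le \<rho> (?\<beta> e)"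
    by (rule orthogonal_bsum[OF S(1), of E ?\<alpha> ?\<beta>]) (use dim.proj_split[OF p S(1)] orth in auto)
  have "\<rho> = cls lzero"
  proof (rule ccontr)
    assume "\<rho> \<noteq> cls lzero"
    moreover have rx: "dim.le \<rho> x" using dim_add_le[OF s(2)] by blast
    ultimately obtain u where u: "dim.le u \<rho>" "u \<noteq> cls lzero" "dim.le (dim.near u x) (dim.near u y)"
      using local by blast
    have uS: "u \<in> dim_set sim" using dim.le_S[OF u(1)] by blast
    have ue: "dim.orth u e" if e: "e \<in> E" for e
    proof -
      have "?\<beta> e \<in> dim.polar (dim.near e ` dim_set sim)"
        using dim.proj_compl_projection(2)[OF p[OF e]] S(1) by blast
      hence "u \<in> dim.polar (dim.near e ` dim_set sim)"
        using dim.polar_down dim.le_trans[OF u(1) s(3)[OF e]] by blast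
      moreover have "e \<in> dim.near e ` dim_set sim"
        using dim.near_self[OF ES(1)[OF e]] ES(1)[OF e] by (metis image_eqI)
      ultimately show ?thesis unfolding dim.polar_def by blast
    qed
    hence "insert u E \<in> G" using E(1) uS u(3) dim.orth_sym unfolding G_def by auto
    hence "u \<in> E" using E(2) by blast
    hence "dim.orth u u" by (rule ue)
    thus False using u(2) dim.le_refl uS unfolding dim.orth_def by blast
  qed
  hence x: "bsum E ?\<alpha> x" using s(1,2) dim.zero_add dim.comm by metis
  have "\<exists>\<gamma>. dim_add perp sim (?\<alpha> e) \<gamma> y" if e: "e \<in> E" for e
    using dim.leE dim.le_trans[OF ES(2)[OF e] dim.proj_le_self[OF p[OF e] S(2)]] by metis
  then obtain \<gamma> where g: "\<And>e. e \<in> E \<Longrightarrow> dim_add perp sim (?\<alpha> e) (\<gamma> e) y" by metis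
  obtain \<tau> \<upsilon> where t: "bsum E ?\<alpha> \<tau>" "dim_add perp sim \<tau> \<upsilon> y"
    by (rule orthogonal_bsum[OF S(2) g orth])
  show ?thesis using bsum_unique[OF x t(1)] dim_add_le[OF t(2)] by simp
qed

lemma dim_common_part:
  assumes "X \<subseteq> dim_set sim" "X \<noteq> {}"
  shows "\<exists>m r. (\<forall>x\<in>X. dim_add perp sim m (r x) x) \<and>
    (\<forall>z. (\<forall>x\<in>X. dim.le z (r x)) \<longrightarrow> z = cls lzero)"
proof -
  obtain E :: "('a set \<Rightarrow> 'a) set" and \<alpha> m r where e:
    "\<And>i. i \<in> E \<Longrightarrow> \<alpha> i \<in> dim_set sim" "bsum E \<alpha> m" "\<And>x. x \<in> X \<Longrightarrow> dim_add perp sim m (r x) x"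
    "\<And>y. y \<in> dim_set sim \<Longrightarrow> \<forall>x\<in>X. dim.le y (r x) \<Longrightarrow> y = cls lzero"
    using exhaustion[OF assms, of "dim_set sim"] by metis
  have "z = cls lzero" if "\<forall>x\<in>X. dim.le z (r x)" for z
    using e(4)[OF _ that] that dim.le_S assms(2) by blast
  thus ?thesis using e(3) by blast
qed

text \<open>Split every copy into its two components. Polars are closed under sums, so the two
  resulting sums are the components of \<open>m\<close>.\<close>

lemma bsum_const_proj:
  assumes "dim.projection p" "bsum I (\<lambda>_. x) m"
  shows "bsum I (\<lambda>_. p x) (p m)"
proof (cases "I = {}")
  case True
  thus ?thesis using assms(2) dim.proj_zero[OF assms(1)] by (simp add: bsum_empty)
next
  case False
  hence x: "x \<in> dim_set sim" using bsum_in(2)[OF assms(2)] by blast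
  obtain \<sigma>\<^sub>1 \<sigma>\<^sub>2 where s: "bsum I (\<lambda>_. p x) \<sigma>\<^sub>1" "bsum I (\<lambda>_. dim.proj_compl p x) \<sigma>\<^sub>2"
      "dim_add perp sim \<sigma>\<^sub>1 \<sigma>\<^sub>2 m"
    using bsum_split[OF assms(2), of "\<lambda>_. p x" "\<lambda>_. dim.proj_compl p x"] dim.proj_split[OF assms(1) x]
    by blast
  have "p x \<in> dim.polar (dim.polar (p ` dim_set sim))"
    unfolding dim.proj_image_polar[OF assms(1)] using x by blast
  hence "\<sigma>\<^sub>1 \<in> p ` dim_set sim" using bsum_polar[OF s(1)] dim.proj_image_polar[OF assms(1)] by blast
  hence 1: "p \<sigma>\<^sub>1 = \<sigma>\<^sub>1" using dim.proj_image_iff(1)[OF assms(1)] dim.add_closed[OF s(3)] by blast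
  have "dim.proj_compl p x \<in> dim.polar (p ` dim_set sim)"
    using dim.proj_compl_projection(2)[OF assms(1)] x by blast
  hence "\<sigma>\<^sub>2 \<in> dim.polar (p ` dim_set sim)" using bsum_polar[OF s(2)] by blast
  hence 2: "p \<sigma>\<^sub>2 = cls lzero" using dim.proj_of_compl_image[OF assms(1)] by blast
  have "p m = \<sigma>\<^sub>1" using dim.proj_add[OF assms(1) s(3)] 1 2 dim.comm dim.zero_add by metis
  thus ?thesis using s(1) by simp
qed

lemma bsum_const_exhaust:
  assumes "x \<in> dim_set sim" "y \<in> dim_set sim" "x \<noteq> cls lzero"
  shows "\<exists>(I :: ('a set \<Rightarrow> 'a) set) m r. bsum I (\<lambda>_. x) m \<and> dim_add perp sim m r y \<and> \<not> dim.le x r"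
proof -
  obtain E :: "('a set \<Rightarrow> 'a) set" and \<alpha> m r where e:
    "\<And>i. i \<in> E \<Longrightarrow> \<alpha> i \<in> {x}" "bsum E \<alpha> m" "\<And>z. z \<in> {y} \<Longrightarrow> dim_add perp sim m (r z) z"
    "\<And>w. w \<in> {x} \<Longrightarrow> \<forall>z\<in>{y}. dim.le w (r z) \<Longrightarrow> w = cls lzero"
    by (rule exhaustion[of "{y}" "{x}"]) (use assms in auto)
  have "bsum E (\<lambda>_. x) m" using e(2) bsum_cong[of E \<alpha> "\<lambda>_. x" m] e(1) by blast
  thus ?thesis using e(3)[of y] e(4)[of x] assms(3) by blast
qed

lemma bsum_const_finite:
  assumes "dim.purely_infinite x" "finite I" "bsum I (\<lambda>_. x) m"
  shows "dim.le m x"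
  using assms(2,3)
proof (induction I arbitrary: m rule: finite_induct)
  case empty
  hence "m = cls lzero" by (simp add: bsum_empty)
  thus ?case using dim.zero_le assms(1) unfolding dim.purely_infinite_def by blast
next
  case (insert i I)
  have "x \<in> dim_set sim" using assms(1) unfolding dim.purely_infinite_def by blast
  moreover obtain \<tau> where "bsum I (\<lambda>_. x) \<tau>" "dim_add perp sim \<tau> x m"
    using bsum_insert[OF insert.prems insert.hyps(2)] .
  ultimately show ?case using insert.IH dim.purely_infinite_add_le[OF assms(1)] dim.le_refl by blast
qed

text \<open>\<open>I\<close> copies of \<open>J\<close> copies are indexed by
  \<open>I \<times> J\<close>, which is equipotent to \<open>J\<close> since \<open>J\<close> is
  infinite and \<open>I\<close> is nonempty and no larger.\<close>

lemma bsum_const_absorb: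
  assumes "infinite I" "I \<lesssim> J" "bsum I (\<lambda>_. y) w" "bsum J (\<lambda>_. x) y"
  shows "w = y"
proof -
  have le: "(card_of I, card_of J) \<in> ordLeq" using assms(2) unfolding lepoll_def card_of_ordLeq .
  have "infinite J" using assms(1,2) finite_lepoll_infinite finite_subset unfolding lepoll_def
    by (meson finite_imageD)
  hence "(card_of (I \<times> J), card_of J) \<in> ordIso"
    using card_of_Times_infinite[OF _ infinite_imp_nonempty[OF assms(1)] le] by blast
  hence eq: "I \<times> J \<approx> J" unfolding eqpoll_def card_of_ordIso .
  have "bsum (Sigma I (\<lambda>_. J)) (\<lambda>(i, j). x) w" using bsum_Sigma[OF assms(3,4)] .
  hence "bsum (I \<times> J) (\<lambda>_. x) w" by (simp add: case_prod_unfold)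
  hence "bsum J (\<lambda>_. x) w" by (rule bsum_const_eqpoll[OF eq])
  thus ?thesis using bsum_unique assms(4) by blast
qed

end

text \<open>The index type is that of the choice functions produced by \<open>exhaustion\<close>; in
  the descent argument all multiplicities are compared within it.\<close>

sublocale espalier \<subseteq> dim: cardinal_monoid "dim_set sim" "dim_add perp sim" "dim_class sim lzero"
  "\<lambda>I x. bsum (I :: ('a set \<Rightarrow> 'a) set) (\<lambda>_. x)"
  by unfold_locales
    (fact dim_le_local dim_common_part dim_finite_infinite bsum_const_proj bsum_const_exhaust
      bsum_const_finite bsum_infinite_absorb bsum_const_absorb)+

theorem theoremA:
  fixes perp sim :: "'a::order \<Rightarrow> 'a \<Rightarrow> bool"
  assumes "espalier perp sim"
  shows "continuous_dimension_scale (dim_set sim) (dim_add perp sim) (dim_class sim lzero)"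
proof -
  interpret espalier perp sim by fact
  show ?thesis by (rule dim.continuous)
qed

end
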